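(* Let $M$ be a compact Hausdorff space with $\dim M\le 2$ and $\mathrm{H}^2(M,\mathbb Z)\cong 0$. Then $C(M)$ is approximately diagonal (AD). Precisely, let $n\ge 2$, let $A$ be a self-adjoint element of $\mathrm{M}_n(C(M))$, and for each $x\in M$ let $\lambda_1(x)\ge\cdots\ge\lambda_n(x)$ be the eigenvalues of $A(x)$, ordered non-increasingly and counted with multiplicity. Then for any $\epsilon>0$ there is $U\in U_n(C(M))$ such that $$\|U^*(x)A(x)U(x)-\mathrm{diag}(\lambda_1(x),\dots,\lambda_n(x))\|<\epsilon\quad\text{for all } x\in M.$$
   Context: $C(M)$ is the unital $C^*$-algebra of continuous complex-valued functions on $M$; elements of $\mathrm{M}_n(C(M))$ are identified with continuous maps $M\to \mathrm{M}_n(\mathbb C)$. For a unital $C^*$-algebra $\mathcal A$, $\mathrm{M}_n(\mathcal A)$ is the $C^*$-algebra of $n\times n$ matrices over $\mathcal A$ and $U_n(\mathcal A)$ is its unitary group. An element $A\in \mathrm{M}_n(\mathcal A)$ ($n\ge 2$) is approximately diagonalizable if for every $\epsilon>0$ there are $U\in U_n(\mathcal A)$ and $a_1,\dots,a_n\in\mathcal A$ such that $\|UAU^*-\mathrm{diag}(a_1,\dots,a_n)\|<\epsilon$. The algebra $\mathcal A$ is approximately diagonal (AD) if for every $n\ge 2$ every self-adjoint element of $\mathrm{M}_n(\mathcal A)$ is approximately diagonalizable. $\dim M$ is the covering dimension; for a compact Hausdorff space, $\dim M\le n$ iff for every closed subset $A\subset M$ every continuous map $A\to \mathbf{S}^n$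 (the $n$-sphere) extends continuously to $M$. $\mathrm{H}^n(M,\mathbb Z)$ is the $n$-th Čech cohomology group of $M$ with integer coefficients. *)

theory Defs
  imports
    "HOL-Analysis.T1_Spaces"
    "HOL-Algebra.Elementary_Groups"
    "Jordan_Normal_Form.Schur_Decomposition"
begin

section \<open>Covering dimension\<close>

definition open_cover :: "'a topology \<Rightarrow> 'a set set \<Rightarrow> bool" where
  "open_cover M C \<longleftrightarrow> (\<forall>U\<in>C. openin M U) \<and> \<Union>C = topspace M"

definition refinement_map :: "'a set set \<Rightarrow> 'a set set \<Rightarrow> ('a set \<Rightarrow> 'a set) \<Rightarrow> bool" where
  "refinement_map D C r \<longleftrightarrow> (\<forall>V\<in>D. r V \<in> C \<and> V \<subseteq> r V)"

text \<open>Lebesgue covering dimension at most \<open>n\<close>.  (The relation \<open>dim_le\<close> of HOL-Analysis is the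
  small inductive dimension.)\<close>

definition covering_dim_le :: "'a topology \<Rightarrow> nat \<Rightarrow> bool" where
  "covering_dim_le M n \<longleftrightarrow>
     (\<forall>C. finite C \<and> open_cover M C \<longrightarrow>
       (\<exists>D. finite D \<and> open_cover M D \<and> (\<forall>V\<in>D. \<exists>U\<in>C. V \<subseteq> U) \<and>
            (\<forall>x\<in>topspace M. card {V\<in>D. x \<in> V} \<le> n + 1)))"


section \<open>Cech cohomology with integer coefficients\<close>

text \<open>A \<open>p\<close>-simplex of the nerve of a cover is an ordered \<open>(p+1)\<close>-tuple of members of the cover
  (repetitions allowed) with nonempty intersection.  Cochains are integer functions on the simplices,
  extended by \<open>0\<close> to all lists.\<close>

definition nerve :: "'a set set \<Rightarrow> nat \<Rightarrow> 'a set list set" where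
  "nerve C p = {us. length us = Suc p \<and> set us \<subseteq> C \<and> \<Inter>(set us) \<noteq> {}}"

definition cochains :: "'a set set \<Rightarrow> nat \<Rightarrow> ('a set list \<Rightarrow> int) set" where
  "cochains C p = {f. \<forall>us. us \<notin> nerve C p \<longrightarrow> f us = 0}"

definition coboundary :: "'a set set \<Rightarrow> nat \<Rightarrow> ('a set list \<Rightarrow> int) \<Rightarrow> 'a set list \<Rightarrow> int" where
  "coboundary C p f = (\<lambda>us. if us \<in> nerve C (Suc p)
     then \<Sum>i\<le>Suc p. (-1) ^ i * f (take i us @ drop (Suc i) us) else 0)"

definition cocycles :: "'a set set \<Rightarrow> nat \<Rightarrow> ('a set list \<Rightarrow> int) set" where
  "cocycles C p = {f \<in> cochains C p. coboundary C p f = (\<lambda>_. 0)}"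

definition coboundaries :: "'a set set \<Rightarrow> nat \<Rightarrow> ('a set list \<Rightarrow> int) set" where
  "coboundaries C p = (case p of 0 \<Rightarrow> {\<lambda>_. 0} | Suc q \<Rightarrow> coboundary C q ` cochains C q)"

definition pullback ::
    "'a set set \<Rightarrow> nat \<Rightarrow> ('a set \<Rightarrow> 'a set) \<Rightarrow> ('a set list \<Rightarrow> int) \<Rightarrow> 'a set list \<Rightarrow> int" where
  "pullback D p r f = (\<lambda>vs. if vs \<in> nerve D p then f (map r vs) else 0)"

text \<open>The \<open>p\<close>-th cohomology group of \<open>M\<close> is the direct limit, over all open covers ordered by
  refinement, of the cohomology groups of the nerves: a class is represented by a cocycle on some
  cover, and two cocycles are identified when their pullbacks to some common refinement are
  cohomologous.\<close>

definition cech_cocycles :: "'a topology \<Rightarrow> nat \<Rightarrow> ('a set set \<times> ('a set list \<Rightarrow> int)) set" where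
  "cech_cocycles M p = (SIGMA C:{C. open_cover M C}. cocycles C p)"

definition cech_rel :: "'a topology \<Rightarrow> nat \<Rightarrow>
    (('a set set \<times> ('a set list \<Rightarrow> int)) \<times> ('a set set \<times> ('a set list \<Rightarrow> int))) set" where
  "cech_rel M p = {((C, f), (C', f')).
     (C, f) \<in> cech_cocycles M p \<and> (C', f') \<in> cech_cocycles M p \<and>
     (\<exists>D r r'. open_cover M D \<and> refinement_map D C r \<and> refinement_map D C' r' \<and>
        (\<lambda>vs. pullback D p r f vs - pullback D p r' f' vs) \<in> coboundaries D p)}"

definition cech_cohomology ::
    "'a topology \<Rightarrow> nat \<Rightarrow> ('a set set \<times> ('a set list \<Rightarrow> int)) set monoid" where
  "cech_cohomology M p = \<lparr>
     carrier = cech_cocycles M p // cech_rel M p,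
     monoid.mult = (\<lambda>X Y. \<Union>{cech_rel M p `` {(C, \<lambda>us. f us + g us)} | C f g. (C, f) \<in> X \<and> (C, g) \<in> Y}),
     monoid.one = cech_rel M p `` {({topspace M}, \<lambda>_. 0)} \<rparr>"


subsection \<open>The direct limit is an abelian group\<close>

lemma refinement_map_nerve:
  assumes "refinement_map D C r" "vs \<in> nerve D p"
  shows "map r vs \<in> nerve C p"
proof -
  have "\<Inter>(set vs) \<subseteq> \<Inter>(set (map r vs))" "set (map r vs) \<subseteq> C"
    using assms by (auto simp: refinement_map_def nerve_def)
  then show ?thesis using assms(2) by (auto simp: nerve_def)
qed

lemma nerve_face:
  assumes "us \<in> nerve C (Suc p)" "i \<le> Suc p"
  shows "take i us @ drop (Suc i) us \<in> nerve C p"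
proof -
  have "set (take i us @ drop (Suc i) us) \<subseteq> set us"
    using set_take_subset[of i us] set_drop_subset[of "Suc i" us] by simp
  then have "\<Inter>(set us) \<subseteq> \<Inter>(set (take i us @ drop (Suc i) us))"
    and "set (take i us @ drop (Suc i) us) \<subseteq> C"
    using assms(1) unfolding nerve_def by blast+
  moreover have "length (take i us @ drop (Suc i) us) = Suc p"
    using assms by (simp add: nerve_def min_def)
  ultimately show ?thesis using assms(1) unfolding nerve_def by blast
qed

fun ldiff :: "('b list \<Rightarrow> int) \<Rightarrow> 'b list \<Rightarrow> int" where
  "ldiff f [] = 0"
| "ldiff f (u # us) = f us - ldiff (\<lambda>vs. f (u # vs)) us"

fun lprism :: "('c \<Rightarrow> 'b) \<Rightarrow> ('c \<Rightarrow> 'b) \<Rightarrow> ('b list \<Rightarrow> int) \<Rightarrow> 'c list \<Rightarrow> int" where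
  "lprism r s f [] = 0"
| "lprism r s f (u # us) = f (r u # s u # map s us) - lprism r s (\<lambda>vs. f (r u # vs)) us"

lemma ldiff_sum: "ldiff f us = (\<Sum>i<length us. (-1) ^ i * f (take i us @ drop (Suc i) us))"
proof (induction us arbitrary: f)
  case (Cons u us)
  show ?case
    by (simp del: sum.lessThan_Suc add: Cons.IH sum.lessThan_Suc_shift sum_negf)
qed simp

lemma ldiff_diff: "ldiff (\<lambda>us. f us - g us) us = ldiff f us - ldiff g us"
  by (induction us arbitrary: f g) auto

lemma lprism_diff: "lprism r s (\<lambda>us. f us - g us) us = lprism r s f us - lprism r s g us"
  by (induction us arbitrary: f g) auto

lemma ldiff_map: "ldiff (\<lambda>us. f (map r us)) us = ldiff f (map r us)"
  by (induction us arbitrary: f) auto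

lemma lprism_homotopy:
  "ldiff (lprism r s f) us + lprism r s (ldiff f) us = f (map s us) - f (map r us)"
proof (induction us arbitrary: f)
  case (Cons u us)
  show ?case
    using Cons.IH[of "\<lambda>vs. f (r u # vs)"]
    by (simp add: ldiff_diff lprism_diff ldiff_map[of "\<lambda>vs. f (r u # s u # vs)" s us])
qed simp

lemma lprism_zero:
  assumes "\<And>l. length l = Suc (length us) \<Longrightarrow> set l \<subseteq> r ` set us \<union> s ` set us \<Longrightarrow> f l = 0"
  shows "lprism r s f us = 0"
  using assms
proof (induction us arbitrary: f)
  case (Cons u us)
  have "lprism r s (\<lambda>vs. f (r u # vs)) us = 0"
    by (rule Cons.IH, rule Cons.prems) auto
  moreover have "f (r u # s u # map s us) = 0"
    by (rule Cons.prems) auto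
  ultimately show ?case by simp
qed simp

lemma coboundary_ldiff:
  "coboundary C p f = (\<lambda>us. if us \<in> nerve C (Suc p) then ldiff f us else 0)"
proof -
  have "{..Suc p} = {..<length us}" if "us \<in> nerve C (Suc p)" for us
    using that by (auto simp: nerve_def)
  then show ?thesis
    by (intro ext) (simp add: coboundary_def ldiff_sum)
qed

lemma ldiff_cong_nerve:
  assumes "us \<in> nerve C (Suc p)" "\<And>vs. vs \<in> nerve C p \<Longrightarrow> f vs = g vs"
  shows "ldiff f us = ldiff g us"
  unfolding ldiff_sum
proof (rule sum.cong[OF refl])
  fix i assume "i \<in> {..<length us}"
  then have "i \<le> Suc p" using assms(1) by (simp add: nerve_def)
  from assms(2)[OF nerve_face[OF assms(1) this]]
  show "(-1) ^ i * f (take i us @ drop (Suc i) us) = (-1) ^ i * g (take i us @ drop (Suc i) us)"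
    by simp
qed

lemma cochains_diff: "f \<in> cochains C p \<Longrightarrow> g \<in> cochains C p \<Longrightarrow> (\<lambda>us. f us - g us) \<in> cochains C p"
  by (auto simp: cochains_def)

lemma coboundary_diff:
  "coboundary C p (\<lambda>us. f us - g us) = (\<lambda>us. coboundary C p f us - coboundary C p g us)"
  by (auto simp: coboundary_ldiff ldiff_diff)

lemma coboundary_zero: "coboundary C p (\<lambda>_. 0) = (\<lambda>_. 0)"
  by (auto simp: coboundary_def)

lemma zero_coboundaries: "(\<lambda>_. 0) \<in> coboundaries C p"
proof (cases p)
  case (Suc q)
  have "(\<lambda>_. 0) \<in> cochains C q" by (simp add: cochains_def)
  then show ?thesis unfolding coboundaries_def Suc nat.case
    using coboundary_zero[of C q] by (metis image_eqI)
qed (simp add: coboundaries_def)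

lemma coboundaries_diff:
  assumes "f \<in> coboundaries C p" "g \<in> coboundaries C p"
  shows "(\<lambda>us. f us - g us) \<in> coboundaries C p"
proof (cases p)
  case 0
  then show ?thesis using assms by (simp add: coboundaries_def)
next
  case (Suc q)
  then obtain a b where "a \<in> cochains C q" "b \<in> cochains C q"
    and "f = coboundary C q a" "g = coboundary C q b"
    using assms by (auto simp: coboundaries_def)
  then have "(\<lambda>us. f us - g us) = coboundary C q (\<lambda>us. a us - b us)"
    and "(\<lambda>us. a us - b us) \<in> cochains C q"
    by (simp_all add: coboundary_diff cochains_diff)
  then show ?thesis unfolding coboundaries_def Suc nat.case by (rule image_eqI)
qed

lemma coboundaries_minus: "f \<in> coboundaries C p \<Longrightarrow> (\<lambda>us. - f us) \<in> coboundaries C p"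
  using coboundaries_diff[OF zero_coboundaries] by fastforce

lemma coboundaries_add:
  assumes "f \<in> coboundaries C p" "g \<in> coboundaries C p"
  shows "(\<lambda>us. f us + g us) \<in> coboundaries C p"
  using coboundaries_diff[OF assms(1) coboundaries_minus[OF assms(2)]] by simp

lemma zero_cocycles: "(\<lambda>_. 0) \<in> cocycles C p"
  by (simp add: cocycles_def cochains_def coboundary_zero)

lemma cocycles_diff:
  "f \<in> cocycles C p \<Longrightarrow> g \<in> cocycles C p \<Longrightarrow> (\<lambda>us. f us - g us) \<in> cocycles C p"
  by (simp add: cocycles_def cochains_diff coboundary_diff)

lemma cocycles_minus: "f \<in> cocycles C p \<Longrightarrow> (\<lambda>us. - f us) \<in> cocycles C p"
  using cocycles_diff[OF zero_cocycles] by fastforce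

lemma cocycles_add:
  "f \<in> cocycles C p \<Longrightarrow> g \<in> cocycles C p \<Longrightarrow> (\<lambda>us. f us + g us) \<in> cocycles C p"
  using cocycles_diff[OF _ cocycles_minus] by fastforce

lemma pullback_coboundary:
  assumes "refinement_map D C r"
  shows "pullback D (Suc p) r (coboundary C p f) = coboundary D p (pullback D p r f)"
proof
  fix vs
  show "pullback D (Suc p) r (coboundary C p f) vs = coboundary D p (pullback D p r f) vs"
  proof (cases "vs \<in> nerve D (Suc p)")
    case True
    have "ldiff (pullback D p r f) vs = ldiff (\<lambda>us. f (map r us)) vs"
      by (rule ldiff_cong_nerve[OF True]) (simp add: pullback_def)
    then show ?thesis
      using True refinement_map_nerve[OF assms True]
      by (simp add: pullback_def coboundary_ldiff ldiff_map)
  qed (simp add: pullback_def coboundary_ldiff)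
qed

lemma pullback_cochain: "pullback D p r f \<in> cochains D p"
  by (simp add: pullback_def cochains_def)

lemma pullback_zero [simp]: "pullback D p r (\<lambda>_. 0) = (\<lambda>_. 0)"
  by (auto simp: pullback_def)

lemma pullback_cocycle:
  assumes "refinement_map D C r" "f \<in> cocycles C p"
  shows "pullback D p r f \<in> cocycles D p"
  using assms pullback_coboundary[OF assms(1), of p f]
  by (simp add: cocycles_def pullback_cochain)

lemma pullback_coboundaries:
  assumes "refinement_map D C r" "f \<in> coboundaries C p"
  shows "pullback D p r f \<in> coboundaries D p"
proof (cases p)
  case 0
  then show ?thesis using assms by (simp add: coboundaries_def)
next
  case (Suc q)
  then show ?thesis using assms pullback_coboundary[OF assms(1), of q]
    by (auto simp: coboundaries_def intro: pullback_cochain)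
qed

lemma pullback_pullback:
  assumes "refinement_map E D s"
  shows "pullback E p s (pullback D p r f) = pullback E p (r \<circ> s) f"
  using refinement_map_nerve[OF assms] by (auto simp: pullback_def)

lemma refinement_map_comp:
  "refinement_map E D s \<Longrightarrow> refinement_map D C r \<Longrightarrow> refinement_map E C (r \<circ> s)"
  by (fastforce simp: refinement_map_def)

lemma refinement_maps_cohomologous:
  assumes r: "refinement_map D C r" and s: "refinement_map D C s" and f: "f \<in> cocycles C p"
  shows "(\<lambda>us. pullback D p s f us - pullback D p r f us) \<in> coboundaries D p"
proof -
  have prism: "lprism r s (ldiff f) vs = 0" if vs: "vs \<in> nerve D p" for vs
  proof (rule lprism_zero)
    fix l assume l: "length l = Suc (length vs)" "set l \<subseteq> r ` set vs \<union> s ` set vs"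
    have *: "V \<subseteq> r V \<and> V \<subseteq> s V \<and> r V \<in> C \<and> s V \<in> C" if "V \<in> set vs" for V
      using that vs r s by (auto simp: nerve_def refinement_map_def)
    have **: "U \<in> C \<and> (\<exists>V\<in>set vs. V \<subseteq> U)" if "U \<in> set l" for U
    proof -
      from that l(2) obtain V where "V \<in> set vs" "U = r V \<or> U = s V" by blast
      then show ?thesis using *[of V] by auto
    qed
    have "\<Inter>(set vs) \<subseteq> \<Inter>(set l)"
    proof (rule Inter_greatest)
      fix U assume "U \<in> set l"
      then obtain V where "V \<in> set vs" "V \<subseteq> U" using ** by blast
      then show "\<Inter>(set vs) \<subseteq> U" by blast
    qed
    moreover have "set l \<subseteq> C" using ** by blast
    ultimately have "l \<in> nerve C (Suc p)"
      using vs l(1) unfolding nerve_def by auto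
    moreover have "coboundary C p f l = 0" using f by (simp add: cocycles_def)
    ultimately show "ldiff f l = 0" by (simp add: coboundary_ldiff)
  qed
  have eq: "ldiff (lprism r s f) vs = pullback D p s f vs - pullback D p r f vs"
    if "vs \<in> nerve D p" for vs
    using lprism_homotopy[of r s f vs] prism[OF that] that by (simp add: pullback_def)
  show ?thesis
  proof (cases p)
    case 0
    have "pullback D p s f vs - pullback D p r f vs = 0" for vs
    proof (cases "vs \<in> nerve D p")
      case True
      then obtain u where "vs = [u]" using 0 by (auto simp: nerve_def length_Suc_conv)
      then show ?thesis using eq[OF True] by simp
    qed (simp add: pullback_def)
    then show ?thesis using 0 by (simp add: coboundaries_def)
  next
    case (Suc q)
    define h where "h = (\<lambda>vs. if vs \<in> nerve D q then lprism r s f vs else 0)"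
    have "coboundary D q h vs = pullback D p s f vs - pullback D p r f vs" for vs
    proof (cases "vs \<in> nerve D p")
      case True
      have "ldiff h vs = ldiff (lprism r s f) vs"
        by (rule ldiff_cong_nerve[of _ D q]) (use True Suc in \<open>auto simp: h_def\<close>)
      then show ?thesis using True eq[OF True] Suc by (simp add: coboundary_ldiff)
    qed (use Suc in \<open>simp add: coboundary_ldiff pullback_def\<close>)
    then have "(\<lambda>us. pullback D p s f us - pullback D p r f us) = coboundary D q h"
      by (intro ext) simp
    moreover have "h \<in> cochains D q" by (simp add: h_def cochains_def)
    ultimately show ?thesis unfolding coboundaries_def Suc nat.case by (rule image_eqI)
  qed
qed

lemma common_refinement:
  assumes "open_cover M C" "open_cover M D"
  obtains E r s where "open_cover M E" "refinement_map E C r" "refinement_map E D s"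
proof -
  define E where "E = {U \<inter> V | U V. U \<in> C \<and> V \<in> D}"
  have "open_cover M E" unfolding open_cover_def
  proof
    show "\<forall>U\<in>E. openin M U" using assms by (auto simp: E_def open_cover_def)
    have "\<Union>E = \<Union>C \<inter> \<Union>D" unfolding E_def by blast
    then show "\<Union>E = topspace M" using assms by (simp add: open_cover_def)
  qed
  moreover have "\<exists>r. refinement_map E C r" "\<exists>s. refinement_map E D s"
    unfolding refinement_map_def E_def by (rule bchoice, blast)+
  ultimately show ?thesis using that by blast
qed

lemma cech_rel_all:
  assumes "((C, f), (C', f')) \<in> cech_rel M p"
  shows "\<exists>D. open_cover M D \<and> (\<forall>E t r r'.
    refinement_map E D t \<longrightarrow> refinement_map E C r \<longrightarrow> refinement_map E C' r' \<longrightarrow>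
      (\<lambda>vs. pullback E p r f vs - pullback E p r' f' vs) \<in> coboundaries E p)"
proof -
  obtain D a a' where D: "open_cover M D" "refinement_map D C a" "refinement_map D C' a'"
    and b: "(\<lambda>vs. pullback D p a f vs - pullback D p a' f' vs) \<in> coboundaries D p"
    and f: "f \<in> cocycles C p" and f': "f' \<in> cocycles C' p"
    using assms by (auto simp: cech_rel_def cech_cocycles_def)
  have "(\<lambda>vs. pullback E p r f vs - pullback E p r' f' vs) \<in> coboundaries E p"
    if t: "refinement_map E D t" and r: "refinement_map E C r" and r': "refinement_map E C' r'"
    for E t r r'
  proof -
    have "pullback E p t (\<lambda>vs. pullback D p a f vs - pullback D p a' f' vs)
        = (\<lambda>vs. pullback E p (a \<circ> t) f vs - pullback E p (a' \<circ> t) f' vs)"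
      unfolding pullback_pullback[OF t, symmetric] by (auto simp: pullback_def)
    then have 1: "(\<lambda>vs. pullback E p (a \<circ> t) f vs - pullback E p (a' \<circ> t) f' vs) \<in> coboundaries E p"
      using pullback_coboundaries[OF t b] by simp
    have 2: "(\<lambda>vs. pullback E p r f vs - pullback E p (a \<circ> t) f vs) \<in> coboundaries E p"
      by (rule refinement_maps_cohomologous[OF refinement_map_comp[OF t D(2)] r f])
    have 3: "(\<lambda>vs. pullback E p (a' \<circ> t) f' vs - pullback E p r' f' vs) \<in> coboundaries E p"
      by (rule refinement_maps_cohomologous[OF r' refinement_map_comp[OF t D(3)] f'])
    show ?thesis
      using coboundaries_add[OF coboundaries_add[OF 2 1] 3] by simp
  qed
  then show ?thesis using D(1) by blast
qed

lemma cech_relI: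
  assumes "open_cover M C" "f \<in> cocycles C p" "open_cover M C'" "f' \<in> cocycles C' p"
    "open_cover M D" "refinement_map D C r" "refinement_map D C' r'"
    "(\<lambda>vs. pullback D p r f vs - pullback D p r' f' vs) \<in> coboundaries D p"
  shows "((C, f), (C', f')) \<in> cech_rel M p"
  using assms by (auto simp: cech_rel_def cech_cocycles_def)

lemma cech_relD:
  assumes "((C, f), (C', f')) \<in> cech_rel M p"
  shows "open_cover M C" "f \<in> cocycles C p" "open_cover M C'" "f' \<in> cocycles C' p"
  using assms by (auto simp: cech_rel_def cech_cocycles_def)

lemma refinement_map_id: "refinement_map C C id"
  by (simp add: refinement_map_def)

lemma cech_rel_pullback:
  assumes "open_cover M C" "f \<in> cocycles C p" "open_cover M D" "refinement_map D C r"
  shows "((C, f), (D, pullback D p r f)) \<in> cech_rel M p"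
  by (rule cech_relI[OF assms(1,2,3) pullback_cocycle[OF assms(4,2)] assms(3,4) refinement_map_id])
    (simp add: pullback_pullback[OF refinement_map_id] zero_coboundaries)

lemma cech_rel_equiv: "equiv (cech_cocycles M p) (cech_rel M p)"
proof (rule equivI)
  show "cech_rel M p \<subseteq> cech_cocycles M p \<times> cech_cocycles M p"
    by (auto simp: cech_rel_def)
  show "refl_on (cech_cocycles M p) (cech_rel M p)"
  proof (rule refl_onI)
    fix x assume "x \<in> cech_cocycles M p"
    then obtain C f where "x = (C, f)" "open_cover M C" "f \<in> cocycles C p"
      by (auto simp: cech_cocycles_def)
    then show "(x, x) \<in> cech_rel M p"
      using cech_relI[OF _ _ _ _ _ refinement_map_id refinement_map_id, of M C f p f]
      by (simp add: zero_coboundaries)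
  qed
  show "sym (cech_rel M p)"
  proof (rule symI)
    fix x y assume "(x, y) \<in> cech_rel M p"
    moreover obtain C f C' f' where [simp]: "x = (C, f)" "y = (C', f')" by fastforce
    ultimately obtain D r r' where "open_cover M D" "refinement_map D C r" "refinement_map D C' r'"
      and b: "(\<lambda>vs. pullback D p r f vs - pullback D p r' f' vs) \<in> coboundaries D p"
      and "(C, f) \<in> cech_cocycles M p" "(C', f') \<in> cech_cocycles M p"
      by (auto simp: cech_rel_def)
    then show "(y, x) \<in> cech_rel M p"
      using coboundaries_minus[OF b] by (auto simp: cech_rel_def)
  qed
  show "trans (cech_rel M p)"
  proof (rule transI)
    fix x y z assume xy: "(x, y) \<in> cech_rel M p" and yz: "(y, z) \<in> cech_rel M p"
    obtain C f where x: "x = (C, f)" by (cases x)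
    obtain C' f' where y: "y = (C', f')" by (cases y)
    obtain C'' f'' where z: "z = (C'', f'')" by (cases z)
    note xy = xy[unfolded x y] and yz = yz[unfolded y z]
    obtain D1 where D1: "open_cover M D1"
      and all1: "\<forall>E t r r'. refinement_map E D1 t \<longrightarrow> refinement_map E C r \<longrightarrow> refinement_map E C' r' \<longrightarrow>
        (\<lambda>vs. pullback E p r f vs - pullback E p r' f' vs) \<in> coboundaries E p"
      using cech_rel_all[OF xy] by blast
    note * = all1[rule_format]
    obtain D2 where D2: "open_cover M D2"
      and all2: "\<forall>E t r r'. refinement_map E D2 t \<longrightarrow> refinement_map E C' r \<longrightarrow> refinement_map E C'' r' \<longrightarrow>
        (\<lambda>vs. pullback E p r f' vs - pullback E p r' f'' vs) \<in> coboundaries E p"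
      using cech_rel_all[OF yz] by blast
    note ** = all2[rule_format]
    have C: "open_cover M C" "f \<in> cocycles C p" "open_cover M C'" "f' \<in> cocycles C' p"
      "open_cover M C''" "f'' \<in> cocycles C'' p"
      using cech_relD[OF xy] cech_relD[OF yz] by auto
    obtain E1 a1 b1 where E1: "open_cover M E1" "refinement_map E1 D1 a1" "refinement_map E1 D2 b1"
      using common_refinement[OF D1 D2] .
    obtain E2 a2 b2 where E2: "open_cover M E2" "refinement_map E2 C a2" "refinement_map E2 C' b2"
      using common_refinement[OF C(1,3)] .
    obtain E3 a3 b3 where E3: "open_cover M E3" "refinement_map E3 E1 a3" "refinement_map E3 E2 b3"
      using common_refinement[OF E1(1) E2(1)] .
    obtain E a b where E: "open_cover M E" "refinement_map E E3 a" "refinement_map E C'' b"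
      using common_refinement[OF E3(1) C(5)] .
    note rm = refinement_map_comp
    have D1': "refinement_map E D1 (a1 \<circ> (a3 \<circ> a))" and D2': "refinement_map E D2 (b1 \<circ> (a3 \<circ> a))"
      and C': "refinement_map E C (a2 \<circ> (b3 \<circ> a))" "refinement_map E C' (b2 \<circ> (b3 \<circ> a))"
      using rm[OF rm[OF E(2) E3(2)] E1(2)] rm[OF rm[OF E(2) E3(2)] E1(3)]
        rm[OF rm[OF E(2) E3(3)] E2(2)] rm[OF rm[OF E(2) E3(3)] E2(3)] by auto
    show "(x, z) \<in> cech_rel M p"
      using cech_relI[OF C(1,2,5,6) E(1) C'(1) E(3)]
        coboundaries_add[OF *[OF D1' C'] **[OF D2' C'(2) E(3)]] by (simp add: x z)
  qed
qed

lemma cech_rel_add: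
  assumes f: "((C, f), (C', f')) \<in> cech_rel M p" and g: "((C, g), (C', g')) \<in> cech_rel M p"
  shows "((C, \<lambda>us. f us + g us), (C', \<lambda>us. f' us + g' us)) \<in> cech_rel M p"
proof -
  obtain D1 where D1: "open_cover M D1"
    and all1: "\<forall>E t r r'. refinement_map E D1 t \<longrightarrow> refinement_map E C r \<longrightarrow> refinement_map E C' r' \<longrightarrow>
      (\<lambda>vs. pullback E p r f vs - pullback E p r' f' vs) \<in> coboundaries E p"
    using cech_rel_all[OF f] by blast
  note * = all1[rule_format]
  obtain D2 where D2: "open_cover M D2"
    and all2: "\<forall>E t r r'. refinement_map E D2 t \<longrightarrow> refinement_map E C r \<longrightarrow> refinement_map E C' r' \<longrightarrow>
      (\<lambda>vs. pullback E p r g vs - pullback E p r' g' vs) \<in> coboundaries E p"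
    using cech_rel_all[OF g] by blast
  note ** = all2[rule_format]
  note C = cech_relD[OF f] and G = cech_relD[OF g]
  obtain E1 a1 b1 where E1: "open_cover M E1" "refinement_map E1 D1 a1" "refinement_map E1 D2 b1"
    using common_refinement[OF D1 D2] .
  obtain E2 a2 b2 where E2: "open_cover M E2" "refinement_map E2 C a2" "refinement_map E2 C' b2"
    using common_refinement[OF C(1,3)] .
  obtain E a b where E: "open_cover M E" "refinement_map E E1 a" "refinement_map E E2 b"
    using common_refinement[OF E1(1) E2(1)] .
  note rm = refinement_map_comp
  note r = rm[OF E(3) E2(2)] and r' = rm[OF E(3) E2(3)]
  have "(\<lambda>vs. pullback E p (a2 \<circ> b) (\<lambda>us. f us + g us) vs
      - pullback E p (b2 \<circ> b) (\<lambda>us. f' us + g' us) vs) =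
      (\<lambda>vs. (pullback E p (a2 \<circ> b) f vs - pullback E p (b2 \<circ> b) f' vs)
        + (pullback E p (a2 \<circ> b) g vs - pullback E p (b2 \<circ> b) g' vs))"
    by (auto simp: pullback_def)
  also have "\<dots> \<in> coboundaries E p"
    by (rule coboundaries_add[OF *[OF rm[OF E(2) E1(2)] r r'] **[OF rm[OF E(2) E1(3)] r r']])
  finally show ?thesis
    using cech_relI[OF C(1) cocycles_add[OF C(2) G(2)] C(3) cocycles_add[OF C(4) G(4)] E(1) r r']
    by simp
qed

abbreviation cech_class where "cech_class M p C f \<equiv> cech_rel M p `` {(C, f)}"

lemma cech_class_eq_iff:
  assumes "open_cover M C" "f \<in> cocycles C p" "open_cover M C'" "f' \<in> cocycles C' p"
  shows "cech_class M p C f = cech_class M p C' f' \<longleftrightarrow> ((C, f), (C', f')) \<in> cech_rel M p"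
  using assms eq_equiv_class_iff[OF cech_rel_equiv, of "(C, f)" M p "(C', f')"]
  by (auto simp: cech_cocycles_def)

lemma cech_class_mult:
  assumes C: "open_cover M C" and f: "f \<in> cocycles C p" and g: "g \<in> cocycles C p"
  shows "cech_class M p C f \<otimes>\<^bsub>cech_cohomology M p\<^esub> cech_class M p C g
    = cech_class M p C (\<lambda>us. f us + g us)"
proof -
  have "cech_class M p C' (\<lambda>us. f' us + g' us) = cech_class M p C (\<lambda>us. f us + g us)"
    if f': "((C, f), (C', f')) \<in> cech_rel M p" and g': "((C, g), (C', g')) \<in> cech_rel M p" for C' f' g'
    using equiv_class_eq[OF cech_rel_equiv cech_rel_add[OF f' g']] by simp
  moreover have "((C, f), (C, f)) \<in> cech_rel M p" "((C, g), (C, g)) \<in> cech_rel M p"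
    using C f g equiv_class_self[OF cech_rel_equiv] by (auto simp: cech_cocycles_def)
  ultimately have "{cech_class M p C' (\<lambda>us. f' us + g' us) | C' f' g'.
      (C', f') \<in> cech_class M p C f \<and> (C', g') \<in> cech_class M p C g}
      = {cech_class M p C (\<lambda>us. f us + g us)}"
    unfolding Image_singleton_iff by blast
  then show ?thesis by (simp add: cech_cohomology_def)
qed

lemma cech_class_carrier:
  "open_cover M C \<Longrightarrow> f \<in> cocycles C p \<Longrightarrow> cech_class M p C f \<in> carrier (cech_cohomology M p)"
  by (auto simp: cech_cohomology_def cech_cocycles_def intro!: quotientI)

lemma cech_class_cases:
  assumes "X \<in> carrier (cech_cohomology M p)"
  obtains C f where "open_cover M C" "f \<in> cocycles C p" "X = cech_class M p C f"
  using assms by (auto simp: cech_cohomology_def cech_cocycles_def elim!: quotientE)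

lemma cech_class_pullback:
  assumes "open_cover M C" "f \<in> cocycles C p" "open_cover M D" "refinement_map D C r"
  shows "cech_class M p C f = cech_class M p D (pullback D p r f)"
  using equiv_class_eq[OF cech_rel_equiv cech_rel_pullback[OF assms]] .

lemma cech_class_common2:
  assumes "X \<in> carrier (cech_cohomology M p)" "Y \<in> carrier (cech_cohomology M p)"
  obtains C f g where "open_cover M C" "f \<in> cocycles C p" "g \<in> cocycles C p"
    "X = cech_class M p C f" "Y = cech_class M p C g"
proof -
  obtain A f where A: "open_cover M A" "f \<in> cocycles A p" "X = cech_class M p A f"
    using cech_class_cases[OF assms(1)] .
  obtain B g where B: "open_cover M B" "g \<in> cocycles B p" "Y = cech_class M p B g"
    using cech_class_cases[OF assms(2)] .
  obtain C r s where C: "open_cover M C" "refinement_map C A r" "refinement_map C B s"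
    using common_refinement[OF A(1) B(1)] .
  show ?thesis
    using that[OF C(1) pullback_cocycle[OF C(2) A(2)] pullback_cocycle[OF C(3) B(2)]]
      cech_class_pullback[OF A(1,2) C(1,2)] cech_class_pullback[OF B(1,2) C(1,3)] A(3) B(3) by simp
qed

lemma open_cover_topspace: "open_cover M {topspace M}"
  by (simp add: open_cover_def)

lemma cech_one:
  assumes "open_cover M C"
  shows "\<one>\<^bsub>cech_cohomology M p\<^esub> = cech_class M p C (\<lambda>_. 0)"
proof -
  have r: "refinement_map C {topspace M} (\<lambda>_. topspace M)"
    using assms by (auto simp: refinement_map_def open_cover_def openin_subset)
  show ?thesis
    using cech_class_pullback[OF open_cover_topspace zero_cocycles assms r, of p]
    by (simp add: cech_cohomology_def)
qed

theorem cech_cohomology_comm_group: "comm_group (cech_cohomology M p)"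
proof (rule comm_groupI)
  fix X Y assume X: "X \<in> carrier (cech_cohomology M p)" and Y: "Y \<in> carrier (cech_cohomology M p)"
  obtain C f g where C: "open_cover M C" "f \<in> cocycles C p" "g \<in> cocycles C p"
    and [simp]: "X = cech_class M p C f" "Y = cech_class M p C g"
    using cech_class_common2[OF X Y] .
  show "X \<otimes>\<^bsub>cech_cohomology M p\<^esub> Y \<in> carrier (cech_cohomology M p)"
    using C by (simp add: cech_class_mult cech_class_carrier cocycles_add)
  show "X \<otimes>\<^bsub>cech_cohomology M p\<^esub> Y = Y \<otimes>\<^bsub>cech_cohomology M p\<^esub> X"
    using C by (simp add: cech_class_mult add.commute)
next
  show "\<one>\<^bsub>cech_cohomology M p\<^esub> \<in> carrier (cech_cohomology M p)"
    by (simp add: cech_one[OF open_cover_topspace] cech_class_carrier open_cover_topspace zero_cocycles)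
next
  fix X assume "X \<in> carrier (cech_cohomology M p)"
  then obtain C f where C: "open_cover M C" "f \<in> cocycles C p" and [simp]: "X = cech_class M p C f"
    by (rule cech_class_cases)
  show "\<one>\<^bsub>cech_cohomology M p\<^esub> \<otimes>\<^bsub>cech_cohomology M p\<^esub> X = X"
    using C by (simp add: cech_one[OF C(1)] cech_class_mult zero_cocycles)
  have "cech_class M p C (\<lambda>us. - f us) \<otimes>\<^bsub>cech_cohomology M p\<^esub> X = \<one>\<^bsub>cech_cohomology M p\<^esub>"
    using C by (simp add: cech_one[OF C(1)] cech_class_mult cocycles_minus)
  then show "\<exists>Y\<in>carrier (cech_cohomology M p). Y \<otimes>\<^bsub>cech_cohomology M p\<^esub> X = \<one>\<^bsub>cech_cohomology M p\<^esub>"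
    using cech_class_carrier[OF C(1) cocycles_minus[OF C(2)]] by blast
next
  fix X Y Z assume X: "X \<in> carrier (cech_cohomology M p)" and Y: "Y \<in> carrier (cech_cohomology M p)"
    and Z: "Z \<in> carrier (cech_cohomology M p)"
  obtain A f g where A: "open_cover M A" "f \<in> cocycles A p" "g \<in> cocycles A p"
    and XY: "X = cech_class M p A f" "Y = cech_class M p A g"
    using cech_class_common2[OF X Y] .
  obtain B h where B: "open_cover M B" "h \<in> cocycles B p" "Z = cech_class M p B h"
    using cech_class_cases[OF Z] .
  obtain C r s where C: "open_cover M C" "refinement_map C A r" "refinement_map C B s"
    using common_refinement[OF A(1) B(1)] .
  note P = pullback_cocycle[OF C(2) A(2)] pullback_cocycle[OF C(2) A(3)] pullback_cocycle[OF C(3) B(2)]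
  have "X = cech_class M p C (pullback C p r f)" "Y = cech_class M p C (pullback C p r g)"
    "Z = cech_class M p C (pullback C p s h)"
    using XY B(3) cech_class_pullback[OF A(1,2) C(1,2)] cech_class_pullback[OF A(1,3) C(1,2)]
      cech_class_pullback[OF B(1,2) C(1,3)] by auto
  then show "X \<otimes>\<^bsub>cech_cohomology M p\<^esub> Y \<otimes>\<^bsub>cech_cohomology M p\<^esub> Z
      = X \<otimes>\<^bsub>cech_cohomology M p\<^esub> (Y \<otimes>\<^bsub>cech_cohomology M p\<^esub> Z)"
    using P C(1) by (simp add: cech_class_mult cocycles_add add.assoc)
qed


section \<open>Matrices over \<open>C(M)\<close>\<close>

text \<open>Elements of the algebra of \<open>n \<times> n\<close> matrices over \<open>C(M)\<close> are continuous matrix-valued maps on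
  \<open>topspace M\<close>; values outside \<open>topspace M\<close> are irrelevant.\<close>

definition cont_mat :: "'a topology \<Rightarrow> nat \<Rightarrow> ('a \<Rightarrow> complex mat) set" where
  "cont_mat M n = {A. (\<forall>x\<in>topspace M. A x \<in> carrier_mat n n) \<and>
     (\<forall>i<n. \<forall>j<n. continuous_map M euclidean (\<lambda>x. A x $$ (i, j)))}"

definition cont_self_adjoint :: "'a topology \<Rightarrow> nat \<Rightarrow> ('a \<Rightarrow> complex mat) set" where
  "cont_self_adjoint M n = {A \<in> cont_mat M n. \<forall>x\<in>topspace M. mat_adjoint (A x) = A x}"

definition cont_unitary :: "'a topology \<Rightarrow> nat \<Rightarrow> ('a \<Rightarrow> complex mat) set" where
  "cont_unitary M n = {U \<in> cont_mat M n. \<forall>x\<in>topspace M.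
     U x * mat_adjoint (U x) = 1\<^sub>m n \<and> mat_adjoint (U x) * U x = 1\<^sub>m n}"

definition l2_norm :: "complex vec \<Rightarrow> real" where
  "l2_norm v = sqrt (\<Sum>i<dim_vec v. (cmod (v $ i))\<^sup>2)"

definition op_norm :: "complex mat \<Rightarrow> real" where
  "op_norm B = Sup {l2_norm (B *\<^sub>v v) | v. v \<in> carrier_vec (dim_col B) \<and> l2_norm v \<le> 1}"

text \<open>The \<open>C\<^sup>*\<close>-norm of a continuous matrix-valued map on a compact space; inserting \<open>0\<close> only
  matters for the empty space.\<close>

definition cstar_norm :: "'a topology \<Rightarrow> ('a \<Rightarrow> complex mat) \<Rightarrow> real" where
  "cstar_norm M B = Sup (insert 0 ((\<lambda>x. op_norm (B x)) ` topspace M))"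

definition approx_diagonalizable :: "'a topology \<Rightarrow> nat \<Rightarrow> ('a \<Rightarrow> complex mat) \<Rightarrow> bool" where
  "approx_diagonalizable M n A \<longleftrightarrow>
     (\<forall>\<epsilon>>0. \<exists>U\<in>cont_unitary M n. \<exists>a :: nat \<Rightarrow> 'a \<Rightarrow> complex.
        (\<forall>i<n. continuous_map M euclidean (a i)) \<and>
        cstar_norm M (\<lambda>x. U x * A x * mat_adjoint (U x) - mat_diag n (\<lambda>i. a i x)) < \<epsilon>)"

text \<open>The AD property (every self-adjoint matrix of every size at least 2 is approximately
  diagonalizable), for the particular algebra \<open>C(M)\<close>.\<close>

definition C_approx_diagonal :: "'a topology \<Rightarrow> bool" where
  "C_approx_diagonal M \<longleftrightarrow>
     (\<forall>n\<ge>2. \<forall>A\<in>cont_self_adjoint M n. approx_diagonalizable M n A)"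

text \<open>\<open>l 0 \<ge> \<dots> \<ge> l (n - 1)\<close> are the eigenvalues, listed with (algebraic) multiplicity, of an
  \<open>n \<times> n\<close> matrix whose eigenvalues are real.\<close>

definition ordered_eigenvalues :: "complex mat \<Rightarrow> (nat \<Rightarrow> real) \<Rightarrow> bool" where
  "ordered_eigenvalues B l \<longleftrightarrow>
     (\<forall>i j. i \<le> j \<and> j < dim_row B \<longrightarrow> l j \<le> l i) \<and>
     char_poly B = (\<Prod>i<dim_row B. [:- complex_of_real (l i), 1:])"

end

theory Submission
  imports Defs "HOL-Analysis.Analysis"
begin

text \<open>
  Let \<open>\<lambda>\<close> be the largest eigenvalue of \<open>A\<close> and \<open>T = f (A - \<lambda>)\<close> with \<open>f t = max 0 (t + \<epsilon>)\<close>.  Every nonzero vector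
  \<open>T(x) w\<close> is an approximate eigenvector of \<open>A(x)\<close> for \<open>\<lambda>(x)\<close>, so it suffices to find a continuous \<open>w\<close> with
  \<open>T w\<close> nowhere zero.  On the closed set \<open>K\<close> where all \<open>2 \<times> 2\<close> minors of \<open>T\<close> vanish, \<open>T\<close> has rank one and the
  obstruction is a line bundle on \<open>K\<close>; the integer 2-cocycle of its transition phases, extended by \<open>0\<close>, is a
  cocycle on \<open>M\<close> because \<open>dim M \<le> 2\<close>, hence a coboundary, and \<open>w\<close> exists on \<open>K\<close>.  Off \<open>K\<close> the kernel of \<open>T\<close> has
  real codimension at least 4, so an arbitrary extension of \<open>w\<close> can be perturbed into general position.
  The resulting unit vector field \<open>v\<close> can be kept away from \<open>e\<^sub>0\<close> by the same dimension count; a complex Householder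
  matrix then moves \<open>e\<^sub>0\<close> to \<open>v\<close> continuously, which splits off \<open>\<lambda>\<close> approximately, and one proceeds by induction
  on the size.  Weyl's inequality identifies the diagonal entries with the ordered eigenvalues of \<open>A\<close>.
\<close>

unbundle no vec_syntax

section \<open>General position on two-dimensional compacta\<close>

text \<open>Eigenvalues of \<open>A\<close> may cross, so the spectral projection of the largest one
  jumps and an exact continuous eigenvector need not exist. The cutoff \<open>T\<close> is a
  Lipschitz function of \<open>A - \<lambda>\<close>, hence continuous, and never zero, since it
  takes the value \<open>\<epsilon>\<close> on the top eigenspace. The dimension bound enters in two
  ways. A point lies in at most three members of a suitable cover, so a generic map into C^2 = R^4
  misses any prescribed real line, as 2 + 1 < 4; and a nerve without nondegenerate 3-simplices makes
  every alternating integer 2-cochain a cocycle. Overlaps are cut with an arbitrary closed set and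
  need not be connected; small oscillation of the phases is what keeps the integers constant on
  them. Completing \<open>v\<close> to a continuous unitary frame is a second bundle problem; a unit
  field that avoids a single point of the sphere solves it by a formula. Deflation yields the top
  eigenvalues of successive compressions instead of those of \<open>A\<close>, so the diagonal has
  to be compared with the ordered eigenvalues at every step.\<close>

lemma continuous_map_mult':
  fixes f g :: "'a \<Rightarrow> 'b::real_normed_algebra"
  shows "continuous_map X euclidean f \<Longrightarrow> continuous_map X euclidean g \<Longrightarrow>
    continuous_map X euclidean (\<lambda>x. f x * g x)"
  by (simp add: continuous_map_atin tendsto_mult)

lemma continuous_map_divide':
  fixes f g :: "'a \<Rightarrow> 'b::real_normed_field"
  shows "continuous_map X euclidean f \<Longrightarrow> continuous_map X euclidean g \<Longrightarrow>
    (\<And>x. x \<in> topspace X \<Longrightarrow> g x \<noteq> 0) \<Longrightarrow> continuous_map X euclidean (\<lambda>x. f x / g x)"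
  by (simp add: continuous_map_atin tendsto_divide)

lemma continuous_map_scaleR':
  fixes g :: "'a \<Rightarrow> 'b::real_normed_vector"
  shows "continuous_map X euclidean f \<Longrightarrow> continuous_map X euclidean g \<Longrightarrow>
    continuous_map X euclidean (\<lambda>x. f x *\<^sub>R g x)"
  by (simp add: continuous_map_atin tendsto_scaleR)

lemma continuous_map_euclidean_compose:
  assumes "continuous_map X euclidean f" "continuous_on UNIV h"
  shows "continuous_map X euclidean (\<lambda>x. h (f x))"
  using continuous_map_compose[OF assms(1), of euclidean h] assms(2) by (simp add: o_def)

lemma continuous_map_cnj:
  "continuous_map X euclidean f \<Longrightarrow> continuous_map X euclidean (\<lambda>x. cnj (f x))"
  by (erule continuous_map_euclidean_compose) (intro continuous_intros)

lemma continuous_map_of_real: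
  "continuous_map X euclidean f \<Longrightarrow> continuous_map X euclidean (\<lambda>x. of_real (f x) :: 'b::real_normed_algebra_1)"
  by (erule continuous_map_euclidean_compose) (intro continuous_intros)

lemma continuous_map_Pair_euclidean:
  assumes "continuous_map X euclidean f" "continuous_map X euclidean g"
  shows "continuous_map X euclidean (\<lambda>x. (f x, g x))"
  using assms by (simp add: continuous_map_atin tendsto_Pair)

lemmas cmap_intros = continuous_map_mult' continuous_map_divide' continuous_map_scaleR'
  continuous_map_cnj continuous_map_of_real continuous_map_Pair_euclidean
  continuous_map_add continuous_map_diff continuous_map_sum continuous_map_norm
  continuous_map_minus continuous_map_canonical_const continuous_map_real_max continuous_map_real_pow

lemma normal_space_compact_Hausdorff:
  "compact_space M \<Longrightarrow> Hausdorff_space M \<Longrightarrow> normal_space M"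
  by (simp add: compact_Hausdorff_or_regular_imp_normal_space)

lemma closedin_le_continuous_map:
  fixes f g :: "'a \<Rightarrow> real"
  assumes "continuous_map M euclidean f" "continuous_map M euclidean g"
  shows "closedin M {x \<in> topspace M. f x \<le> g x}"
proof -
  have "continuous_map M euclidean (\<lambda>x. g x - f x)"
    using assms by (intro cmap_intros)
  then have "closedin M {x \<in> topspace M. g x - f x \<in> {0..}}"
    by (rule closedin_continuous_map_preimage) auto
  then show ?thesis by simp
qed

lemma openin_less_continuous_map:
  fixes f g :: "'a \<Rightarrow> real"
  assumes "continuous_map M euclidean f" "continuous_map M euclidean g"
  shows "openin M {x \<in> topspace M. f x < g x}"
proof -
  have "continuous_map M euclidean (\<lambda>x. g x - f x)"
    using assms by (intro cmap_intros)
  then have "openin M {x \<in> topspace M. g x - f x \<in> {0<..}}"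
    by (rule openin_continuous_map_preimage) auto
  then show ?thesis by simp
qed

section \<open>Compactness: bounds, finite subcovers, partitions of unity\<close>

lemma continuous_map_bounded_above:
  fixes f :: "'a \<Rightarrow> real"
  assumes "compact_space M" "continuous_map M euclidean f"
  obtains c where "c > 0" "\<And>x. x \<in> topspace M \<Longrightarrow> f x \<le> c"
proof -
  have "compact (f ` topspace M)"
    using image_compactin[OF _ assms(2)] assms(1) by (simp add: compact_space_def)
  then have "bounded (f ` topspace M)" by (rule compact_imp_bounded)
  then obtain B where "\<forall>y \<in> f ` topspace M. norm y \<le> B" unfolding bounded_iff by blast
  then have "f x \<le> max 1 B" if "x \<in> topspace M" for x using that by force
  then show ?thesis by (rule that[rotated]) auto
qed

lemma continuous_map_bounded_below_pos:
  fixes f :: "'a \<Rightarrow> real"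
  assumes "compact_space M" "continuous_map M euclidean f" "closedin M F"
    and "\<And>x. x \<in> F \<Longrightarrow> f x > 0"
  obtains c where "c > 0" "\<And>x. x \<in> F \<Longrightarrow> c \<le> f x"
proof (cases "F = {}")
  case False
  have "compactin M F" using assms by (simp add: closedin_compact_space)
  then have "compact (f ` F)" using image_compactin[OF _ assms(2)] by simp
  then obtain y where "y \<in> f ` F" "\<forall>z \<in> f ` F. y \<le> z"
    using compact_attains_inf[of "f ` F"] False by auto
  then show ?thesis using assms(4) that[of y] by auto
next
  case True
  then show ?thesis using that[of 1] by auto
qed

lemma finite_open_subcover:
  assumes "compact_space M"
    and "\<And>x. x \<in> topspace M \<Longrightarrow> \<exists>U. P U \<and> openin M U \<and> x \<in> U"
  obtains C where "finite C" "open_cover M C" "\<And>U. U \<in> C \<Longrightarrow> P U"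
proof -
  let ?\<U> = "{U. P U \<and> openin M U}"
  have "\<exists>\<F>. finite \<F> \<and> \<F> \<subseteq> ?\<U> \<and> topspace M \<subseteq> \<Union>\<F>"
    by (rule assms(1)[unfolded compact_space_alt, rule_format]) (use assms(2) in blast)+
  then obtain \<F> where F: "finite \<F>" "\<F> \<subseteq> ?\<U>" "topspace M \<subseteq> \<Union>\<F>" by blast
  have "\<Union>\<F> \<subseteq> topspace M"
    by (rule Union_least) (use F(2) in \<open>auto dest: openin_subset\<close>)
  then have "open_cover M \<F>" using F unfolding open_cover_def by blast
  then show ?thesis using F that by blast
qed

text \<open>The closed sets \<open>S V\<close> are provided so that \<open>\<phi> V\<close> times a
  function defined only on \<open>V\<close> extends continuously by zero. Urysohn functions equal to
  1 at a point and 0 outside a member of the cover are grouped by that member, so the index set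
  stays \<open>C\<close> although the functions come from a finer cover.\<close>

lemma finite_partition_of_unity:
  assumes "compact_space M" "Hausdorff_space M" "finite C" "open_cover M C"
  obtains \<phi> :: "'a set \<Rightarrow> 'a \<Rightarrow> real" and S where
    "\<And>V. V \<in> C \<Longrightarrow> continuous_map M euclidean (\<phi> V)"
    "\<And>V x. V \<in> C \<Longrightarrow> x \<in> topspace M \<Longrightarrow> \<phi> V x \<ge> 0"
    "\<And>x. x \<in> topspace M \<Longrightarrow> (\<Sum>V\<in>C. \<phi> V x) = 1"
    "\<And>V. V \<in> C \<Longrightarrow> closedin M (S V) \<and> S V \<subseteq> V"
    "\<And>V x. V \<in> C \<Longrightarrow> x \<in> topspace M \<Longrightarrow> x \<notin> S V \<Longrightarrow> \<phi> V x = 0"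
proof -
  have nor: "normal_space M" using assms by (simp add: normal_space_compact_Hausdorff)
  define P where "P = (\<lambda>U. \<exists>V f. V \<in> C \<and> continuous_map M euclidean f \<and>
    (\<forall>x\<in>topspace M. x \<notin> V \<longrightarrow> f x = 0) \<and> U \<subseteq> {x\<in>topspace M. f x > (1/2::real)})"
  have "\<exists>U. P U \<and> openin M U \<and> x \<in> U" if x: "x \<in> topspace M" for x
  proof -
    obtain V where V: "V \<in> C" "x \<in> V" "openin M V"
      using x assms(4) by (auto simp: open_cover_def)
    have "closedin M {x}" using assms(2) x
      by (simp add: Hausdorff_imp_t1_space closedin_t1_singleton)
    moreover have "closedin M (topspace M - V)" using V by (simp add: openin_closedin_eq)
    moreover have "disjnt (topspace M - V) {x}" using V by (simp add: disjnt_def)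
    ultimately obtain f where f: "continuous_map M euclideanreal f" "f ` (topspace M - V) \<subseteq> {0}"
      "f ` {x} \<subseteq> {1}"
      using Urysohn_lemma_alt[OF nor, of "topspace M - V" "{x}" 0 1] by blast
    have "openin M {y\<in>topspace M. 1/2 < f y}"
      by (rule openin_less_continuous_map) (use f in \<open>auto intro: cmap_intros\<close>)
    moreover have "P {y\<in>topspace M. 1/2 < f y}"
      unfolding P_def by (rule exI[of _ V], rule exI[of _ f]) (use f V in auto)
    moreover have "x \<in> {y\<in>topspace M. 1/2 < f y}" using f x by auto
    ultimately show ?thesis by blast
  qed
  then obtain D where D: "finite D" "open_cover M D" "\<And>U. U \<in> D \<Longrightarrow> P U"
    using finite_open_subcover[OF assms(1), of P] by blast
  obtain v f where vf: "\<And>U. U \<in> D \<Longrightarrow> v U \<in> C \<and> continuous_map M euclidean (f U) \<and>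
    (\<forall>x\<in>topspace M. x \<notin> v U \<longrightarrow> f U x = 0) \<and> U \<subseteq> {x\<in>topspace M. f U x > (1/2::real)}"
    using D(3) unfolding P_def by metis
  \<comment> \<open>Subtracting 1/2 before truncating puts the support inside the closed set where
    \<open>f U\<close> is at least 1/2, which lies in \<open>v U\<close>. The total stays positive
    because \<open>f U > 1/2\<close> on \<open>U\<close> and the sets \<open>U\<close>
    cover.\<close>
  define g where "g = (\<lambda>V x. \<Sum>U\<in>{U\<in>D. v U = V}. max 0 (f U x - 1/2))"
  define G where "G = (\<lambda>x. \<Sum>V\<in>C. g V x)"
  have gc: "continuous_map M euclidean (g V)" for V
    unfolding g_def by (intro cmap_intros) (use D vf in auto)
  have Gc: "continuous_map M euclidean G"
    unfolding G_def by (intro cmap_intros gc) (use assms in auto)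
  have g0: "g V x \<ge> 0" for V x unfolding g_def by (intro sum_nonneg) auto
  have Gpos: "G x > 0" if x: "x \<in> topspace M" for x
  proof -
    obtain U where U: "U \<in> D" "x \<in> U" using x D(2) by (auto simp: open_cover_def)
    have "0 < max 0 (f U x - 1/2)" using vf[OF U(1)] U by auto
    also have "\<dots> \<le> g (v U) x" unfolding g_def
      by (rule member_le_sum) (use U D in auto)
    also have "\<dots> \<le> G x" unfolding G_def
      by (rule member_le_sum) (use U vf g0 assms in auto)
    finally show ?thesis .
  qed
  define S where "S = (\<lambda>V. \<Union>U\<in>{U\<in>D. v U = V}. {x\<in>topspace M. 1/2 \<le> f U x})"
  show ?thesis
  proof (rule that[of "\<lambda>V x. g V x / G x" S])
    fix V assume V: "V \<in> C"
    show "continuous_map M euclidean (\<lambda>x. g V x / G x)"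
      by (intro cmap_intros gc Gc) (use Gpos in fastforce)
    show "closedin M (S V) \<and> S V \<subseteq> V"
    proof
      show "closedin M (S V)" unfolding S_def
        by (intro closedin_Union) (use D vf in \<open>auto intro!: closedin_le_continuous_map cmap_intros\<close>)
      show "S V \<subseteq> V" unfolding S_def using vf by force
    qed
    fix x assume x: "x \<in> topspace M"
    show "0 \<le> g V x / G x" using g0[of V x] Gpos[OF x] by simp
    show "g V x / G x = 0" if "x \<notin> S V"
    proof -
      have "g V x = 0" unfolding g_def
        by (rule sum.neutral) (use that x in \<open>auto simp: S_def not_le max_def\<close>)
      then show ?thesis by simp
    qed
  next
    fix x assume x: "x \<in> topspace M"
    have "(\<Sum>V\<in>C. g V x / G x) = G x / G x" unfolding G_def sum_divide_distrib ..
    then show "(\<Sum>V\<in>C. g V x / G x) = 1" using Gpos[OF x] by simp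
  qed
qed

text \<open>Vectors are chosen one at a time. A new one must avoid the spans of \<open>e\<close>
  with at most two of its predecessors; these are finitely many subspaces of dimension at most 3,
  hence negligible in dimension at least 4, while a ball is not. The bound 3 on
  \<open>card S\<close> is the order of a cover in dimension 2, and \<open>e\<close> is included so
  that nontrivial combinations avoid a whole line.\<close>

lemma general_position:
  fixes a :: "'i \<Rightarrow> 'e::euclidean_space"
  assumes "finite D" "\<delta> > 0" "DIM('e) \<ge> 4" "e \<noteq> 0"
  obtains c where "\<And>i. i \<in> D \<Longrightarrow> norm (c i - a i) < \<delta>"
    "\<And>S. S \<subseteq> D \<Longrightarrow> card S \<le> 3 \<Longrightarrow> inj_on c S \<and> e \<notin> c ` S \<and> independent (insert e (c ` S))"
proof -
  have "\<exists>c. (\<forall>i\<in>D. norm (c i - a i) < \<delta>) \<and> (\<forall>S. S \<subseteq> D \<longrightarrow> card S \<le> 3 \<longrightarrow>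
    inj_on c S \<and> e \<notin> c ` S \<and> independent (insert e (c ` S)))"
    using assms(1)
  proof induction
    case empty
    show ?case using assms(4) by (auto simp: independent_insert)
  next
    case (insert v D)
    then obtain c where c: "\<forall>i\<in>D. norm (c i - a i) < \<delta>"
      and ind: "\<And>S. S \<subseteq> D \<Longrightarrow> card S \<le> 3 \<Longrightarrow> inj_on c S \<and> e \<notin> c ` S \<and> independent (insert e (c ` S))"
      by blast
    define \<S> where "\<S> = {S. S \<subseteq> D \<and> card S \<le> 2}"
    have "negligible (\<Union>S\<in>\<S>. span (insert e (c ` S)))"
    proof (rule negligible_Union)
      show "finite ((\<lambda>S. span (insert e (c ` S))) ` \<S>)" unfolding \<S>_def using insert by simp
      fix X assume "X \<in> (\<lambda>S. span (insert e (c ` S))) ` \<S>"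
      then obtain S where "S \<in> \<S>" and X: "X = span (insert e (c ` S))" by blast
      then have S: "finite S" "card S \<le> 2" using insert finite_subset by (auto simp: \<S>_def)
      have "dim (insert e (c ` S)) \<le> card (insert e (c ` S))"
        by (rule dim_le_card') (use S in auto)
      also have "\<dots> \<le> Suc (card (c ` S))" by (simp add: S card_insert_le_m1)
      also have "\<dots> \<le> 3" using card_image_le[OF S(1), of c] S by simp
      finally show "negligible X" unfolding X
        by (intro negligible_lowdim) (use assms(3) in \<open>simp add: dim_span\<close>)
    qed
    moreover have "\<not> negligible (ball (a v) \<delta>)"
      using open_not_negligible[of "ball (a v) \<delta>"] assms(2) by simp
    ultimately obtain w where w: "w \<in> ball (a v) \<delta>" "w \<notin> (\<Union>S\<in>\<S>. span (insert e (c ` S)))"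
      using negligible_subset by (metis subsetI)
    define c' where "c' = c(v := w)"
    have c'D: "c' ` S = c ` S" "inj_on c' S = inj_on c S" if "v \<notin> S" for S
      using that by (auto simp: c'_def inj_on_def)
    show ?case
    proof (rule exI[of _ c'], intro conjI ballI allI impI)
      fix i assume "i \<in> insert v D"
      then show "norm (c' i - a i) < \<delta>"
        using c w(1) insert by (auto simp: c'_def dist_norm norm_minus_commute)
    next
      fix S assume S: "S \<subseteq> insert v D" "card S \<le> 3"
      have fS: "finite S" using S insert finite_subset by (metis finite_insert)
      have "inj_on c' S \<and> e \<notin> c' ` S \<and> independent (insert e (c' ` S))"
      proof (cases "v \<in> S")
        case False
        then show ?thesis using ind[of S] S c'D[of S] by auto
      next
        case True
        define R where "R = S - {v}"
        have R: "S = insert v R" "v \<notin> R" "R \<subseteq> D" "card R \<le> 2"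
          using True S fS by (auto simp: R_def)
        have 1: "w \<notin> span (insert e (c ` R))" using w(2) R by (auto simp: \<S>_def)
        have 2: "inj_on c R" "e \<notin> c ` R" "independent (insert e (c ` R))"
          using ind[of R] R by auto
        have 3: "w \<notin> insert e (c ` R)" using 1 span_base[of w "insert e (c ` R)"] by auto
        have 4: "c' ` S = insert w (c ` R)"
          unfolding R(1) image_insert c'D(1)[OF R(2)] by (simp add: c'_def)
        have "inj_on c' S"
          unfolding R(1) inj_on_insert c'D[OF R(2)] using R(2) 2(1) 3 by (auto simp: c'_def)
        moreover have "independent (insert e (insert w (c ` R)))"
          unfolding insert_commute[of e w] using 1 2(3) 3 by (simp add: independent_insert)
        ultimately show ?thesis unfolding 4 using 2 3 by auto
      qed
      then show "inj_on c' S" "e \<notin> c' ` S" "independent (insert e (c' ` S))" by auto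
    qed
  qed
  then show ?thesis using that by blast
qed

text \<open>The perturbed map factors through the nerve of a cover of order at most 3: at each point
  it is a convex combination of at most three vectors that are independent together with
  \<open>e\<close>, and such a combination is never a multiple of \<open>e\<close>. The line passes
  through 0, so zeros are removed as well.\<close>

lemma approximate_avoiding_line:
  fixes h :: "'a \<Rightarrow> 'e::euclidean_space"
  assumes M: "compact_space M" "Hausdorff_space M" "covering_dim_le M 2"
    and h: "continuous_map M euclidean h" and "\<delta> > 0" "DIM('e) \<ge> 4" "e \<noteq> 0"
  obtains h' where "continuous_map M euclidean h'" "\<And>x. x \<in> topspace M \<Longrightarrow> norm (h' x - h x) < \<delta>"
    "\<And>x. x \<in> topspace M \<Longrightarrow> h' x \<notin> span {e}"
proof -
  \<comment> \<open>Half of \<open>\<delta>\<close> is for the oscillation of \<open>h\<close> on a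
    member of the cover, half for moving its value into general position.\<close>
  define P where "P = (\<lambda>U. \<forall>x\<in>U. \<forall>y\<in>U. norm (h x - h y) < \<delta> / 2)"
  have "\<exists>U. P U \<and> openin M U \<and> p \<in> U" if p: "p \<in> topspace M" for p
  proof (rule exI[of _ "{x \<in> topspace M. norm (h x - h p) < \<delta> / 4}"], intro conjI)
    show "openin M {x \<in> topspace M. norm (h x - h p) < \<delta> / 4}"
      by (intro openin_less_continuous_map cmap_intros h)
    show "P {x \<in> topspace M. norm (h x - h p) < \<delta> / 4}"
      unfolding P_def
    proof (intro ballI)
      fix x y assume "x \<in> {x \<in> topspace M. norm (h x - h p) < \<delta> / 4}"
        "y \<in> {x \<in> topspace M. norm (h x - h p) < \<delta> / 4}"
      then show "norm (h x - h y) < \<delta> / 2"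
        using norm_triangle_ineq4[of "h x - h p" "h y - h p"] by simp
    qed
    show "p \<in> {x \<in> topspace M. norm (h x - h p) < \<delta> / 4}" using p assms by simp
  qed
  then obtain C where C: "finite C" "open_cover M C" "\<And>U. U \<in> C \<Longrightarrow> P U"
    using finite_open_subcover[OF M(1), of P] by blast
  obtain D where D: "finite D" "open_cover M D" "\<forall>V\<in>D. \<exists>U\<in>C. V \<subseteq> U"
    "\<forall>x\<in>topspace M. card {V \<in> D. x \<in> V} \<le> 2 + 1"
    using M(3)[unfolded covering_dim_le_def, rule_format, of C] C by metis
  have DP: "P V" if V: "V \<in> D" for V
  proof -
    obtain U where "U \<in> C" "V \<subseteq> U" using D(3) V by metis
    then show ?thesis using C(3)[of U] unfolding P_def by (meson subsetD)
  qed
  obtain \<phi> S where \<phi>: "\<And>V. V \<in> D \<Longrightarrow> continuous_map M euclidean (\<phi> V)"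
    "\<And>V x. V \<in> D \<Longrightarrow> x \<in> topspace M \<Longrightarrow> \<phi> V x \<ge> (0::real)"
    "\<And>x. x \<in> topspace M \<Longrightarrow> (\<Sum>V\<in>D. \<phi> V x) = 1"
    "\<And>V. V \<in> D \<Longrightarrow> closedin M (S V) \<and> S V \<subseteq> V"
    "\<And>V x. V \<in> D \<Longrightarrow> x \<in> topspace M \<Longrightarrow> x \<notin> S V \<Longrightarrow> \<phi> V x = 0"
    using finite_partition_of_unity[OF M(1,2) D(1,2)] by blast
  \<comment> \<open>For an empty member the chosen point is arbitrary, which is harmless: its weight
    vanishes on the whole space.\<close>
  obtain c where c: "\<And>V. V \<in> D \<Longrightarrow> norm (c V - h (SOME x. x \<in> V)) < \<delta> / 2"
    "\<And>S. S \<subseteq> D \<Longrightarrow> card S \<le> 3 \<Longrightarrow> inj_on c S \<and> e \<notin> c ` S \<and> independent (insert e (c ` S))"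
    using general_position[OF D(1), of "\<delta>/2" e "\<lambda>V. h (SOME x. x \<in> V)"] assms by auto
  define h' where "h' = (\<lambda>x. \<Sum>V\<in>D. \<phi> V x *\<^sub>R c V)"
  show ?thesis
  proof (rule that[of h'])
    show "continuous_map M euclidean h'" unfolding h'_def by (intro cmap_intros \<phi> D)
    fix x assume x: "x \<in> topspace M"
    have xV: "x \<in> V" if "V \<in> D" "\<phi> V x \<noteq> 0" for V using \<phi>(4,5) that x by blast
    have bound: "\<phi> V x * norm (c V - h x) \<le> \<phi> V x * \<delta>" "\<phi> V x \<noteq> 0 \<Longrightarrow> \<phi> V x * norm (c V - h x) < \<phi> V x * \<delta>" if "V \<in> D" for V
    proof -
      have *: "norm (c V - h x) < \<delta>" if nz: "\<phi> V x \<noteq> 0"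
      proof -
        have "x \<in> V" using xV \<open>V \<in> D\<close> nz by blast
        then have "norm (h (SOME x. x \<in> V) - h x) < \<delta> / 2"
          using DP[OF \<open>V \<in> D\<close>] someI[of "\<lambda>x. x \<in> V" x] unfolding P_def by blast
        then show ?thesis using c(1)[OF \<open>V \<in> D\<close>]
          norm_triangle_ineq[of "c V - h (SOME x. x \<in> V)" "h (SOME x. x \<in> V) - h x"] by simp
      qed
      then show "\<phi> V x * norm (c V - h x) \<le> \<phi> V x * \<delta>"
        using \<phi>(2)[OF that x] by (cases "\<phi> V x = 0") auto
      show "\<phi> V x * norm (c V - h x) < \<phi> V x * \<delta>" if "\<phi> V x \<noteq> 0"
        using \<phi>(2)[OF \<open>V \<in> D\<close> x] * that by auto
    qed
    \<comment> \<open>A member of nonzero weight gives both the strict inequality below and the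
      nontriviality of the linear relation.\<close>
    have "\<exists>V\<in>D. \<phi> V x \<noteq> 0"
      by (rule ccontr) (use \<phi>(3)[OF x] in simp)
    then obtain V0 where V0: "V0 \<in> D" "\<phi> V0 x \<noteq> 0" by blast
    have "h' x - h x = (\<Sum>V\<in>D. \<phi> V x *\<^sub>R (c V - h x))"
      using \<phi>(3)[OF x] by (simp add: h'_def scaleR_diff_right sum_subtractf flip: scaleR_sum_left)
    also have "norm \<dots> \<le> (\<Sum>V\<in>D. \<phi> V x * norm (c V - h x))"
      by (rule order_trans[OF norm_sum]) (use \<phi>(2) x in simp)
    also have "\<dots> < (\<Sum>V\<in>D. \<phi> V x * \<delta>)"
    proof (rule sum_strict_mono_ex1)
      show "\<exists>V\<in>D. \<phi> V x * norm (c V - h x) < \<phi> V x * \<delta>"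
        using bound(2)[OF V0] V0(1) by blast
    qed (use D bound(1) in blast)+
    also have "\<dots> = \<delta>" using \<phi>(3)[OF x] by (simp flip: sum_distrib_right)
    finally show "norm (h' x - h x) < \<delta>" .
    define Q where "Q = {V \<in> D. x \<in> V}"
    have Q: "Q \<subseteq> D" "card Q \<le> 3" "finite Q" using D x by (auto simp: Q_def)
    have ind: "inj_on c Q" "e \<notin> c ` Q" "independent (insert e (c ` Q))" using c(2) Q by auto
    have h'Q: "h' x = (\<Sum>V\<in>Q. \<phi> V x *\<^sub>R c V)" unfolding h'_def
      by (rule sum.mono_neutral_right) (use D Q xV in \<open>auto simp: Q_def\<close>)
    show "h' x \<notin> span {e}"
    proof
      assume "h' x \<in> span {e}"
      then obtain t where t: "h' x = t *\<^sub>R e" by (auto simp: span_singleton)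
      \<comment> \<open>If \<open>h' x\<close> were \<open>t\<close> times \<open>e\<close>, these
        would be the coefficients of a linear relation: \<open>- t\<close> on \<open>e\<close>, and
        on \<open>c V\<close> the weight of \<open>V\<close>, recovered from the vector by
        injectivity.\<close>
      define u where "u = (\<lambda>y. if y = e then - t else \<phi> (the_inv_into Q c y) x)"
      have "(\<Sum>y\<in>insert e (c ` Q). u y *\<^sub>R y) = - t *\<^sub>R e + (\<Sum>y\<in>c ` Q. u y *\<^sub>R y)"
        using ind Q by (simp add: u_def)
      also have "(\<Sum>y\<in>c ` Q. u y *\<^sub>R y) = (\<Sum>V\<in>Q. u (c V) *\<^sub>R c V)"
        using ind(1) by (simp add: sum.reindex)
      also have "\<dots> = (\<Sum>V\<in>Q. \<phi> V x *\<^sub>R c V)"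
        by (rule sum.cong) (use ind in \<open>auto simp: u_def the_inv_into_f_f\<close>)
      finally have "(\<Sum>y\<in>insert e (c ` Q). u y *\<^sub>R y) = 0" using h'Q t by simp
      moreover have "V0 \<in> Q" using V0 xV by (auto simp: Q_def)
      then have "c V0 \<in> insert e (c ` Q)" "u (c V0) \<noteq> 0"
        using V0 ind by (auto simp: u_def the_inv_into_f_f)
      ultimately have "\<exists>u. (\<exists>y\<in>insert e (c ` Q). u y \<noteq> 0) \<and> (\<Sum>y\<in>insert e (c ` Q). u y *\<^sub>R y) = 0"
        by (intro exI[of _ u]) auto
      then have "dependent (insert e (c ` Q))"
        by (subst dependent_finite) (use Q(3) in simp_all)
      with ind(3) show False by simp
    qed
  qed
qed

section \<open>Trivialising a unitary cocycle\<close>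

text \<open>Division by the value at one point brings the values within 1/4 of 1, where the
  principal logarithm is continuous and \<open>norm_Ln_le\<close> bounds it by 1/2. A continuous
  argument with oscillation at most 1 thus exists on any space, however disconnected.\<close>

lemma continuous_log_small_oscillation:
  fixes g :: "'a \<Rightarrow> complex"
  assumes cont: "continuous_map X euclidean g"
    and norm: "\<And>x. x \<in> topspace X \<Longrightarrow> cmod (g x) = 1"
    and osc: "\<And>x y. x \<in> topspace X \<Longrightarrow> y \<in> topspace X \<Longrightarrow> cmod (g x - g y) \<le> 1/4"
  obtains \<tau> :: "'a \<Rightarrow> real" where "continuous_map X euclidean \<tau>"
    "\<And>x. x \<in> topspace X \<Longrightarrow> exp (\<i> * of_real (\<tau> x)) = g x"
    "\<And>x y. x \<in> topspace X \<Longrightarrow> y \<in> topspace X \<Longrightarrow> \<bar>\<tau> x - \<tau> y\<bar> \<le> 1"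
proof (cases "topspace X = {}")
  case True
  then show ?thesis using that[of "\<lambda>_. 0"] by auto
next
  case False
  then obtain p where p: "p \<in> topspace X" by blast
  have exp_Im: "exp (\<i> * of_real (Im (Ln z))) = z" if "cmod z = 1" for z
  proof -
    have z: "z \<noteq> 0" using that by auto
    have "\<i> * of_real (Im (Ln z)) = Ln z"
      by (rule complex_eqI) (use that z in simp_all)
    then show ?thesis using z by (simp add: exp_Ln)
  qed
  define f where "f = (\<lambda>x. g x / g p)"
  have f1: "cmod (f x) = 1" if "x \<in> topspace X" for x
    using norm[OF that] norm[OF p] by (simp add: f_def norm_divide)
  have fosc: "cmod (f x - 1) \<le> 1/4" if "x \<in> topspace X" for x
  proof -
    have "g p \<noteq> 0" using norm[OF p] by auto
    then have "f x - 1 = (g x - g p) / g p" by (simp add: f_def diff_divide_distrib)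
    then show ?thesis using osc[OF that p] norm[OF p] by (simp add: norm_divide)
  qed
  have fcont: "continuous_map X euclidean f"
    unfolding f_def by (intro cmap_intros cont) (use norm[OF p] in auto)
  have fnp: "f x \<notin> \<real>\<^sub>\<le>\<^sub>0" if "x \<in> topspace X" for x
  proof
    assume "f x \<in> \<real>\<^sub>\<le>\<^sub>0"
    then have "Re (f x) \<le> 0" by (simp add: complex_nonpos_Reals_iff)
    moreover have "\<bar>Re (f x - 1)\<bar> \<le> 1/4" using fosc[OF that] abs_Re_le_cmod order_trans by blast
    ultimately show False by simp
  qed
  have small: "\<bar>Im (Ln (f x))\<bar> \<le> 1/2" if "x \<in> topspace X" for x
  proof -
    have "cmod (Ln (1 + (f x - 1))) \<le> 2 * cmod (f x - 1)"
      by (rule norm_Ln_le) (use fosc[OF that] in simp)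
    then show ?thesis using fosc[OF that] abs_Im_le_cmod[of "Ln (f x)"] by simp
  qed
  show ?thesis
  proof (rule that[of "\<lambda>x. Im (Ln (g p)) + Im (Ln (f x))"])
    have "continuous_map X euclidean (\<lambda>x. Ln (f x))"
      using fcont fnp unfolding continuous_map_atin by (auto intro!: tendsto_Ln)
    then have "continuous_map X euclidean (\<lambda>x. Im (Ln (f x)))"
      by (rule continuous_map_euclidean_compose) (intro continuous_intros)
    then show "continuous_map X euclidean (\<lambda>x. Im (Ln (g p)) + Im (Ln (f x)))"
      by (intro cmap_intros)
    show "exp (\<i> * of_real (Im (Ln (g p)) + Im (Ln (f x)))) = g x" if "x \<in> topspace X" for x
      using exp_Im[OF norm[OF p]] exp_Im[OF f1[OF that]] norm[OF p]
      by (auto simp: distrib_left exp_add f_def)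
    show "\<bar>Im (Ln (g p)) + Im (Ln (f x)) - (Im (Ln (g p)) + Im (Ln (f y)))\<bar> \<le> 1"
      if "x \<in> topspace X" "y \<in> topspace X" for x y
      using small[OF that(1)] small[OF that(2)] by linarith
  qed
qed

text \<open>The zero class is compared on the same cover \<open>C\<close>, so equality of classes
  says that one pullback of \<open>f\<close> is a coboundary. The refinement obtained may be
  infinite.\<close>

lemma trivial_cech_cocycle:
  assumes "trivial_group (cech_cohomology M (Suc p))" "open_cover M C" "f \<in> cocycles C (Suc p)"
  obtains D r m where "open_cover M D" "refinement_map D C r" 
    "\<And>vs. vs \<in> nerve D (Suc p) \<Longrightarrow> f (map r vs) = ldiff m vs"
proof -
  have "cech_class M (Suc p) C f = cech_class M (Suc p) C (\<lambda>_. 0)"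
    using assms cech_class_carrier[OF assms(2,3)] cech_one[OF assms(2)]
    unfolding trivial_group_def by (metis singletonD)
  then have "((C, f), (C, \<lambda>_. 0)) \<in> cech_rel M (Suc p)"
    using cech_class_eq_iff[OF assms(2,3) assms(2) zero_cocycles] by simp
  then obtain D r r' where D: "open_cover M D" "refinement_map D C r" and
    b: "(\<lambda>vs. pullback D (Suc p) r f vs - pullback D (Suc p) r' (\<lambda>_. 0) vs) \<in> coboundaries D (Suc p)"
    by (auto simp: cech_rel_def)
  then obtain m where "pullback D (Suc p) r f = coboundary D p m"
    by (auto simp: coboundaries_def)
  then have *: "pullback D (Suc p) r f vs = coboundary D p m vs" for vs by simp
  show ?thesis
  proof (rule that[OF D])
    fix vs assume "vs \<in> nerve D (Suc p)"
    then show "f (map r vs) = ldiff m vs"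
      using *[of vs] by (simp add: coboundary_ldiff pullback_def)
  qed
qed


text \<open>On a cover of order at most 3 a nondegenerate 4-tuple has empty intersection, and on degenerate
  tuples the coboundary of an alternating cochain vanishes.\<close>

lemma alternating_cocycle:
  assumes fin: "finite C" and ord: "\<And>x. card {V \<in> C. x \<in> V} \<le> 3"
    and n: "n \<in> cochains C 2"
    and alt1: "\<And>a b c. n [b, a, c] = - n [a, b, c]" and alt2: "\<And>a b c. n [a, c, b] = - n [a, b, c]"
  shows "n \<in> cocycles C 2"
proof -
  have "coboundary C 2 n us = 0" for us
  proof (cases "us \<in> nerve C (Suc 2)")
    case True
    then have "length us = 4" by (simp add: nerve_def)
    then obtain a b c d where us: "us = [a, b, c, d]"
      by (auto simp: length_Suc_conv eval_nat_numeral)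
    have cob: "coboundary C 2 n us = n [b, c, d] - n [a, c, d] + n [a, b, d] - n [a, b, c]"
      using True by (simp add: coboundary_ldiff us)
    have "card {a, b, c, d} \<noteq> 4"
    proof
      assume card: "card {a, b, c, d} = 4"
      obtain x where x: "x \<in> \<Inter>(set us)" and sub: "set us \<subseteq> C" using True by (auto simp: nerve_def)
      have "{a, b, c, d} \<subseteq> {V \<in> C. x \<in> V}" using x sub us by auto
      then have "card {a, b, c, d} \<le> card {V \<in> C. x \<in> V}" using fin by (intro card_mono) auto
      then show False using ord[of x] card by simp
    qed
    then have "a = b \<or> a = c \<or> a = d \<or> b = c \<or> b = d \<or> c = d"
      by (rule contrapos_np) (simp add: card_insert_if)
    moreover have d1: "n [a, a, c] = 0" for a c using alt1[of a a c] by simp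
    moreover have d2: "n [a, c, c] = 0" for a c using alt2[of a c c] by simp
    moreover have d3: "n [a, c, a] = 0" for a c using alt2[of a a c] d1[of a c] by simp
    ultimately show ?thesis unfolding cob
      using alt1[of a b d] alt1[of a b c] alt2[of b a c] alt2[of a b c]
      by (elim disjE) (simp_all add: d1 d2 d3)
  qed (simp add: coboundary_def)
  then show ?thesis using n by (auto simp: cocycles_def)
qed


text \<open>This is the connecting map of the exponential sequence, done by hand. With
  \<open>g\<close> the exponential of \<open>\<i> * \<theta>\<close>, the defect \<open>S\<close> of
  additivity of \<open>\<theta>\<close> is 2 pi times an integer cochain \<open>n\<close>; if
  \<open>n\<close> becomes the coboundary of \<open>m\<close> after refinement, then
  \<open>\<theta> - 2 * pi * m\<close> is additive and still has exponential \<open>g\<close>. A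
  real additive cocycle is split by a partition of unity. The integers live on the nerve of a cover
  of \<open>M\<close>, with 0 where an intersection misses \<open>K\<close>, so that the cohomology
  of \<open>M\<close> itself applies.\<close>

lemma trivialize_phase_cocycle:
  fixes g :: "'a set \<Rightarrow> 'a set \<Rightarrow> 'a \<Rightarrow> complex"
  assumes M: "compact_space M" "Hausdorff_space M" "trivial_group (cech_cohomology M 2)"
    and C: "finite C" "open_cover M C" "\<And>x. card {V \<in> C. x \<in> V} \<le> 3"
    and K: "K \<subseteq> topspace M"
    and cont: "\<And>U V. U \<in> C \<Longrightarrow> V \<in> C \<Longrightarrow> continuous_map (subtopology M (U \<inter> V \<inter> K)) euclidean (g U V)"
    and one: "\<And>U V x. U \<in> C \<Longrightarrow> V \<in> C \<Longrightarrow> x \<in> U \<inter> V \<inter> K \<Longrightarrow> cmod (g U V x) = 1"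
    and coc: "\<And>U V W x. U \<in> C \<Longrightarrow> V \<in> C \<Longrightarrow> W \<in> C \<Longrightarrow> x \<in> U \<inter> V \<inter> W \<inter> K \<Longrightarrow>
      g U V x * g V W x = g U W x"
    and osc: "\<And>U V x y. U \<in> C \<Longrightarrow> V \<in> C \<Longrightarrow> x \<in> U \<inter> V \<inter> K \<Longrightarrow> y \<in> U \<inter> V \<inter> K \<Longrightarrow>
      cmod (g U V x - g U V y) \<le> 1/4"
  obtains D r c where "finite D" "open_cover M D" "refinement_map D C r"
    "\<And>V. V \<in> D \<Longrightarrow> continuous_map (subtopology M (V \<inter> K)) euclidean (c V)"
    "\<And>V x. V \<in> D \<Longrightarrow> x \<in> V \<inter> K \<Longrightarrow> cmod (c V x) = 1"
    "\<And>V W x. V \<in> D \<Longrightarrow> W \<in> D \<Longrightarrow> x \<in> V \<inter> W \<inter> K \<Longrightarrow> c W x * g (r V) (r W) x = c V x"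
proof -
  have "\<exists>\<tau>. continuous_map (subtopology M (U \<inter> V \<inter> K)) euclideanreal \<tau> \<and>
    (\<forall>x\<in>U \<inter> V \<inter> K. exp (\<i> * of_real (\<tau> x)) = g U V x) \<and>
    (\<forall>x\<in>U \<inter> V \<inter> K. \<forall>y\<in>U \<inter> V \<inter> K. \<bar>\<tau> x - \<tau> y\<bar> \<le> 1)" if UV: "U \<in> C" "V \<in> C" for U V
  proof -
    have top: "topspace (subtopology M (U \<inter> V \<inter> K)) = U \<inter> V \<inter> K" using K by auto
    show ?thesis
      by (rule continuous_log_small_oscillation[OF cont[OF UV], unfolded top])
        (use one[OF UV] osc[OF UV] in auto)
  qed
  then obtain \<tau> where \<tau>: "\<And>U V. U \<in> C \<Longrightarrow> V \<in> C \<Longrightarrow> continuous_map (subtopology M (U \<inter> V \<inter> K)) euclideanreal (\<tau> U V)"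
    "\<And>U V x. U \<in> C \<Longrightarrow> V \<in> C \<Longrightarrow> x \<in> U \<inter> V \<inter> K \<Longrightarrow> exp (\<i> * of_real (\<tau> U V x)) = g U V x"
    "\<And>U V x y. U \<in> C \<Longrightarrow> V \<in> C \<Longrightarrow> x \<in> U \<inter> V \<inter> K \<Longrightarrow> y \<in> U \<inter> V \<inter> K \<Longrightarrow> \<bar>\<tau> U V x - \<tau> U V y\<bar> \<le> 1"
    by metis
  obtain idx :: "'a set \<Rightarrow> nat" where idx: "inj_on idx C"
    using finite_imp_inj_to_nat_seg[OF C(1)] by blast
  \<comment> \<open>Ordering the members by \<open>idx\<close> makes \<open>\<theta>\<close> exactly
    antisymmetric and zero for equal members. Independently chosen logarithms would be so only up to
    multiples of 2 pi, and \<open>n\<close> might fail to alternate.\<close>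
  define \<theta> where "\<theta> = (\<lambda>U V x. if idx U < idx V then \<tau> U V x else if idx V < idx U then - \<tau> V U x else 0)"
  have \<theta>anti: "\<theta> V U x = - \<theta> U V x" for U V x by (simp add: \<theta>_def)
  have \<theta>cont: "continuous_map (subtopology M (U \<inter> V \<inter> K)) euclideanreal (\<theta> U V)" if "U \<in> C" "V \<in> C" for U V
    using \<tau>(1)[OF that] \<tau>(1)[OF that(2,1)] by (auto simp: \<theta>_def Int_commute cong: if_cong)
  have \<theta>osc: "\<bar>\<theta> U V x - \<theta> U V y\<bar> \<le> 1" if "U \<in> C" "V \<in> C" "x \<in> U \<inter> V \<inter> K" "y \<in> U \<inter> V \<inter> K" for U V x y
    using \<tau>(3)[OF that] \<tau>(3)[OF that(2,1), of x y] that(3,4) by (auto simp: \<theta>_def)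
  have \<theta>exp: "exp (\<i> * of_real (\<theta> U V x)) = g U V x" if "U \<in> C" "V \<in> C" "x \<in> U \<inter> V \<inter> K" for U V x
  proof -
    have gUU: "g U U x = 1" if "U \<in> C" "x \<in> U \<inter> K" for U
      using coc[of U U U x] that one[of U U x] by auto
    have "idx U < idx V \<or> idx V < idx U \<or> U = V"
      using inj_onD[OF idx _ that(1,2)] by linarith
    then consider "idx U < idx V" | "idx V < idx U" | "U = V" by blast
    then show ?thesis
    proof cases
      case 1
      then show ?thesis using \<tau>(2)[OF that] by (simp add: \<theta>_def)
    next
      case 2
      have "g U V x * g V U x = 1" using coc[of U V U x] gUU[of U] that by auto
      then have "inverse (g V U x) = g U V x" by (metis inverse_unique mult.commute)
      moreover have "exp (\<i> * of_real (\<tau> V U x)) = g V U x" using \<tau>(2)[of V U x] that by auto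
      ultimately show ?thesis using 2 by (simp add: \<theta>_def exp_minus)
    next
      case 3
      then show ?thesis using gUU[of U] that by (simp add: \<theta>_def)
    qed
  qed
  define S where "S = (\<lambda>U V W x. \<theta> U V x + \<theta> V W x - \<theta> U W x)"
  \<comment> \<open>The integer of a simplex is read off at one chosen point of its intersection
    with \<open>K\<close>; \<open>nS\<close> shows that every other point gives the same
    value.\<close>
  define Q where "Q = (\<lambda>us. SOME x. x \<in> \<Inter>(set us) \<inter> K)"
  define n :: "'a set list \<Rightarrow> int" where "n = (\<lambda>us. if us \<in> nerve C 2 \<and> \<Inter>(set us) \<inter> K \<noteq> {}
    then round (S (us ! 0) (us ! 1) (us ! 2) (Q us) / (2 * pi)) else 0)"
  have Sint: "\<exists>k::int. S U V W x = 2 * pi * k" if "U \<in> C" "V \<in> C" "W \<in> C" "x \<in> U \<inter> V \<inter> W \<inter> K" for U V W x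
  proof -
    have "exp (\<i> * of_real (S U V W x)) = g U V x * g V W x / g U W x"
      using \<theta>exp[of U V x] \<theta>exp[of V W x] \<theta>exp[of U W x] that
      by (simp add: S_def ring_distribs exp_add exp_diff right_diff_distrib)
    also have "\<dots> = 1" using coc[OF that] one[of U W x] that by auto
    finally obtain k :: int where "S U V W x = of_int (2 * k) * pi" by (auto simp: exp_eq_1)
    then show ?thesis by (intro exI[of _ k]) simp
  qed
  have nS: "S U V W x = 2 * pi * n [U, V, W]" if UVW: "U \<in> C" "V \<in> C" "W \<in> C" and x: "x \<in> U \<inter> V \<inter> W \<inter> K" for U V W x
  proof -
    define q where "q = Q [U, V, W]"
    have "q \<in> \<Inter>(set [U, V, W]) \<inter> K"
      unfolding q_def Q_def by (rule someI[of _ x]) (use x in auto)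
    then have q: "q \<in> U \<inter> V \<inter> W \<inter> K" by auto
    obtain k :: int where k: "S U V W x = 2 * pi * k" using Sint[OF UVW x] by blast
    obtain l :: int where l: "S U V W q = 2 * pi * l" using Sint[OF UVW q] by blast
    have "[U, V, W] \<in> nerve C 2 \<and> \<Inter>(set [U, V, W]) \<inter> K \<noteq> {}"
      using UVW x by (auto simp: nerve_def)
    then have "n [U, V, W] = round (S U V W q / (2 * pi))" by (simp add: n_def q_def)
    then have nl: "n [U, V, W] = l" using l by simp
    \<comment> \<open>Each of the three terms of \<open>S\<close> oscillates by at most 1, and 3 < 2
      pi, so the integer cannot jump even if the intersection is disconnected.\<close>
    have "\<bar>S U V W x - S U V W q\<bar> \<le> 3"
      using \<theta>osc[of U V x q] \<theta>osc[of V W x q] \<theta>osc[of U W x q] UVW x q unfolding S_def by auto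
    then have "2 * pi * \<bar>real_of_int (k - l)\<bar> \<le> 3"
      unfolding k l by (simp add: abs_mult flip: right_diff_distrib)
    moreover have "2 * pi * 1 \<le> 2 * pi * \<bar>real_of_int (k - l)\<bar>" if "1 \<le> \<bar>real_of_int (k - l)\<bar>"
      by (intro mult_left_mono that) simp
    ultimately have "\<bar>real_of_int (k - l)\<bar> < 1" using pi_gt3 by argo
    then have "k = l" by linarith
    then show ?thesis using k nl by simp
  qed
  have nne: "us \<in> nerve C 2 \<and> \<Inter>(set us) \<inter> K \<noteq> {}" if "n us \<noteq> 0" for us
    using that unfolding n_def by meson
  have cancel: "i = - j" if "2 * pi * real_of_int i = - (2 * pi * real_of_int j)" for i j
  proof -
    have "2 * pi * real_of_int (i + j) = 0" using that by (simp add: distrib_left)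
    then have "real_of_int (i + j) = 0" by simp
    then show ?thesis by linarith
  qed
  have alt: "n [b, a, c] = - n [a, b, c] \<and> n [a, c, b] = - n [a, b, c]" for a b c
  proof (cases "{a, b, c} \<subseteq> C \<and> a \<inter> b \<inter> c \<inter> K \<noteq> {}")
    case True
    then obtain x where x: "x \<in> a \<inter> b \<inter> c \<inter> K" by blast
    have "2 * pi * n [b, a, c] = - (2 * pi * n [a, b, c])"
      using nS[of a b c x] nS[of b a c x] \<theta>anti[of a b x] True x by (auto simp: S_def)
    moreover have "2 * pi * n [a, c, b] = - (2 * pi * n [a, b, c])"
      using nS[of a b c x] nS[of a c b x] \<theta>anti[of b c x] True x by (auto simp: S_def)
    ultimately show ?thesis using cancel by blast
  next
    case False
    then have "n [a, b, c] = 0" "n [b, a, c] = 0" "n [a, c, b] = 0"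
      using nne[of "[a, b, c]"] nne[of "[b, a, c]"] nne[of "[a, c, b]"] by (auto simp: nerve_def)
    then show ?thesis by simp
  qed
  have "n \<in> cocycles C (Suc 1)" unfolding Suc_1
  proof (rule alternating_cocycle[OF C(1,3)])
    show "n \<in> cochains C 2" by (simp add: cochains_def n_def)
  qed (rule conjunct1[OF alt], rule conjunct2[OF alt])
  then obtain D0 r m where D0: "open_cover M D0" "refinement_map D0 C r"
    "\<And>vs. vs \<in> nerve D0 (Suc 1) \<Longrightarrow> n (map r vs) = ldiff m vs"
    by (rule trivial_cech_cocycle[OF M(3)[folded Suc_1] C(2)]) blast
  \<comment> \<open>The trivialising refinement may be infinite, while the averaging below runs over
    a finite partition of unity; \<open>r\<close> and \<open>m\<close> restrict to a finite
    subcover.\<close>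
  obtain D where D: "finite D" "open_cover M D" "\<And>V. V \<in> D \<Longrightarrow> V \<in> D0"
  proof (rule finite_open_subcover[OF M(1), of "\<lambda>V. V \<in> D0"])
    fix x assume "x \<in> topspace M"
    then have "x \<in> \<Union>D0" using D0(1) by (simp add: open_cover_def)
    then obtain U where "U \<in> D0" "x \<in> U" by blast
    then show "\<exists>U. U \<in> D0 \<and> openin M U \<and> x \<in> U" using D0(1) by (auto simp: open_cover_def)
  qed blast
  have rC: "r V \<in> C" "V \<subseteq> r V" if "V \<in> D" for V
    using D0(2) D(3)[OF that] by (auto simp: refinement_map_def)
  define \<eta> where "\<eta> = (\<lambda>V W x. \<theta> (r V) (r W) x - 2 * pi * m [V, W])"
  have \<eta>coc: "\<eta> V W x + \<eta> W X x = \<eta> V X x" if V: "V \<in> D" "W \<in> D" "X \<in> D" and x: "x \<in> V \<inter> W \<inter> X \<inter> K" for V W X x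
  proof -
    have "[V, W, X] \<in> nerve D0 (Suc 1)" using V x D(3) by (auto simp: nerve_def)
    from D0(3)[OF this] have n: "n [r V, r W, r X] = m [W, X] - m [V, X] + m [V, W]"
      by simp
    have "S (r V) (r W) (r X) x = 2 * pi * n [r V, r W, r X]"
      by (rule nS) (use V x rC in auto)
    then show ?thesis unfolding n by (simp add: S_def \<eta>_def algebra_simps)
  qed
  have \<eta>exp: "exp (\<i> * of_real (\<eta> V W x)) = g (r V) (r W) x" if "V \<in> D" "W \<in> D" "x \<in> V \<inter> W \<inter> K" for V W x
  proof -
    have "exp (\<i> * of_real (\<eta> V W x)) = exp (\<i> * of_real (\<theta> (r V) (r W) x)) / exp (2 * of_int (m [V, W]) * of_real pi * \<i>)"
      by (simp add: \<eta>_def exp_diff right_diff_distrib mult_ac)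
    also have "exp (2 * of_int (m [V, W]) * of_real pi * \<i>) = 1" 
      unfolding exp_eq_1 by (intro conjI exI[of _ "m [V, W]"]) auto
    finally show ?thesis using \<theta>exp[of "r V" "r W" x] rC that by auto
  qed
  have \<eta>cont: "continuous_map (subtopology M (V \<inter> W \<inter> K)) euclideanreal (\<eta> V W)" if "V \<in> D" "W \<in> D" for V W
  proof -
    have "continuous_map (subtopology M (V \<inter> W \<inter> K)) euclideanreal (\<theta> (r V) (r W))"
      by (rule continuous_map_from_subtopology_mono[OF \<theta>cont[of "r V" "r W"]]) (use rC that in blast)+
    then show ?thesis unfolding \<eta>_def by (intro cmap_intros)
  qed
  obtain \<psi> Z where \<psi>: "\<And>V. V \<in> D \<Longrightarrow> continuous_map M euclidean (\<psi> V)"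
    "\<And>V x. V \<in> D \<Longrightarrow> x \<in> topspace M \<Longrightarrow> \<psi> V x \<ge> (0::real)"
    "\<And>x. x \<in> topspace M \<Longrightarrow> (\<Sum>V\<in>D. \<psi> V x) = 1"
    "\<And>V. V \<in> D \<Longrightarrow> closedin M (Z V) \<and> Z V \<subseteq> V"
    "\<And>V x. V \<in> D \<Longrightarrow> x \<in> topspace M \<Longrightarrow> x \<notin> Z V \<Longrightarrow> \<psi> V x = 0"
    using finite_partition_of_unity[OF M(1,2) D(1,2)] by blast
  have openD: "openin M V" if "V \<in> D" for V using D(2) that by (auto simp: open_cover_def)
  \<comment> \<open>Averaging the cocycle over its second index solves
    \<open>a V - a W = \<eta> V W\<close>, because \<open>\<eta> V X - \<eta> W X\<close> does not
    depend on \<open>X\<close>. The conditional is there since \<open>\<eta> V W\<close> is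
    controlled only inside \<open>W\<close>.\<close>
  define a where "a = (\<lambda>V x. \<Sum>W\<in>D. if x \<in> W then \<psi> W x * \<eta> V W x else 0)"
  have acont: "continuous_map (subtopology M (V \<inter> K)) euclideanreal (a V)" if V: "V \<in> D" for V
    unfolding a_def
  proof (rule continuous_map_sum[OF D(1)])
    fix W assume W: "W \<in> D"
    let ?X = "subtopology M (V \<inter> K)"
    let ?T = "\<lambda>b. if b then W \<inter> (V \<inter> K) else (topspace M - Z W) \<inter> (V \<inter> K)"
    let ?f = "\<lambda>b x. if b then \<psi> W x * \<eta> V W x else 0"
    show "continuous_map ?X euclideanreal (\<lambda>x. if x \<in> W then \<psi> W x * \<eta> V W x else 0)"
    \<comment> \<open>Two open pieces: \<open>W\<close>, and the complement of the closed support
      \<open>Z W\<close>. On their overlap the weight is 0, so both formulas give 0.\<close>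
    proof (rule pasting_lemma[where I = UNIV and T = ?T and f = ?f])
      fix b :: bool
      show "openin ?X (?T b)"
        using openD[OF W] \<psi>(4)[OF W] by (auto intro: openin_subtopology_Int)
      have "continuous_map (subtopology M (V \<inter> K \<inter> (W \<inter> (V \<inter> K)))) euclideanreal (\<lambda>x. \<psi> W x * \<eta> V W x)"
        by (intro cmap_intros continuous_map_from_subtopology[OF \<psi>(1)[OF W]]
            continuous_map_from_subtopology_mono[OF \<eta>cont[OF V W]]) auto
      then show "continuous_map (subtopology ?X (?T b)) euclideanreal (?f b)"
        by (cases b) (auto simp: subtopology_subtopology)
    next
      fix b c x assume "x \<in> topspace ?X \<inter> ?T b \<inter> ?T c"
      then show "?f b x = ?f c x" using \<psi>(5)[OF W] by (auto split: if_splits)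
    next
      fix x assume "x \<in> topspace ?X"
      then show "\<exists>j. j \<in> UNIV \<and> x \<in> ?T j \<and> (if x \<in> W then \<psi> W x * \<eta> V W x else 0) = ?f j x"
        using \<psi>(4)[OF W] by (intro exI[of _ "x \<in> W"]) auto
    qed
  qed
  have adiff: "a V x = a W x + \<eta> V W x" if VW: "V \<in> D" "W \<in> D" and x: "x \<in> V \<inter> W \<inter> K" for V W x
  proof -
    have xM: "x \<in> topspace M" using x K by auto
    have "a V x - a W x = (\<Sum>X\<in>D. \<psi> X x * \<eta> V W x)"
      unfolding a_def sum_subtractf[symmetric]
    proof (rule sum.cong[OF refl])
      fix X assume X: "X \<in> D"
      show "(if x \<in> X then \<psi> X x * \<eta> V X x else 0) - (if x \<in> X then \<psi> X x * \<eta> W X x else 0) = \<psi> X x * \<eta> V W x"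
      proof (cases "x \<in> X")
        case True
        then show ?thesis using \<eta>coc[OF VW X, of x] x by (auto simp flip: right_diff_distrib)
      next
        case False
        then show ?thesis using \<psi>(4,5)[OF X] xM by auto
      qed
    qed
    also have "\<dots> = \<eta> V W x" using \<psi>(3)[OF xM] by (simp flip: sum_distrib_right)
    finally show ?thesis by simp
  qed
  show ?thesis
  proof (rule that[of D r "\<lambda>V x. exp (\<i> * of_real (a V x))"])
    show "refinement_map D C r" using rC by (simp add: refinement_map_def)
    show "continuous_map (subtopology M (V \<inter> K)) euclidean (\<lambda>x. exp (\<i> * of_real (a V x)))" if "V \<in> D" for V
      by (rule continuous_map_euclidean_compose[OF acont[OF that]]) (intro continuous_intros)
    fix V W x assume "V \<in> D" "W \<in> D" "x \<in> V \<inter> W \<inter> K"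
    then show "exp (\<i> * of_real (a W x)) * g (r V) (r W) x = exp (\<i> * of_real (a V x))"
      using \<eta>exp[of V W x] adiff[of V W x] by (auto simp: ring_distribs exp_add)
  qed (use D in auto)
qed

section \<open>Nowhere vanishing sections\<close>

lemma Tietze_extension_complex:
  fixes f :: "'a \<Rightarrow> complex"
  assumes "normal_space M" "closedin M K" "continuous_map (subtopology M K) euclidean f"
  obtains g where "continuous_map M euclidean g" "\<And>x. x \<in> K \<Longrightarrow> g x = f x"
proof -
  have "continuous_map (subtopology M K) euclidean (\<lambda>x. Re (f x))"
    "continuous_map (subtopology M K) euclidean (\<lambda>x. Im (f x))"
    by (rule continuous_map_euclidean_compose[OF assms(3)]; intro continuous_intros)+
  then obtain g1 g2 where g: "continuous_map M euclideanreal g1" "\<And>x. x \<in> K \<Longrightarrow> g1 x = Re (f x)"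
    "continuous_map M euclideanreal g2" "\<And>x. x \<in> K \<Longrightarrow> g2 x = Im (f x)"
    using Tietze_extension_realinterval[OF assms(1,2) is_interval_univ UNIV_not_empty] by (metis subset_UNIV)
  show ?thesis
  proof (rule that[of "\<lambda>x. of_real (g1 x) + \<i> * of_real (g2 x)"])
    show "continuous_map M euclidean (\<lambda>x. of_real (g1 x) + \<i> * of_real (g2 x))"
      by (intro cmap_intros g)
    show "complex_of_real (g1 x) + \<i> * complex_of_real (g2 x) = f x" if "x \<in> K" for x
      using g(2,4)[OF that] by (simp add: complex_eq_iff)
  qed
qed

text \<open>The normalised conjugates of the nonzero rows of \<open>T\<close> are local sections; the vanishing of the minors makes any two of
  them proportional, so they differ by phases.\<close>

lemma rank_one_nonvanishing_section:
  fixes T :: "'a \<Rightarrow> nat \<Rightarrow> nat \<Rightarrow> complex"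
  assumes M: "compact_space M" "Hausdorff_space M" "covering_dim_le M 2"
      "trivial_group (cech_cohomology M 2)"
    and K: "closedin M K"
    and cont: "\<And>i j. i < n \<Longrightarrow> j < n \<Longrightarrow> continuous_map M euclidean (\<lambda>x. T x i j)"
    and nz: "\<And>x. x \<in> K \<Longrightarrow> \<exists>i<n. \<exists>j<n. T x i j \<noteq> 0"
    and minors: "\<And>x i j k l. x \<in> K \<Longrightarrow> i < n \<Longrightarrow> j < n \<Longrightarrow> k < n \<Longrightarrow> l < n \<Longrightarrow>
      T x i k * T x j l = T x i l * T x j k"
  obtains v :: "nat \<Rightarrow> 'a \<Rightarrow> complex" where
    "\<And>j. j < n \<Longrightarrow> continuous_map (subtopology M K) euclidean (v j)"
    "\<And>x. x \<in> K \<Longrightarrow> \<exists>i<n. (\<Sum>j<n. T x i j * v j x) \<noteq> 0"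
proof (cases "K = {}")
  case True
  then show ?thesis using that[of "\<lambda>_ _. 0"] by auto
next
  case False
  then have npos: "n > 0" using nz by fastforce
  have KM: "K \<subseteq> topspace M" using K by (rule closedin_subset)
  define R where "R = (\<lambda>k x. sqrt (\<Sum>j<n. (cmod (T x k j))\<^sup>2))"
  define s where "s = (\<lambda>k x j. cnj (T x k j) / of_real (R k x))"
  have Rcont: "continuous_map M euclidean (R k)" if "k < n" for k
  proof -
    have "continuous_map M euclidean (\<lambda>x. \<Sum>j<n. (cmod (T x k j))\<^sup>2)"
      by (intro cmap_intros cont that) auto
    then show ?thesis unfolding R_def
      by (rule continuous_map_euclidean_compose) (intro continuous_intros)
  qed
  have R0: "R k x \<ge> 0" for k x by (simp add: R_def sum_nonneg)
  have R2: "(R k x)\<^sup>2 = (\<Sum>j<n. (cmod (T x k j))\<^sup>2)" for k x by (simp add: R_def sum_nonneg)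
  have scont: "continuous_map (subtopology M U) euclidean (\<lambda>x. s k x j)"
    if "k < n" "j < n" "\<And>x. x \<in> U \<inter> topspace M \<Longrightarrow> R k x \<noteq> 0" for U k j
    unfolding s_def
    by (intro cmap_intros continuous_map_from_subtopology[OF cont[OF that(1,2)]]
        continuous_map_from_subtopology[OF Rcont[OF that(1)]]) (use that(3) in auto)
  have sunit: "(\<Sum>j<n. (cmod (s k x j))\<^sup>2) = 1" if "R k x \<noteq> 0" for k x
  proof -
    have "(\<Sum>j<n. (cmod (s k x j))\<^sup>2) = (\<Sum>j<n. (cmod (T x k j))\<^sup>2) / (R k x)\<^sup>2"
      by (simp add: s_def norm_divide power_divide sum_divide_distrib)
    then show ?thesis using that by (simp flip: R2)
  qed
  have s1: "cmod (s k x j) \<le> 1" if "R k x \<noteq> 0" "j < n" for k x j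
  proof -
    have "(cmod (s k x j))\<^sup>2 \<le> (\<Sum>j<n. (cmod (s k x j))\<^sup>2)"
      by (rule member_le_sum) (use that in auto)
    then show ?thesis using sunit[OF that(1)] by (simp add: power_le_one_iff abs_square_le_1)
  qed
  \<comment> \<open>Each of the \<open>n\<close> terms of the inner product \<open>g\<close> below
    is a product of two factors of modulus at most 1 that vary by at most 1/(8n), so
    \<open>g\<close> varies by at most 1/4, as the logarithm requires. A point outside
    \<open>K\<close> has a neighbourhood missing \<open>K\<close>, where row 0 serves
    vacuously.\<close>
  define P where "P = (\<lambda>U. \<exists>k<n. (\<forall>x\<in>U \<inter> K. R k x \<noteq> 0) \<and>
    (\<forall>x\<in>U \<inter> K. \<forall>y\<in>U \<inter> K. \<forall>j<n. cmod (s k x j - s k y j) \<le> 1 / (8 * real n)))"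
  have "\<exists>U. P U \<and> openin M U \<and> p \<in> U" if p: "p \<in> topspace M" for p
  proof (cases "p \<in> K")
    case False
    have "P (topspace M - K)" unfolding P_def using npos by (intro exI[of _ 0]) auto
    moreover have "openin M (topspace M - K)" using K by (simp add: closedin_def)
    ultimately show ?thesis using p False by blast
  next
    case True
    then obtain k j where kj: "k < n" "j < n" "T p k j \<noteq> 0" using nz by blast
    have "0 < (cmod (T p k j))\<^sup>2" using kj by simp
    also have "\<dots> \<le> (R k p)\<^sup>2" unfolding R2 by (rule member_le_sum) (use kj in auto)
    finally have Rp: "0 < R k p" using R0[of k p] by (cases "R k p = 0") auto
    define W where "W = {x \<in> topspace M. 0 < R k x}"
    have W: "openin M W" unfolding W_def
      by (rule openin_less_continuous_map) (auto intro: Rcont kj)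
    define U where "U = {x \<in> topspace (subtopology M W). (\<Sum>j<n. cmod (s k x j - s k p j)) < 1 / (16 * real n)}"
    have "openin (subtopology M W) U" unfolding U_def
      by (intro openin_less_continuous_map cmap_intros scont kj) (auto simp: W_def)
    then have "openin M U" using W openin_open_subtopology by blast
    moreover have "p \<in> U" using p Rp npos by (auto simp: U_def W_def)
    moreover have "P U" unfolding P_def
    proof (intro exI[of _ k] conjI ballI allI impI)
      show "R k x \<noteq> 0" if "x \<in> U \<inter> K" for x using that by (auto simp: U_def W_def)
      have near: "cmod (s k x j - s k p j) \<le> 1 / (16 * real n)" if "x \<in> U" "j < n" for x j
      proof -
        have "cmod (s k x j - s k p j) \<le> (\<Sum>j<n. cmod (s k x j - s k p j))"
          by (rule member_le_sum) (use that in auto)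
        then show ?thesis using that by (simp add: U_def)
      qed
      fix x y j assume xy: "x \<in> U \<inter> K" "y \<in> U \<inter> K" "j < n"
      have "cmod (s k x j - s k y j) \<le> 1 / (16 * real n) + 1 / (16 * real n)"
        using near[of x j] near[of y j] xy norm_triangle_ineq4[of "s k x j - s k p j" "s k y j - s k p j"]
        by simp
      then show "cmod (s k x j - s k y j) \<le> 1 / (8 * real n)" by simp
    qed (rule kj)
    ultimately show ?thesis by blast
  qed
  then obtain C0 where C0: "finite C0" "open_cover M C0" "\<And>U. U \<in> C0 \<Longrightarrow> P U"
    using finite_open_subcover[OF M(1), of P] by blast
  obtain C where C: "finite C" "open_cover M C" "\<forall>V\<in>C. \<exists>U\<in>C0. V \<subseteq> U"
    "\<forall>x\<in>topspace M. card {V \<in> C. x \<in> V} \<le> 2 + 1"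
    using M(3)[unfolded covering_dim_le_def, rule_format, of C0] C0 by metis
  have ord: "card {V \<in> C. x \<in> V} \<le> 3" for x
  proof (cases "x \<in> topspace M")
    case False
    then have "{V \<in> C. x \<in> V} = {}" using C(2) by (auto simp: open_cover_def)
    then show ?thesis by (metis card.empty zero_le)
  qed (use C(4) in auto)
  have "P V" if V: "V \<in> C" for V
  proof -
    obtain U where "U \<in> C0" "V \<subseteq> U" using C(3) V by metis
    then have "P U" "V \<inter> K \<subseteq> U \<inter> K" using C0(3) by auto
    then show ?thesis unfolding P_def by (meson subsetD)
  qed
  then obtain k where k: "\<And>U. U \<in> C \<Longrightarrow> k U < n" "\<And>U x. U \<in> C \<Longrightarrow> x \<in> U \<inter> K \<Longrightarrow> R (k U) x \<noteq> 0"
    "\<And>U x y j. U \<in> C \<Longrightarrow> x \<in> U \<inter> K \<Longrightarrow> y \<in> U \<inter> K \<Longrightarrow> j < n \<Longrightarrow>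
      cmod (s (k U) x j - s (k U) y j) \<le> 1 / (8 * real n)"
    unfolding P_def by metis
  \<comment> \<open>An inner product of unit vectors is used instead of a quotient of coordinates:
    it is continuous on the whole overlap, whichever coordinates vanish, and for proportional unit
    vectors it is the factor itself.\<close>
  define g where "g = (\<lambda>U V x. \<Sum>j<n. cnj (s (k U) x j) * s (k V) x j)"
  have gs: "g U V x * s (k U) x i = s (k V) x i" if UV: "U \<in> C" "V \<in> C" "x \<in> U \<inter> V \<inter> K" "i < n" for U V x i
  proof -
    have R: "R (k U) x \<noteq> 0" "R (k V) x \<noteq> 0" using k UV by auto
    have "s (k V) x j * s (k U) x i = s (k U) x j * s (k V) x i" if "j < n" for j
    proof -
      have "T x (k U) i * T x (k V) j = T x (k U) j * T x (k V) i"
        by (rule minors) (use UV k that in auto)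
      then have "cnj (T x (k U) i) * cnj (T x (k V) j) = cnj (T x (k U) j) * cnj (T x (k V) i)"
        by (simp flip: complex_cnj_mult)
      then show ?thesis by (simp add: s_def mult.commute)
    qed
    then have "g U V x * s (k U) x i = (\<Sum>j<n. (cnj (s (k U) x j) * s (k U) x j) * s (k V) x i)"
      unfolding g_def sum_distrib_right by (intro sum.cong) (auto simp: mult.assoc)
    also have "\<dots> = of_real (\<Sum>j<n. (cmod (s (k U) x j))\<^sup>2) * s (k V) x i"
      unfolding of_real_sum sum_distrib_right
      by (intro sum.cong) (simp_all add: complex_norm_square mult.commute del: of_real_power)
    finally show ?thesis using sunit[OF R(1)] by simp
  qed
  have snz: "\<exists>i<n. s (k U) x i \<noteq> 0" if "U \<in> C" "x \<in> U \<inter> K" for U x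
  proof (rule ccontr)
    assume "\<not> ?thesis"
    then have "(\<Sum>j<n. (cmod (s (k U) x j))\<^sup>2) = 0" by simp
    then show False using sunit[of "k U" x] k(2)[OF that] by simp
  qed
  have gone: "cmod (g U V x) = 1" if UV: "U \<in> C" "V \<in> C" "x \<in> U \<inter> V \<inter> K" for U V x
  proof -
    have R: "R (k U) x \<noteq> 0" "R (k V) x \<noteq> 0" using k UV by auto
    have "1 = (\<Sum>j<n. (cmod (g U V x * s (k U) x j))\<^sup>2)"
      using gs[OF UV] sunit[OF R(2)] by simp
    also have "\<dots> = (cmod (g U V x))\<^sup>2 * (\<Sum>j<n. (cmod (s (k U) x j))\<^sup>2)"
      by (simp add: norm_mult power_mult_distrib sum_distrib_left)
    finally have "(cmod (g U V x))\<^sup>2 = 1" using sunit[OF R(1)] by simp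
    then show ?thesis by (simp add: power2_eq_1_iff) (smt (verit) norm_ge_zero)
  qed
  have gcoc: "g U V x * g V W x = g U W x"
    if UVW: "U \<in> C" "V \<in> C" "W \<in> C" "x \<in> U \<inter> V \<inter> W \<inter> K" for U V W x
  proof -
    obtain i where i: "i < n" "s (k U) x i \<noteq> 0" using snz[of U x] UVW by auto
    have "(g U V x * g V W x) * s (k U) x i = g V W x * (g U V x * s (k U) x i)"
      by (simp add: mult_ac)
    also have "\<dots> = g U W x * s (k U) x i"
      using gs[of U V x i] gs[of V W x i] gs[of U W x i] UVW i by simp
    finally show ?thesis using i by simp
  qed
  have gosc: "cmod (g U V x - g U V y) \<le> 1/4"
    if UV: "U \<in> C" "V \<in> C" and x: "x \<in> U \<inter> V \<inter> K" and y: "y \<in> U \<inter> V \<inter> K" for U V x y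
  proof -
    have "cmod (cnj (s (k U) x j) * s (k V) x j - cnj (s (k U) y j) * s (k V) y j) \<le> 1 / (4 * real n)"
      if j: "j < n" for j
    proof -
      let ?a = "s (k U) x j" and ?b = "s (k V) x j" and ?a' = "s (k U) y j" and ?b' = "s (k V) y j"
      have "cnj ?a * ?b - cnj ?a' * ?b' = cnj (?a - ?a') * ?b + cnj ?a' * (?b - ?b')"
        by (simp add: algebra_simps)
      also have "cmod \<dots> \<le> cmod (?a - ?a') * cmod ?b + cmod ?a' * cmod (?b - ?b')"
        by (rule norm_triangle_le) (simp add: norm_mult del: complex_cnj_diff)
      also have "\<dots> \<le> 1 / (8 * real n) * 1 + 1 * (1 / (8 * real n))"
        using k(3)[OF UV(1), of x y j] k(3)[OF UV(2), of x y j] x y j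
          s1[of "k V" x j] s1[of "k U" y j] k(2)[OF UV(1), of y] k(2)[OF UV(2), of x]
        by (intro add_mono mult_mono) auto
      finally show ?thesis by simp
    qed
    then have "cmod (g U V x - g U V y) \<le> (\<Sum>j<n. 1 / (4 * real n))"
      unfolding g_def sum_subtractf[symmetric] by (intro sum_norm_le) auto
    then show ?thesis using npos by simp
  qed
  have gcont: "continuous_map (subtopology M (U \<inter> V \<inter> K)) euclidean (g U V)" if "U \<in> C" "V \<in> C" for U V
    unfolding g_def by (intro cmap_intros scont) (use that k in auto)
  obtain D r c where D: "finite D" "open_cover M D" "refinement_map D C r"
    and c: "\<And>V. V \<in> D \<Longrightarrow> continuous_map (subtopology M (V \<inter> K)) euclidean (c V)"
    "\<And>V x. V \<in> D \<Longrightarrow> x \<in> V \<inter> K \<Longrightarrow> cmod (c V x) = 1"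
    "\<And>V W x. V \<in> D \<Longrightarrow> W \<in> D \<Longrightarrow> x \<in> V \<inter> W \<inter> K \<Longrightarrow> c W x * g (r V) (r W) x = c V x"
    by (rule trivialize_phase_cocycle[OF M(1,2,4) C(1,2) ord KM gcont gone gcoc gosc]) blast+
  have r: "r V \<in> C" "V \<subseteq> r V" if "V \<in> D" for V using D(3) that by (auto simp: refinement_map_def)
  \<comment> \<open>The factor \<open>g\<close> carries the section of \<open>r V\<close> to that of
    \<open>r W\<close>, and \<open>c W * g (r V) (r W) x = c V x\<close>; hence the corrected
    sections agree on overlaps.\<close>
  define f where "f = (\<lambda>j V x. c V x * s (k (r V)) x j)"
  have agree: "f j V x = f j W x" if "V \<in> D" "W \<in> D" "x \<in> V \<inter> W \<inter> K" "j < n" for j V W x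
  proof -
    have "g (r V) (r W) x * s (k (r V)) x j = s (k (r W)) x j"
      by (rule gs) (use r that in auto)
    then show ?thesis using c(3)[OF that(1-3)] by (simp add: f_def flip: mult.assoc) (metis mult.assoc)
  qed
  define W where "W = (\<lambda>x. SOME V. V \<in> D \<and> x \<in> V)"
  have W: "W x \<in> D" "x \<in> W x" if "x \<in> topspace M" for x
  proof -
    have "\<exists>V. V \<in> D \<and> x \<in> V" using D(2) that by (auto simp: open_cover_def)
    then have "W x \<in> D \<and> x \<in> W x" unfolding W_def by (rule someI_ex)
    then show "W x \<in> D" "x \<in> W x" by auto
  qed
  show ?thesis
  proof (rule that[of "\<lambda>j x. f j (W x) x"])
    fix j assume j: "j < n"
    show "continuous_map (subtopology M K) euclidean (\<lambda>x. f j (W x) x)"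
    proof (rule pasting_lemma[where I = D and T = "\<lambda>V. V \<inter> K" and f = "f j"])
      fix V assume V: "V \<in> D"
      show "openin (subtopology M K) (V \<inter> K)"
        using D(2) V by (auto simp: open_cover_def intro: openin_subtopology_Int)
      have "continuous_map (subtopology M (V \<inter> K)) euclidean (f j V)"
        unfolding f_def using r[OF V] k by (intro cmap_intros c V scont j) auto
      moreover have "K \<inter> (V \<inter> K) = V \<inter> K" by blast
      ultimately show "continuous_map (subtopology (subtopology M K) (V \<inter> K)) euclidean (f j V)"
        by (simp add: subtopology_subtopology)
    next
      fix V V' x assume "V \<in> D" "V' \<in> D" "x \<in> topspace (subtopology M K) \<inter> (V \<inter> K) \<inter> (V' \<inter> K)"
      then show "f j V x = f j V' x" using agree[of V V' x j] j by auto
    next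
      fix x assume "x \<in> topspace (subtopology M K)"
      then show "\<exists>V. V \<in> D \<and> x \<in> V \<inter> K \<and> f j (W x) x = f j V x"
        using W[of x] by (intro exI[of _ "W x"]) auto
    qed
  next
    fix x assume x: "x \<in> K"
    then have xM: "x \<in> topspace M" using KM by auto
    let ?k = "k (r (W x))"
    have Rx: "R ?k x \<noteq> 0" using k(2)[OF r(1)[OF W(1)[OF xM]]] r(2)[OF W(1)[OF xM]] W(2)[OF xM] x by auto
    \<comment> \<open>A row of \<open>T\<close> is paired with its own conjugate divided by its
      norm, so up to the phase the result is \<open>R ?k x\<close>.\<close>
    have "(\<Sum>j<n. T x ?k j * f j (W x) x) = c (W x) x / of_real (R ?k x) * of_real ((R ?k x)\<^sup>2)"
      unfolding R2 f_def s_def of_real_sum sum_distrib_left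
      by (intro sum.cong) (simp_all add: complex_norm_square del: of_real_power)
    also have "\<dots> \<noteq> 0" using Rx c(2)[OF W(1)[OF xM], of x] W(2)[OF xM] x by auto
    finally have "(\<Sum>j<n. T x ?k j * f j (W x) x) \<noteq> 0" .
    moreover have "?k < n" using k(1)[OF r(1)[OF W(1)[OF xM]]] .
    ultimately show "\<exists>i<n. (\<Sum>j<n. T x i j * f j (W x) x) \<noteq> 0" by blast
  qed
qed


text \<open>Let \<open>h\<close> be the adjugate of the minor (rows \<open>a, b\<close>, columns \<open>k, l\<close>) applied to the entries \<open>a, b\<close> of \<open>T w\<close>.  Adding
  \<open>u\<close> to the coordinates \<open>k, l\<close> of \<open>w\<close> adds \<open>d u\<close> to \<open>h\<close>, where \<open>d\<close> is the minor, so on \<open>G\<close> it can be replaced by a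
  nearby map without zeros.\<close>

lemma perturb_to_nonvanishing:
  fixes T :: "'a \<Rightarrow> nat \<Rightarrow> nat \<Rightarrow> complex" and w :: "nat \<Rightarrow> 'a \<Rightarrow> complex"
  assumes M: "compact_space M" "Hausdorff_space M" "covering_dim_le M 2"
    and cont: "\<And>i j. i < n \<Longrightarrow> j < n \<Longrightarrow> continuous_map M euclidean (\<lambda>x. T x i j)"
    and w: "\<And>j. j < n \<Longrightarrow> continuous_map M euclidean (w j)"
    and F: "closedin M F" "\<And>x. x \<in> F \<Longrightarrow> \<exists>i<n. (\<Sum>j<n. T x i j * w j x) \<noteq> 0"
    and q: "a < n" "b < n" "k < n" "l < n"
    and G: "closedin M G" "\<And>x. x \<in> G \<Longrightarrow> T x a k * T x b l - T x a l * T x b k \<noteq> 0"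
  obtains w' :: "nat \<Rightarrow> 'a \<Rightarrow> complex" where "\<And>j. j < n \<Longrightarrow> continuous_map M euclidean (w' j)"
    "\<And>x. x \<in> F \<union> G \<Longrightarrow> \<exists>i<n. (\<Sum>j<n. T x i j * w' j x) \<noteq> 0"
proof -
  define d where "d = (\<lambda>x. T x a k * T x b l - T x a l * T x b k)"
  have dcont: "continuous_map M euclidean d" unfolding d_def by (intro cmap_intros cont q)
  define Tw where "Tw = (\<lambda>x i. \<Sum>j<n. T x i j * w j x)"
  have Twcont: "continuous_map M euclidean (\<lambda>x. Tw x i)" if "i < n" for i
    unfolding Tw_def by (intro cmap_intros cont w that) auto
  have FM: "F \<subseteq> topspace M" "G \<subseteq> topspace M" using closedin_subset[OF F(1)] closedin_subset[OF G(1)] .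
  obtain c where c: "c > 0" "\<And>x. x \<in> G \<Longrightarrow> c \<le> (cmod (d x))\<^sup>2"
  proof (rule continuous_map_bounded_below_pos[OF M(1) _ G(1), of "\<lambda>x. (cmod (d x))\<^sup>2"])
    show "continuous_map M euclideanreal (\<lambda>x. (cmod (d x))\<^sup>2)" by (intro cmap_intros dcont)
    show "0 < (cmod (d x))\<^sup>2" if "x \<in> G" for x using G(2)[OF that] by (simp add: d_def)
  qed blast
  obtain e where e: "e > 0" "\<And>x. x \<in> F \<Longrightarrow> e \<le> (\<Sum>i<n. cmod (Tw x i))"
  proof (rule continuous_map_bounded_below_pos[OF M(1) _ F(1), of "\<lambda>x. \<Sum>i<n. cmod (Tw x i)"])
    show "continuous_map M euclideanreal (\<lambda>x. \<Sum>i<n. cmod (Tw x i))"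
      by (intro cmap_intros Twcont) auto
    fix x assume "x \<in> F"
    then obtain i where "i < n" "Tw x i \<noteq> 0" using F(2) unfolding Tw_def by blast
    then show "0 < (\<Sum>i<n. cmod (Tw x i))" by (intro sum_pos2[of _ i]) auto
  qed blast
  obtain B where B: "B > 0" "\<And>x. x \<in> topspace M \<Longrightarrow> (\<Sum>i<n. cmod (T x i k) + cmod (T x i l)) \<le> B"
    by (rule continuous_map_bounded_above[OF M(1), of "\<lambda>x. \<Sum>i<n. cmod (T x i k) + cmod (T x i l)"])
      (use cont q in \<open>auto intro!: cmap_intros\<close>)
  obtain A where A: "A > 0" "\<And>x. x \<in> topspace M \<Longrightarrow> cmod (d x) \<le> A"
    by (rule continuous_map_bounded_above[OF M(1), of "\<lambda>x. cmod (d x)"])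
      (auto intro!: cmap_intros dcont)
  \<comment> \<open>The factor \<open>\<rho>\<close> below is at most \<open>A / c\<close> in
    modulus, so each correction is less than \<open>A / c * \<delta> = e / (2 * B)\<close>, and on
    \<open>F\<close> the entries of \<open>T w\<close> change by at most \<open>e / 2\<close> in
    total.\<close>
  define \<delta> where "\<delta> = c * e / (2 * A * B)"
  have \<delta>: "\<delta> > 0" using c e A B by (simp add: \<delta>_def)
  define h where "h = (\<lambda>x. (T x b l * Tw x a - T x a l * Tw x b, T x a k * Tw x b - T x b k * Tw x a))"
  have hcont: "continuous_map M euclidean h" unfolding h_def
    by (intro cmap_intros cont Twcont q)
  obtain h' where h': "continuous_map M euclidean h'" "\<And>x. x \<in> topspace M \<Longrightarrow> norm (h' x - h x) < \<delta>"
    "\<And>x. x \<in> topspace M \<Longrightarrow> h' x \<notin> span {(1, 0)}"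
    by (rule approximate_avoiding_line[OF M hcont \<delta>, of "(1, 0)"]) (auto simp: zero_prod_def)
  \<comment> \<open>On \<open>G\<close> this is \<open>1 / d\<close>; the maximum with
    \<open>c\<close> keeps it continuous and bounded elsewhere, zeros of \<open>d\<close>
    included.\<close>
  define \<rho> where "\<rho> = (\<lambda>x. cnj (d x) / of_real (max ((cmod (d x))\<^sup>2) c))"
  have \<rho>cont: "continuous_map M euclidean \<rho>" unfolding \<rho>_def
    by (intro cmap_intros dcont) (use c in auto)
  define u1 where "u1 = (\<lambda>x. \<rho> x * fst (h' x - h x))"
  define u2 where "u2 = (\<lambda>x. \<rho> x * snd (h' x - h x))"
  have dh: "continuous_map M euclidean (\<lambda>x. h' x - h x)" by (intro cmap_intros h' hcont)
  have ucont: "continuous_map M euclidean u1" "continuous_map M euclidean u2" unfolding u1_def u2_def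
    by (intro cmap_intros \<rho>cont continuous_map_euclidean_compose[OF dh]; intro continuous_intros)+
  have u_bound: "cmod (u1 x) < e / (2 * B) \<and> cmod (u2 x) < e / (2 * B)" if x: "x \<in> topspace M" for x
  proof -
    have \<rho>: "cmod (\<rho> x) \<le> A / c" unfolding \<rho>_def norm_divide complex_mod_cnj
      using A(2)[OF x] c(1) A(1) by (intro frac_le) auto
    have eq: "A / c * \<delta> = e / (2 * B)" using A B c by (simp add: \<delta>_def field_simps)
    have "cmod (\<rho> x) * t < A / c * \<delta>" if "0 \<le> t" "t < \<delta>" for t
    proof -
      have "cmod (\<rho> x) * t \<le> A / c * t" using \<rho> that by (intro mult_right_mono)
      also have "\<dots> < A / c * \<delta>" using that A c by (intro mult_strict_left_mono) auto
      finally show ?thesis .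
    qed
    moreover have "cmod (fst (h' x - h x)) < \<delta>" "cmod (snd (h' x - h x)) < \<delta>"
      using h'(2)[OF x] norm_fst_le[of "fst (h' x - h x)" "snd (h' x - h x)"]
        norm_snd_le[of "snd (h' x - h x)" "fst (h' x - h x)"] by (auto simp del: fst_diff snd_diff)
    ultimately show ?thesis unfolding eq u1_def u2_def norm_mult by auto
  qed
  \<comment> \<open>Two separate summands make the formula for the image of \<open>w'\<close> valid
    also when \<open>k = l\<close>.\<close>
  define w' where "w' = (\<lambda>j x. w j x + (if j = k then u1 x else 0) + (if j = l then u2 x else 0))"
  have Tw': "(\<Sum>j<n. T x i j * w' j x) = Tw x i + T x i k * u1 x + T x i l * u2 x" for x i
    using q by (simp add: w'_def Tw_def distrib_left sum.distrib if_distrib[of "\<lambda>y. _ * y"] cong: if_cong)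
  show ?thesis
  proof (rule that[of w'])
    show "continuous_map M euclidean (w' j)" if "j < n" for j
    proof -
      have "continuous_map M euclidean (\<lambda>x. if j = k then u1 x else 0)"
        "continuous_map M euclidean (\<lambda>x. if j = l then u2 x else 0)" using ucont by auto
      then show ?thesis unfolding w'_def by (intro cmap_intros w that)
    qed
    fix x assume x: "x \<in> F \<union> G"
    show "\<exists>i<n. (\<Sum>j<n. T x i j * w' j x) \<noteq> 0"
    proof (rule ccontr)
      assume "\<not> ?thesis"
      then have zero: "Tw x i + T x i k * u1 x + T x i l * u2 x = 0" if "i < n" for i
        using that Tw' by auto
      have xM: "x \<in> topspace M" using x FM by auto
      show False
      proof (cases "x \<in> F")
        case True
        have "cmod (Tw x i) \<le> (cmod (T x i k) + cmod (T x i l)) * (e / (2 * B))" if "i < n" for i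
        proof -
          have "Tw x i = - (T x i k * u1 x + T x i l * u2 x)"
            using zero[OF that] by (simp add: add_eq_0_iff add.assoc)
          then have "cmod (Tw x i) \<le> cmod (T x i k) * cmod (u1 x) + cmod (T x i l) * cmod (u2 x)"
            by (metis norm_minus_cancel norm_mult norm_triangle_ineq)
          also have "\<dots> \<le> cmod (T x i k) * (e / (2 * B)) + cmod (T x i l) * (e / (2 * B))"
            using u_bound[OF xM] by (intro add_mono mult_left_mono) auto
          finally show ?thesis by (simp only: distrib_right)
        qed
        then have "e \<le> (\<Sum>i<n. (cmod (T x i k) + cmod (T x i l)) * (e / (2 * B)))"
          using e(2)[OF True] by (meson lessThan_iff order_trans sum_mono)
        also have "\<dots> \<le> B * (e / (2 * B))"
          unfolding sum_distrib_right[symmetric] using B e xM by (intro mult_right_mono) auto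
        also have "\<dots> = e / 2" using B by simp
        finally show False using e by simp
      next
        case False
        then have xG: "x \<in> G" using x by blast
        have d0: "d x \<noteq> 0" using G(2)[OF xG] by (simp add: d_def)
        have "max ((cmod (d x))\<^sup>2) c = (cmod (d x))\<^sup>2" using c(2)[OF xG] by simp
        then have "\<rho> x * d x = 1" using d0
          by (simp add: \<rho>_def complex_norm_square mult.commute del: of_real_power)
        then have du: "d x * u1 x = fst (h' x) - fst (h x)" "d x * u2 x = snd (h' x) - snd (h x)"
          by (simp_all add: u1_def u2_def mult.assoc[symmetric] mult.commute[of "d x"])
        have za: "Tw x a = - (T x a k * u1 x + T x a l * u2 x)" and zb: "Tw x b = - (T x b k * u1 x + T x b l * u2 x)"
          using zero[OF q(1)] zero[OF q(2)] by (simp_all add: add_eq_0_iff add.assoc)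
        \<comment> \<open>By Cramer's rule a zero of the image of \<open>w'\<close> forces
          \<open>h = - d u\<close>, while \<open>d u = h' - h\<close> on \<open>G\<close>. Together
          they give \<open>h' = 0\<close>, but 0 lies on the avoided line.\<close>
        have "fst (h x) = - (d x * u1 x)" "snd (h x) = - (d x * u2 x)"
          unfolding h_def fst_conv snd_conv za zb d_def by (simp_all add: algebra_simps)
        then have "h' x = 0" using du by (simp add: prod_eq_iff)
        then show False using h'(3)[OF xM] by (metis span_zero)
      qed
    qed
  qed
qed

text \<open>A section that works on the rank-one locus still works near it, and away from it some
  minor is bounded below. There are finitely many minors, so the section is corrected on one closed
  set \<open>G q\<close> after another, each correction preserving what was achieved before.\<close>

lemma exists_nonvanishing_image:
  fixes T :: "'a \<Rightarrow> nat \<Rightarrow> nat \<Rightarrow> complex"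
  assumes M: "compact_space M" "Hausdorff_space M" "covering_dim_le M 2"
      "trivial_group (cech_cohomology M 2)"
    and cont: "\<And>i j. i < n \<Longrightarrow> j < n \<Longrightarrow> continuous_map M euclidean (\<lambda>x. T x i j)"
    and nz: "\<And>x. x \<in> topspace M \<Longrightarrow> \<exists>i<n. \<exists>j<n. T x i j \<noteq> 0"
  obtains w :: "nat \<Rightarrow> 'a \<Rightarrow> complex" where "\<And>j. j < n \<Longrightarrow> continuous_map M euclidean (w j)"
    "\<And>x. x \<in> topspace M \<Longrightarrow> \<exists>i<n. (\<Sum>j<n. T x i j * w j x) \<noteq> 0"
proof -
  define d where "d = (\<lambda>(a, b, k, l) x. T x a k * T x b l - T x a l * T x b k)"
  define Q where "Q = {..<n} \<times> {..<n} \<times> {..<n} \<times> {..<n}"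
  have Q: "finite Q" by (simp add: Q_def)
  have dcont: "continuous_map M euclidean (d q)" if "q \<in> Q" for q
  proof -
    obtain a b k l where q: "q = (a, b, k, l)" by (cases q)
    show ?thesis using that unfolding q d_def prod.case Q_def by (intro cmap_intros cont) auto
  qed
  define dd where "dd = (\<lambda>x. \<Sum>q\<in>Q. cmod (d q x))"
  have ddcont: "continuous_map M euclidean dd" unfolding dd_def by (intro cmap_intros dcont Q)
  define K where "K = {x \<in> topspace M. dd x \<le> 0}"
  have K: "closedin M K" unfolding K_def by (intro closedin_le_continuous_map ddcont cmap_intros)
  have minors: "T x i k * T x j l = T x i l * T x j k"
    if "x \<in> K" "i < n" "j < n" "k < n" "l < n" for x i j k l
  proof -
    have "dd x = 0" using that(1) by (auto simp: K_def dd_def intro!: antisym sum_nonneg)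
    then have "\<forall>q\<in>Q. cmod (d q x) = 0" unfolding dd_def using Q by (subst (asm) sum_nonneg_eq_0_iff) auto
    then have "d (i, j, k, l) x = 0" using that by (auto simp: Q_def)
    then show ?thesis by (simp add: d_def)
  qed
  have nzK: "\<exists>i<n. \<exists>j<n. T x i j \<noteq> 0" if "x \<in> K" for x
    using nz[of x] that by (simp add: K_def)
  obtain v where v: "\<And>j. j < n \<Longrightarrow> continuous_map (subtopology M K) euclidean (v j)"
    "\<And>x. x \<in> K \<Longrightarrow> \<exists>i<n. (\<Sum>j<n. T x i j * v j x) \<noteq> 0"
    by (rule rank_one_nonvanishing_section[OF M K cont nzK minors]) (assumption | rule that | simp)+
  have "\<exists>g. continuous_map M euclidean g \<and> (\<forall>x\<in>K. g x = v j x)" if "j < n" for j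
    by (rule Tietze_extension_complex[OF normal_space_compact_Hausdorff[OF M(1,2)] K v(1)[OF that]]) blast
  then obtain w0 where w0: "\<And>j. j < n \<Longrightarrow> continuous_map M euclidean (w0 j)"
    "\<And>j x. j < n \<Longrightarrow> x \<in> K \<Longrightarrow> w0 j x = v j x" by metis
  define E where "E = (\<lambda>x. \<Sum>i<n. cmod (\<Sum>j<n. T x i j * w0 j x))"
  have Econt: "continuous_map M euclidean E" unfolding E_def by (intro cmap_intros cont w0(1)) auto
  have E0: "E x \<ge> 0" and dd0: "dd x \<ge> 0" for x by (auto simp: E_def dd_def intro: sum_nonneg)
  \<comment> \<open>On \<open>K\<close> the extended section has nonzero image, off \<open>K\<close>
    some minor is nonzero; compactness turns this into a uniform bound.\<close>
  obtain c where c: "c > 0" "\<And>x. x \<in> topspace M \<Longrightarrow> c \<le> E x + dd x"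
  proof (rule continuous_map_bounded_below_pos[OF M(1) _ closedin_topspace, of "\<lambda>x. E x + dd x"])
    show "continuous_map M euclideanreal (\<lambda>x. E x + dd x)" by (intro cmap_intros Econt ddcont)
    fix x assume x: "x \<in> topspace M"
    show "0 < E x + dd x"
    proof (cases "x \<in> K")
      case True
      then obtain i where "i < n" "(\<Sum>j<n. T x i j * w0 j x) \<noteq> 0" using v(2)[OF True] w0(2) by auto
      then have "0 < E x" unfolding E_def by (intro sum_pos2[of _ i]) auto
      then show ?thesis using dd0[of x] by simp
    next
      case False
      then show ?thesis using x E0[of x] by (auto simp: K_def not_le)
    qed
  qed blast
  \<comment> \<open>Where every minor is below \<open>c2\<close> in modulus they add up to at most
    \<open>c / 2\<close>, so \<open>E\<close> is at least \<open>c / 2\<close>; hence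
    \<open>F\<close> and the sets \<open>G q\<close> cover. The added 1 keeps the denominator
    nonzero when there are no minors.\<close>
  define c2 where "c2 = c / (2 * (card Q + 1))"
  have c2: "c2 > 0" using c by (simp add: c2_def)
  define F where "F = {x \<in> topspace M. c / 2 \<le> E x}"
  define G where "G = (\<lambda>q. {x \<in> topspace M. c2 \<le> cmod (d q x)})"
  have Fc: "closedin M F" unfolding F_def by (intro closedin_le_continuous_map Econt cmap_intros)
  have Gc: "closedin M (G q)" if "q \<in> Q" for q
    unfolding G_def by (intro closedin_le_continuous_map dcont that cmap_intros)
  have "\<exists>w. (\<forall>j<n. continuous_map M euclidean (w j)) \<and>
    (\<forall>x\<in>F \<union> \<Union>(G ` S). \<exists>i<n. (\<Sum>j<n. T x i j * w j x) \<noteq> 0)" if "finite S" "S \<subseteq> Q" for S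
    using that
  proof induction
    case empty
    have "\<exists>i<n. (\<Sum>j<n. T x i j * w0 j x) \<noteq> 0" if "x \<in> F" for x
    proof (rule ccontr)
      assume "\<not> ?thesis"
      then have "E x = 0" by (simp add: E_def)
      then show False using that c by (simp add: F_def)
    qed
    then show ?case using w0 by (intro exI[of _ w0]) auto
  next
    case (insert q S)
    then obtain w where "(\<forall>j<n. continuous_map M euclidean (w j)) \<and>
      (\<forall>x\<in>F \<union> \<Union>(G ` S). \<exists>i<n. (\<Sum>j<n. T x i j * w j x) \<noteq> 0)" by auto
    then have w: "\<And>j. j < n \<Longrightarrow> continuous_map M euclidean (w j)"
      "\<And>x. x \<in> F \<union> \<Union>(G ` S) \<Longrightarrow> \<exists>i<n. (\<Sum>j<n. T x i j * w j x) \<noteq> 0" by auto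
    obtain a b k l where q: "q = (a, b, k, l)" by (cases q)
    have lt: "a < n" "b < n" "k < n" "l < n" using insert.prems by (auto simp: q Q_def)
    have FS: "closedin M (F \<union> \<Union>(G ` S))"
      using insert Gc by (intro closedin_Un Fc closedin_Union) auto
    have Gq: "T x a k * T x b l - T x a l * T x b k \<noteq> 0" if "x \<in> G q" for x
      using that c2 by (auto simp: G_def q d_def)
    have Gqc: "closedin M (G q)" using Gc insert.prems by simp
    show ?case
    proof (rule perturb_to_nonvanishing[OF M(1-3) cont w(1) FS w(2) lt Gqc Gq])
      fix w' assume "\<And>j. j < n \<Longrightarrow> continuous_map M euclidean (w' j)"
        "\<And>x. x \<in> (F \<union> \<Union>(G ` S)) \<union> G q \<Longrightarrow> \<exists>i<n. (\<Sum>j<n. T x i j * w' j x) \<noteq> 0"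
      then show ?case by (intro exI[of _ w']) auto
    qed
  qed
  from this[OF Q order_refl] obtain w where "(\<forall>j<n. continuous_map M euclidean (w j)) \<and>
    (\<forall>x\<in>F \<union> \<Union>(G ` Q). \<exists>i<n. (\<Sum>j<n. T x i j * w j x) \<noteq> 0)" by blast
  then have w: "\<And>j. j < n \<Longrightarrow> continuous_map M euclidean (w j)"
    "\<And>x. x \<in> F \<union> \<Union>(G ` Q) \<Longrightarrow> \<exists>i<n. (\<Sum>j<n. T x i j * w j x) \<noteq> 0" by auto
  have "x \<in> F \<union> \<Union>(G ` Q)" if x: "x \<in> topspace M" for x
  proof (rule ccontr)
    assume nin: "\<not> ?thesis"
    then have "E x < c / 2" using x by (auto simp: F_def)
    moreover have "dd x \<le> (\<Sum>q\<in>Q. c2)" unfolding dd_def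
      by (rule sum_mono) (use nin x in \<open>auto simp: G_def not_le less_imp_le\<close>)
    moreover have "(\<Sum>q\<in>Q. c2) \<le> c / 2" using c(1) by (simp add: c2_def field_simps)
    ultimately show False using c(2)[OF x] by linarith
  qed
  then show ?thesis using w by (intro that[of w]) auto
qed

section \<open>Frobenius norm and unitary matrices\<close>

lemma mat_adjoint_dims [simp]: "dim_row (mat_adjoint A) = dim_col A" "dim_col (mat_adjoint A) = dim_row A"
  unfolding mat_adjoint_def by simp_all

lemma mat_adjoint_carrier [simp]: "A \<in> carrier_mat n m \<Longrightarrow> mat_adjoint A \<in> carrier_mat m n"
  by (intro carrier_matI) auto

lemma mat_adjoint_index [simp]:
  fixes A :: "complex mat"
  assumes "i < dim_col A" "j < dim_row A"
  shows "mat_adjoint A $$ (i, j) = cnj (A $$ (j, i))"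
  using assms unfolding mat_adjoint_def by (simp add: mat_of_rows_index)

lemma mult_mat_index:
  "A \<in> carrier_mat n m \<Longrightarrow> B \<in> carrier_mat m k \<Longrightarrow> i < n \<Longrightarrow> j < k \<Longrightarrow>
    (A * B) $$ (i, j) = (\<Sum>t<m. A $$ (i, t) * B $$ (t, j))"
  by (simp add: scalar_prod_def lessThan_atLeast0)

lemma mult_mat_vec_index:
  "A \<in> carrier_mat n m \<Longrightarrow> v \<in> carrier_vec m \<Longrightarrow> i < n \<Longrightarrow>
    (A *\<^sub>v v) $ i = (\<Sum>t<m. A $$ (i, t) * v $ t)"
  by (simp add: scalar_prod_def lessThan_atLeast0)

lemma mat_adjoint_mult:
  fixes A B :: "complex mat"
  assumes A: "A \<in> carrier_mat n m" and B: "B \<in> carrier_mat m k"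
  shows "mat_adjoint (A * B) = mat_adjoint B * mat_adjoint A"
proof (rule eq_matI)
  fix i j assume "i < dim_row (mat_adjoint B * mat_adjoint A)" "j < dim_col (mat_adjoint B * mat_adjoint A)"
  then have ij: "i < k" "j < n" using A B by auto
  have "mat_adjoint (A * B) $$ (i, j) = cnj ((A * B) $$ (j, i))"
    by (rule mat_adjoint_index) (use A B ij in auto)
  also have "\<dots> = (\<Sum>t<m. cnj (A $$ (j, t)) * cnj (B $$ (t, i)))"
    using mult_mat_index[OF A B ij(2,1)] by simp
  also have "\<dots> = (\<Sum>t<m. mat_adjoint B $$ (i, t) * mat_adjoint A $$ (t, j))"
    by (rule sum.cong) (use A B ij in auto)
  also have "\<dots> = (mat_adjoint B * mat_adjoint A) $$ (i, j)"
    by (rule mult_mat_index[symmetric]) (use A B ij in auto)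
  finally show "mat_adjoint (A * B) $$ (i, j) = (mat_adjoint B * mat_adjoint A) $$ (i, j)" .
qed (use A B in auto)

lemma mat_adjoint_adjoint [simp]: "mat_adjoint (mat_adjoint A) = (A :: complex mat)"
  by (rule eq_matI) auto

lemma mat_diag_index [simp]: "i < n \<Longrightarrow> j < n \<Longrightarrow> mat_diag n f $$ (i, j) = (if i = j then f j else 0)"
  by (simp add: mat_diag_def)

lemma mat_diag_dims [simp]: "dim_row (mat_diag n f) = n" "dim_col (mat_diag n f) = n"
  by (simp_all add: mat_diag_def)

lemma mat_adjoint_diag_real:
  "mat_adjoint (mat_diag n (\<lambda>i. complex_of_real (f i))) = mat_diag n (\<lambda>i. complex_of_real (f i))"
  by (rule eq_matI) auto

definition unitary_mat :: "nat \<Rightarrow> complex mat \<Rightarrow> bool" where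
  "unitary_mat n U \<longleftrightarrow> U \<in> carrier_mat n n \<and> U * mat_adjoint U = 1\<^sub>m n \<and> mat_adjoint U * U = 1\<^sub>m n"

lemma unitary_matI:
  assumes U: "U \<in> carrier_mat n n" and "mat_adjoint U * U = 1\<^sub>m n"
  shows "unitary_mat n U"
  using mat_mult_left_right_inverse[of "mat_adjoint U" n U] assms by (simp add: unitary_mat_def)

lemma unitary_mat_adjoint: "unitary_mat n U \<Longrightarrow> unitary_mat n (mat_adjoint U)"
  by (simp add: unitary_mat_def)

lemma unitary_mat_mult:
  assumes U: "unitary_mat n U" and V: "unitary_mat n V"
  shows "unitary_mat n (U * V)"
proof (rule unitary_matI)
  have c: "U \<in> carrier_mat n n" "V \<in> carrier_mat n n" "mat_adjoint U \<in> carrier_mat n n" "mat_adjoint V \<in> carrier_mat n n"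
    using U V by (auto simp: unitary_mat_def)
  show "U * V \<in> carrier_mat n n" using c by simp
  have "mat_adjoint (U * V) * (U * V) = mat_adjoint V * ((mat_adjoint U * U) * V)"
    unfolding mat_adjoint_mult[OF c(1,2)] using c by (simp add: assoc_mult_mat[of _ n n _ n _ n])
  then show "mat_adjoint (U * V) * (U * V) = 1\<^sub>m n"
    using U V by (simp add: unitary_mat_def left_mult_one_mat[OF c(2)])
qed

section \<open>Inner product, Euclidean norm and Frobenius norm\<close>

definition cinner :: "complex Matrix.vec \<Rightarrow> complex Matrix.vec \<Rightarrow> complex" where
  "cinner x y = (\<Sum>i<dim_vec y. x $ i * cnj (y $ i))"

lemma l2_norm_nonneg [simp]: "l2_norm v \<ge> 0"
  by (simp add: l2_norm_def sum_nonneg)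

lemma l2_norm_power2: "(l2_norm v)\<^sup>2 = (\<Sum>i<dim_vec v. (cmod (v $ i))\<^sup>2)"
  by (simp add: l2_norm_def sum_nonneg)

lemma l2_norm_eq_L2_set: "l2_norm v = L2_set (\<lambda>i. cmod (v $ i)) {..<dim_vec v}"
  by (simp add: l2_norm_def L2_set_def)

lemma cinner_self: "cinner v v = of_real ((l2_norm v)\<^sup>2)"
  unfolding l2_norm_power2 cinner_def of_real_sum
  by (simp add: complex_norm_square del: of_real_power)

lemma cinner_adjoint:
  assumes A: "A \<in> carrier_mat n m" and x: "x \<in> carrier_vec m" and y: "y \<in> carrier_vec n"
  shows "cinner (A *\<^sub>v x) y = cinner x (mat_adjoint A *\<^sub>v y)"
proof -
  have "cinner (A *\<^sub>v x) y = (\<Sum>i<n. (\<Sum>t<m. A $$ (i, t) * x $ t) * cnj (y $ i))"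
    unfolding cinner_def using y by (intro sum.cong) (auto simp: mult_mat_vec_index[OF A x] simp del: index_mult_mat_vec)
  also have "\<dots> = (\<Sum>t<m. \<Sum>i<n. A $$ (i, t) * x $ t * cnj (y $ i))"
    unfolding sum_distrib_right by (rule sum.swap)
  also have "\<dots> = (\<Sum>t<m. x $ t * cnj (\<Sum>i<n. mat_adjoint A $$ (t, i) * y $ i))"
    using A by (auto simp: sum_distrib_left mult_ac intro!: sum.cong)
  also have "\<dots> = cinner x (mat_adjoint A *\<^sub>v y)"
    unfolding cinner_def using A y
    by (intro sum.cong) (auto simp: mult_mat_vec_index[OF mat_adjoint_carrier[OF A] y] simp del: index_mult_mat_vec)
  finally show ?thesis .
qed

lemma l2_norm_unitary:
  assumes U: "unitary_mat n U" and v: "v \<in> carrier_vec n"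
  shows "l2_norm (U *\<^sub>v v) = l2_norm v"
proof -
  have c: "U \<in> carrier_mat n n" and UU: "mat_adjoint U * U = 1\<^sub>m n" using U by (auto simp: unitary_mat_def)
  have "cinner (U *\<^sub>v v) (U *\<^sub>v v) = cinner v (mat_adjoint U *\<^sub>v (U *\<^sub>v v))"
    by (rule cinner_adjoint[OF c v]) (use c v in simp)
  also have "mat_adjoint U *\<^sub>v (U *\<^sub>v v) = (mat_adjoint U * U) *\<^sub>v v"
    by (rule assoc_mult_mat_vec[symmetric]) (use c v in auto)
  also have "\<dots> = v" using UU v by simp
  finally have "(l2_norm (U *\<^sub>v v))\<^sup>2 = (l2_norm v)\<^sup>2"
    unfolding cinner_self by (metis of_real_eq_iff)
  then show ?thesis by (simp add: power2_eq_iff_nonneg)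
qed

text \<open>The Hilbert--Schmidt norm serves as working norm: it is invariant under unitaries on
  both sides, entrywise bounds control it, and it dominates the operator norm of the final
  statement.\<close>

definition fnorm :: "complex mat \<Rightarrow> real" where
  "fnorm A = L2_set (\<lambda>p. cmod (A $$ p)) ({..<dim_row A} \<times> {..<dim_col A})"

lemma fnorm_nonneg [simp]: "fnorm A \<ge> 0"
  by (simp add: fnorm_def L2_set_nonneg)

lemma fnorm_power2: "(fnorm A)\<^sup>2 = (\<Sum>i<dim_row A. \<Sum>j<dim_col A. (cmod (A $$ (i, j)))\<^sup>2)"
  by (simp add: fnorm_def L2_set_def sum_nonneg sum.cartesian_product)

lemma fnorm_add:
  assumes "A \<in> carrier_mat n m" "B \<in> carrier_mat n m"
  shows "fnorm (A + B) \<le> fnorm A + fnorm B"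
proof -
  have "fnorm (A + B) \<le> L2_set (\<lambda>p. cmod (A $$ p) + cmod (B $$ p)) ({..<n} \<times> {..<m})"
    unfolding fnorm_def using assms by (auto intro!: L2_set_mono norm_triangle_ineq)
  also have "\<dots> \<le> fnorm A + fnorm B"
    using L2_set_triangle_ineq[of "\<lambda>p. cmod (A $$ p)" "\<lambda>p. cmod (B $$ p)" "{..<n} \<times> {..<m}"] assms
    by (simp add: fnorm_def)
  finally show ?thesis .
qed

lemma fnorm_triangle:
  assumes "A \<in> carrier_mat n m" "B \<in> carrier_mat n m" "C \<in> carrier_mat n m"
  shows "fnorm (A - C) \<le> fnorm (A - B) + fnorm (B - C)"
proof -
  have "A - C = (A - B) + (B - C)" by (rule eq_matI) (use assms in auto)
  moreover have "A - B \<in> carrier_mat n m" "B - C \<in> carrier_mat n m"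
    using assms by (auto intro!: carrier_matI)
  ultimately show ?thesis using fnorm_add[of "A - B" n m "B - C"] by simp
qed

lemma fnorm_commute:
  assumes "A \<in> carrier_mat n m" "B \<in> carrier_mat n m"
  shows "fnorm (A - B) = fnorm (B - A)"
  unfolding fnorm_def using assms
  by (intro L2_set_cong) (auto simp: norm_minus_commute)

lemma norm_index_le_fnorm:
  assumes "A \<in> carrier_mat n m" "i < n" "j < m"
  shows "cmod (A $$ (i, j)) \<le> fnorm A"
  unfolding fnorm_def by (rule member_le_L2_set) (use assms in auto)

lemma fnorm_bound:
  assumes "A \<in> carrier_mat n n" "\<And>i j. i < n \<Longrightarrow> j < n \<Longrightarrow> cmod (A $$ (i, j)) \<le> c"
  shows "fnorm A \<le> real (n * n) * c"
proof -
  have "fnorm A \<le> (\<Sum>p\<in>{..<n} \<times> {..<n}. cmod (A $$ p))"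
    unfolding fnorm_def using assms(1) by (simp add: L2_set_le_sum)
  also have "\<dots> \<le> (\<Sum>p\<in>{..<n} \<times> {..<n}. c)" by (rule sum_mono) (use assms in auto)
  finally show ?thesis by simp
qed

lemma fnorm_adjoint [simp]: "fnorm (mat_adjoint A) = fnorm A"
proof -
  have "(fnorm (mat_adjoint A))\<^sup>2 = (fnorm A)\<^sup>2"
    unfolding fnorm_power2 by (subst sum.swap) (auto intro!: sum.cong)
  then show ?thesis by (simp add: power2_eq_iff_nonneg)
qed

lemma fnorm_unitary_left:
  assumes U: "unitary_mat n U" and A: "A \<in> carrier_mat n m"
  shows "fnorm (U * A) = fnorm A"
proof -
  have c: "U \<in> carrier_mat n n" using U by (simp add: unitary_mat_def)
  have cols: "(fnorm B)\<^sup>2 = (\<Sum>j<m. (l2_norm (col B j))\<^sup>2)" if "B \<in> carrier_mat n m" for B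
    unfolding fnorm_power2 l2_norm_power2 using that by (subst sum.swap) (auto intro!: sum.cong)
  have "(fnorm (U * A))\<^sup>2 = (\<Sum>j<m. (l2_norm (U *\<^sub>v col A j))\<^sup>2)"
    using cols[of "U * A"] c A col_mult2[OF c A] by simp
  also have "\<dots> = (\<Sum>j<m. (l2_norm (col A j))\<^sup>2)"
    by (intro sum.cong refl arg_cong[where f = "\<lambda>x. x\<^sup>2"] l2_norm_unitary[OF U] carrier_vecI) (use A in auto)
  also have "\<dots> = (fnorm A)\<^sup>2" using cols[OF A] by simp
  finally show ?thesis by (simp add: power2_eq_iff_nonneg)
qed

lemma fnorm_unitary_right:
  assumes U: "unitary_mat m U" and A: "A \<in> carrier_mat n m"
  shows "fnorm (A * U) = fnorm A"
proof -
  have c: "U \<in> carrier_mat m m" using U by (simp add: unitary_mat_def)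
  have "fnorm (A * U) = fnorm (mat_adjoint U * mat_adjoint A)"
    using mat_adjoint_mult[OF A c] fnorm_adjoint[of "A * U"] by simp
  also have "\<dots> = fnorm A" using fnorm_unitary_left[OF unitary_mat_adjoint[OF U], of "mat_adjoint A" n] A by simp
  finally show ?thesis .
qed

text \<open>Cauchy--Schwarz on each row, squared and summed over the rows; this is what compares the
  operator norm with \<open>fnorm\<close>.\<close>

lemma l2_norm_mult_mat_vec:
  assumes A: "A \<in> carrier_mat n m" and v: "v \<in> carrier_vec m"
  shows "l2_norm (A *\<^sub>v v) \<le> fnorm A * l2_norm v"
proof -
  have "(l2_norm (A *\<^sub>v v))\<^sup>2 = (\<Sum>i<n. (cmod (\<Sum>t<m. A $$ (i, t) * v $ t))\<^sup>2)"
    unfolding l2_norm_power2 using A by (auto simp: mult_mat_vec_index[OF A v] simp del: index_mult_mat_vec intro!: sum.cong)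
  also have "\<dots> \<le> (\<Sum>i<n. (L2_set (\<lambda>t. cmod (A $$ (i, t))) {..<m} * l2_norm v)\<^sup>2)"
  proof (rule sum_mono, rule power_mono)
    fix i
    have "cmod (\<Sum>t<m. A $$ (i, t) * v $ t) \<le> (\<Sum>t<m. \<bar>cmod (A $$ (i, t))\<bar> * \<bar>cmod (v $ t)\<bar>)"
      by (rule sum_norm_le) (simp add: norm_mult)
    also have "\<dots> \<le> L2_set (\<lambda>t. cmod (A $$ (i, t))) {..<m} * L2_set (\<lambda>t. cmod (v $ t)) {..<m}"
      by (rule L2_set_mult_ineq)
    finally show "cmod (\<Sum>t<m. A $$ (i, t) * v $ t) \<le> L2_set (\<lambda>t. cmod (A $$ (i, t))) {..<m} * l2_norm v"
      using v by (simp add: l2_norm_eq_L2_set)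
  qed simp
  also have "\<dots> = (fnorm A)\<^sup>2 * (l2_norm v)\<^sup>2"
    using A by (simp add: fnorm_power2 power_mult_distrib L2_set_def sum_nonneg flip: sum_distrib_right)
  finally have "(l2_norm (A *\<^sub>v v))\<^sup>2 \<le> (fnorm A * l2_norm v)\<^sup>2" by (simp add: power_mult_distrib)
  then show ?thesis by (rule power2_le_imp_le) simp
qed

lemma op_norm_le_fnorm: "op_norm A \<le> fnorm A"
  unfolding op_norm_def
proof (rule cSup_least)
  have "l2_norm (0\<^sub>v (dim_col A)) \<le> 1" by (simp add: l2_norm_def)
  then show "{l2_norm (A *\<^sub>v v) |v. v \<in> carrier_vec (dim_col A) \<and> l2_norm v \<le> 1} \<noteq> {}"
    using zero_carrier_vec by blast
  fix r assume "r \<in> {l2_norm (A *\<^sub>v v) |v. v \<in> carrier_vec (dim_col A) \<and> l2_norm v \<le> 1}"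
  then obtain v where v: "r = l2_norm (A *\<^sub>v v)" "v \<in> carrier_vec (dim_col A)" "l2_norm v \<le> 1" by blast
  have "r \<le> fnorm A * l2_norm v" unfolding v(1) by (rule l2_norm_mult_mat_vec) (use v in auto)
  also have "\<dots> \<le> fnorm A * 1" by (rule mult_left_mono) (use v in auto)
  finally show "r \<le> fnorm A" by simp
qed

lemma cmod_cinner_le:
  assumes "x \<in> carrier_vec n" "y \<in> carrier_vec n"
  shows "cmod (cinner x y) \<le> l2_norm x * l2_norm y"
proof -
  have "cmod (cinner x y) \<le> (\<Sum>i<n. \<bar>cmod (x $ i)\<bar> * \<bar>cmod (y $ i)\<bar>)"
    unfolding cinner_def using assms by (auto intro!: sum_norm_le simp: norm_mult)
  also have "\<dots> \<le> l2_norm x * l2_norm y"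
    unfolding l2_norm_eq_L2_set using L2_set_mult_ineq[of "\<lambda>i. cmod (x $ i)" "\<lambda>i. cmod (y $ i)" "{..<n}"] assms by simp
  finally show ?thesis .
qed

section \<open>Completing a unit vector to a unitary matrix\<close>

definition householder :: "nat \<Rightarrow> complex Matrix.vec \<Rightarrow> complex mat" where
  "householder n v = Matrix.mat n n (\<lambda>(i, j). (if i = j then 1 else 0) -
     (v $ i - (if i = 0 then 1 else 0)) * cnj (v $ j - (if j = 0 then 1 else 0)) / (1 - cnj (v $ 0)))"

text \<open>With \<open>u = v - e\<^sub>0\<close> and \<open>a = 1 - cnj (v $ 0)\<close> the matrix is \<open>1 - u u\<^sup>* / a\<close>; it is unitary because
  \<open>2 Re a = \<parallel>u\<parallel>\<^sup>2\<close>, and it maps \<open>e\<^sub>0\<close> to \<open>v\<close> because \<open>u\<^sup>* e\<^sub>0 = - a\<close>.\<close>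

lemma householder_dims [simp]: "dim_row (householder n v) = n" "dim_col (householder n v) = n"
  by (simp_all add: householder_def)

lemma householder_col_0:
  assumes "n > 0" "v $ 0 \<noteq> 1" "i < n"
  shows "householder n v $$ (i, 0) = v $ i"
proof -
  define b where "b = 1 - cnj (v $ 0)"
  define d :: complex where "d = (if i = 0 then 1 else 0)"
  have b: "b \<noteq> 0" unfolding b_def using assms(2) by (metis complex_cnj_cnj complex_cnj_one eq_iff_diff_eq_0)
  have "cnj (v $ 0 - 1) = - b" by (simp add: b_def)
  then have "householder n v $$ (i, 0) = d - (v $ i - d) * (- b) / b"
    using assms unfolding householder_def by (simp add: b_def d_def)
  then show ?thesis using b by simp
qed

lemma unitary_householder:
  assumes v: "v \<in> carrier_vec n" "l2_norm v = 1" and n: "n > 0" and "v $ 0 \<noteq> 1"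
  shows "unitary_mat n (householder n v)"
proof (rule unitary_matI)
  show c: "householder n v \<in> carrier_mat n n" by (simp add: householder_def)
  define a where "a = 1 - cnj (v $ 0)"
  define u where "u = (\<lambda>i. v $ i - (if i = 0 then 1 else 0))"
  have a0: "a \<noteq> 0" unfolding a_def using assms(4) by (metis complex_cnj_cnj complex_cnj_one eq_iff_diff_eq_0)
  have entry: "householder n v $$ (i, j) = (if i = j then 1 else 0) - u i * cnj (u j) / a" if "i < n" "j < n" for i j
    using that by (simp add: householder_def u_def a_def)
  have "(\<Sum>i<n. v $ i * cnj (v $ i)) = 1"
    using cinner_self[of v] v by (simp add: cinner_def)
  then have uu: "(\<Sum>t<n. cnj (u t) * u t) = a + cnj a"
  proof -
    have "(\<Sum>t<n. cnj (u t) * u t) = (\<Sum>t<n. v $ t * cnj (v $ t) - (if t = 0 then v $ t + cnj (v $ t) - 1 else 0))"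
      by (rule sum.cong) (auto simp: u_def algebra_simps)
    also have "\<dots> = 1 - (v $ 0 + cnj (v $ 0) - 1)"
      using n \<open>(\<Sum>i<n. v $ i * cnj (v $ i)) = 1\<close> by (simp add: sum_subtractf)
    finally show ?thesis by (simp add: a_def)
  qed
  show "mat_adjoint (householder n v) * householder n v = 1\<^sub>m n"
  proof (rule eq_matI)
    fix i j assume "i < dim_row (1\<^sub>m n :: complex mat)" "j < dim_col (1\<^sub>m n :: complex mat)"
    then have ij: "i < n" "j < n" by auto
    define \<kappa> where "\<kappa> = u i * cnj (u j) / (cnj a * a)"
    have "(mat_adjoint (householder n v) * householder n v) $$ (i, j)
      = (\<Sum>t<n. cnj (householder n v $$ (t, i)) * householder n v $$ (t, j))"
      unfolding mult_mat_index[OF mat_adjoint_carrier[OF c] c ij] using c ij by (intro sum.cong) auto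
    \<comment> \<open>The sum is split into indicator terms and a quadratic term. Since
      \<open>u\<close> has squared norm \<open>a + cnj a\<close>, the latter contributes
      \<open>1 / cnj a + 1 / a\<close> times \<open>u i * cnj (u j)\<close> and cancels the linear
      terms.\<close>
    also have "\<dots> = (\<Sum>t<n. (if t = i then (if t = j then 1 else 0) - u t * cnj (u j) / a else 0)
      + (if t = j then - (cnj (u t) * u i / cnj a) else 0) + (cnj (u t) * u t) * \<kappa>)"
      by (rule sum.cong) (use ij in \<open>auto simp: \<kappa>_def entry algebra_simps divide_simps a0\<close>)
    also have "\<dots> = (if i = j then 1 else 0) - u i * cnj (u j) / a - cnj (u j) * u i / cnj a
      + (a + cnj a) * \<kappa>"
      using ij by (simp add: sum.distrib uu flip: sum_distrib_right)
    also have "\<dots> = (if i = j then 1 else 0)" using a0 by (simp add: \<kappa>_def field_simps)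
    finally show "(mat_adjoint (householder n v) * householder n v) $$ (i, j) = 1\<^sub>m n $$ (i, j)"
      using ij by simp
  qed (use c in auto)
qed

text \<open>The Householder formula breaks down only when the first entry is 1; a unit vector then
  has no other entries and the identity serves. This is a pointwise completion, without continuity
  in \<open>v\<close>.\<close>

lemma exists_unitary_first_col:
  assumes v: "v \<in> carrier_vec n" "l2_norm v = 1" and n: "n > 0"
  obtains R where "unitary_mat n R" "col R 0 = v"
proof (cases "v $ 0 = 1")
  case False
  have "col (householder n v) 0 = v"
    by (rule eq_vecI) (use v in \<open>auto simp: householder_col_0[OF n False] n\<close>)
  then show ?thesis using that unitary_householder[OF v n False] by blast
next
  case True
  have "(\<Sum>i<n. (cmod (v $ i))\<^sup>2) = 1" using l2_norm_power2[of v] v by simp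
  moreover have "(\<Sum>i<n. (cmod (v $ i))\<^sup>2) = (cmod (v $ 0))\<^sup>2 + (\<Sum>i\<in>{..<n} - {0}. (cmod (v $ i))\<^sup>2)"
    by (rule sum.remove) (use n in auto)
  ultimately have "(\<Sum>i\<in>{..<n} - {0}. (cmod (v $ i))\<^sup>2) = 0" using True by simp
  then have "\<forall>i\<in>{..<n} - {0}. (cmod (v $ i))\<^sup>2 = 0"
    by (subst (asm) sum_nonneg_eq_0_iff) auto
  then have "col (1\<^sub>m n) 0 = v" using v n True by (intro eq_vecI) auto
  moreover have "unitary_mat n (1\<^sub>m n)"
    by (rule unitary_matI) (auto intro!: eq_matI simp: mult_mat_index[of _ n n _ n])
  ultimately show ?thesis using that by blast
qed

section \<open>Spectral theorem and eigenvalue perturbation\<close>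

lemma mult_carrier_square [simp]:
  "A \<in> carrier_mat n n \<Longrightarrow> B \<in> carrier_mat n n \<Longrightarrow> A * B \<in> carrier_mat n n"
  by (rule mult_carrier_mat)

lemma mult_vec_carrier_square [simp]:
  "A \<in> carrier_mat n n \<Longrightarrow> v \<in> carrier_vec n \<Longrightarrow> A *\<^sub>v v \<in> carrier_vec n"
  by (rule mult_mat_vec_carrier)

lemma l2_norm_eq_0_imp:
  assumes "l2_norm w = 0" "w \<in> carrier_vec n"
  shows "w = 0\<^sub>v n"
proof -
  have "(\<Sum>i<n. (cmod (w $ i))\<^sup>2) = 0" using l2_norm_power2[of w] assms by simp
  then have "\<forall>i\<in>{..<n}. (cmod (w $ i))\<^sup>2 = 0" by (subst (asm) sum_nonneg_eq_0_iff) auto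
  then show ?thesis using assms(2) by (intro eq_vecI) auto
qed

section \<open>Block sums with a scalar\<close>

definition diag_sum :: "complex \<Rightarrow> complex mat \<Rightarrow> complex mat" where
  "diag_sum c A = four_block_mat (Matrix.mat 1 1 (\<lambda>_. c)) (0\<^sub>m 1 (dim_col A)) (0\<^sub>m (dim_row A) 1) A"

lemma diag_sum_dims [simp]: "dim_row (diag_sum c A) = Suc (dim_row A)" "dim_col (diag_sum c A) = Suc (dim_col A)"
  by (simp_all add: diag_sum_def)

lemma diag_sum_carrier: "A \<in> carrier_mat n m \<Longrightarrow> diag_sum c A \<in> carrier_mat (Suc n) (Suc m)"
  by (intro carrier_matI) auto

lemma diag_sum_index:
  assumes "i < Suc (dim_row A)" "j < Suc (dim_col A)"
  shows "diag_sum c A $$ (i, j) = (if i = 0 then (if j = 0 then c else 0) else if j = 0 then 0 else A $$ (i - 1, j - 1))"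
  using assms by (auto simp: diag_sum_def less_Suc_eq_0_disj)

lemma diag_sum_mult:
  assumes A: "A \<in> carrier_mat n m" and B: "B \<in> carrier_mat m k"
  shows "diag_sum a A * diag_sum b B = diag_sum (a * b) (A * B)"
proof (rule eq_matI)
  note cA = diag_sum_carrier[OF A, of a] and cB = diag_sum_carrier[OF B, of b]
  fix i j assume "i < dim_row (diag_sum (a * b) (A * B))" "j < dim_col (diag_sum (a * b) (A * B))"
  then have ij: "i < Suc n" "j < Suc k" using A B by auto
  have "(diag_sum a A * diag_sum b B) $$ (i, j) = diag_sum a A $$ (i, 0) * diag_sum b B $$ (0, j)
    + (\<Sum>t<m. diag_sum a A $$ (i, Suc t) * diag_sum b B $$ (Suc t, j))"
    unfolding mult_mat_index[OF cA cB ij] by (rule sum.lessThan_Suc_shift)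
  also have "\<dots> = diag_sum (a * b) (A * B) $$ (i, j)"
    using ij A B by (auto simp: diag_sum_index less_Suc_eq_0_disj mult_mat_index[OF A B] simp del: index_mult_mat(1))
  finally show "(diag_sum a A * diag_sum b B) $$ (i, j) = diag_sum (a * b) (A * B) $$ (i, j)" .
qed (use A B in auto)

lemma diag_sum_adjoint: "mat_adjoint (diag_sum a A) = diag_sum (cnj a) (mat_adjoint A)"
  by (rule eq_matI) (auto simp: diag_sum_index less_Suc_eq_0_disj)

lemma diag_sum_one: "diag_sum 1 (1\<^sub>m n) = 1\<^sub>m (Suc n)"
  by (rule eq_matI) (auto simp: diag_sum_index less_Suc_eq_0_disj split: if_splits)

lemma diag_sum_diag: "diag_sum (f 0) (mat_diag n (\<lambda>i. f (Suc i))) = mat_diag (Suc n) f"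
  by (rule eq_matI) (auto simp: diag_sum_index less_Suc_eq_0_disj split: if_splits)

lemma unitary_diag_sum: "unitary_mat n U \<Longrightarrow> unitary_mat (Suc n) (diag_sum 1 U)"
  by (rule unitary_matI) (auto simp: unitary_mat_def diag_sum_adjoint diag_sum_mult[of _ n n _ n] diag_sum_one intro: diag_sum_carrier)

lemma char_poly_diag_sum:
  assumes A: "A \<in> carrier_mat n n"
  shows "char_poly (diag_sum c A) = [:- c, 1:] * char_poly A"
proof -
  have "char_poly (Matrix.mat 1 1 (\<lambda>_. c)) = [:- c, 1:]"
    by (subst char_poly_upper_triangular[of _ 1]) (auto simp: diag_mat_def upper_triangular_def)
  then show ?thesis
    unfolding diag_sum_def using A char_poly_four_block_zeros_col[of "Matrix.mat 1 1 (\<lambda>_. c)" "0\<^sub>m 1 n" n A]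
    by simp
qed

definition minor_00 :: "complex mat \<Rightarrow> complex mat" where
  "minor_00 A = Matrix.mat (dim_row A - 1) (dim_col A - 1) (\<lambda>(i, j). A $$ (Suc i, Suc j))"

lemma minor_00_carrier: "A \<in> carrier_mat (Suc n) (Suc m) \<Longrightarrow> minor_00 A \<in> carrier_mat n m"
  by (intro carrier_matI) (auto simp: minor_00_def)

lemma minor_00_index: "A \<in> carrier_mat (Suc n) (Suc m) \<Longrightarrow> i < n \<Longrightarrow> j < m \<Longrightarrow> minor_00 A $$ (i, j) = A $$ (Suc i, Suc j)"
  by (simp add: minor_00_def)

section \<open>Unitary conjugation and the spectral theorem\<close>

lemma hermitian_conj:
  fixes A R :: "complex mat"
  assumes A: "A \<in> carrier_mat n n" "mat_adjoint A = A" and R: "R \<in> carrier_mat n n"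
  shows "mat_adjoint (mat_adjoint R * A * R) = mat_adjoint R * A * R"
proof -
  have "mat_adjoint (mat_adjoint R * A * R) = mat_adjoint R * (mat_adjoint A * R)"
    using R A(1) by (simp add: mat_adjoint_mult[of _ n n _ n])
  then show ?thesis using A R
    by (simp add: assoc_mult_mat[of _ n n _ n _ n])
qed

lemma unitary_conj_cancel:
  assumes P: "unitary_mat n P" and D: "D \<in> carrier_mat n n"
  shows "mat_adjoint P * (P * D * mat_adjoint P) * P = D"
proof -
  have c: "P \<in> carrier_mat n n" "mat_adjoint P \<in> carrier_mat n n"
    and u: "mat_adjoint P * P = 1\<^sub>m n" using P by (auto simp: unitary_mat_def)
  have "mat_adjoint P * (P * D * mat_adjoint P) * P = (mat_adjoint P * P) * D * (mat_adjoint P * P)"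
    using c D by (simp add: assoc_mult_mat[of _ n n _ n _ n])
  then show ?thesis using D by (simp add: u)
qed

lemma unitary_conj_eq_iff:
  assumes P: "unitary_mat n P" and A: "A \<in> carrier_mat n n" and "mat_adjoint P * A * P = D"
  shows "A = P * D * mat_adjoint P"
  using unitary_conj_cancel[OF unitary_mat_adjoint[OF P] A] assms(3) by simp

lemma char_poly_unitary_conj:
  assumes P: "unitary_mat n P" and A: "A \<in> carrier_mat n n"
  shows "char_poly (mat_adjoint P * A * P) = char_poly A"
proof (rule char_poly_similar, rule similar_matI)
  show "{mat_adjoint P * A * P, A, mat_adjoint P, P} \<subseteq> carrier_mat n n"
    using P A by (auto simp: unitary_mat_def)
qed (use P in \<open>auto simp: unitary_mat_def\<close>)

text \<open>The list \<open>l\<close> is fixed in advance and in any order: an eigenvector for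
  \<open>l 0\<close> is split off, and cancelling one linear factor of the characteristic polynomial
  leaves the rest of the list for the complementary block. Multiplicities are thereby handled
  without eigenspaces.\<close>

lemma spectral_theorem_hermitian:
  assumes "A \<in> carrier_mat n n" "mat_adjoint A = A"
    and "char_poly A = (\<Prod>i<n. [:- complex_of_real (l i), 1:])"
  shows "\<exists>P. unitary_mat n P \<and> A = P * mat_diag n (\<lambda>i. complex_of_real (l i)) * mat_adjoint P"
  using assms
proof (induction n arbitrary: A l)
  case 0
  have "unitary_mat 0 (1\<^sub>m 0)" by (rule unitary_matI) auto
  moreover have "A = 1\<^sub>m 0 * mat_diag 0 (\<lambda>i. complex_of_real (l i)) * mat_adjoint (1\<^sub>m 0)"
    by (rule eq_matI) (use 0 in auto)
  ultimately show ?case by blast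
next
  case (Suc n)
  note A = Suc.prems(1) and herm = Suc.prems(2) and cp = Suc.prems(3)
  have "poly (char_poly A) (of_real (l 0)) = 0"
    unfolding cp poly_prod by (rule prod_zero) (auto intro: bexI[of _ 0])
  then have "eigenvalue A (of_real (l 0))" using eigenvalue_root_char_poly[OF A] by simp
  then obtain w where w: "w \<in> carrier_vec (Suc n)" "w \<noteq> 0\<^sub>v (Suc n)" "A *\<^sub>v w = of_real (l 0) \<cdot>\<^sub>v w"
    using A by (auto simp: eigenvalue_def eigenvector_def)
  have w0: "l2_norm w \<noteq> 0" using l2_norm_eq_0_imp[OF _ w(1)] w(2) by blast
  define v where "v = of_real (1 / l2_norm w) \<cdot>\<^sub>v w"
  have v: "v \<in> carrier_vec (Suc n)" using w by (simp add: v_def)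
  have "(\<Sum>i<Suc n. (cmod (w $ i))\<^sup>2) \<noteq> 0"
    using w0 w(1) l2_norm_power2[of w] by (auto simp del: sum.lessThan_Suc)
  then have "(l2_norm v)\<^sup>2 = 1"
    using w0 w(1) unfolding l2_norm_power2 by (simp add: v_def norm_mult norm_divide power_divide sum_nonneg
        l2_norm_power2 del: sum.lessThan_Suc flip: sum_divide_distrib)
  then have v1: "l2_norm v = 1" using l2_norm_nonneg[of v] by (simp add: power2_eq_1_iff)
  have Av: "A *\<^sub>v v = of_real (l 0) \<cdot>\<^sub>v v"
    unfolding v_def mult_mat_vec[OF A w(1)] w(3) by (simp add: smult_smult_assoc mult.commute)
  obtain R where R: "unitary_mat (Suc n) R" "col R 0 = v"
    using exists_unitary_first_col[OF v v1] by blast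
  have Rc: "R \<in> carrier_mat (Suc n) (Suc n)" and RR: "mat_adjoint R * R = 1\<^sub>m (Suc n)"
    using R by (auto simp: unitary_mat_def)
  define B where "B = mat_adjoint R * A * R"
  have Bc: "B \<in> carrier_mat (Suc n) (Suc n)" using Rc A by (simp add: B_def)
  have Bherm: "mat_adjoint B = B" unfolding B_def by (rule hermitian_conj[OF A herm Rc])
  have "col B 0 = (mat_adjoint R * A) *\<^sub>v v"
    unfolding B_def R(2)[symmetric] by (rule col_mult2) (use Rc A in auto)
  also have "\<dots> = mat_adjoint R *\<^sub>v (A *\<^sub>v v)"
    by (rule assoc_mult_mat_vec) (use Rc A v in auto)
  also have "\<dots> = of_real (l 0) \<cdot>\<^sub>v (mat_adjoint R *\<^sub>v v)"
    unfolding Av by (rule mult_mat_vec) (use Rc v in auto)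
  also have "mat_adjoint R *\<^sub>v v = col (mat_adjoint R * R) 0"
    unfolding R(2)[symmetric] by (rule col_mult2[symmetric]) (use Rc in auto)
  finally have col0: "col B 0 = of_real (l 0) \<cdot>\<^sub>v unit_vec (Suc n) 0" by (simp add: RR)
  have B0: "B $$ (i, 0) = (if i = 0 then of_real (l 0) else 0)" if "i < Suc n" for i
    using arg_cong[OF col0, of "\<lambda>x. x $ i"] that Bc by (auto simp: unit_vec_def)
  have B0': "B $$ (0, i) = (if i = 0 then of_real (l 0) else 0)" if "i < Suc n" for i
    using arg_cong[OF Bherm, of "\<lambda>x. x $$ (0, i)"] that Bc B0[OF that] by (simp split: if_splits)
  define C where "C = minor_00 B"
  have Cc: "C \<in> carrier_mat n n" unfolding C_def by (rule minor_00_carrier[OF Bc])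
  have BC: "B = diag_sum (of_real (l 0)) C"
    by (rule eq_matI) (use Bc Cc B0 B0' in \<open>auto simp: diag_sum_index less_Suc_eq_0_disj C_def minor_00_index[OF Bc]\<close>)
  have Cherm: "mat_adjoint C = C"
  proof (rule eq_matI)
    fix i j assume "i < dim_row C" "j < dim_col C"
    then have ij: "i < n" "j < n" using Cc by auto
    have "mat_adjoint B $$ (Suc i, Suc j) = B $$ (Suc i, Suc j)" using Bherm by simp
    then show "mat_adjoint C $$ (i, j) = C $$ (i, j)"
      using ij Bc Cc by (simp add: C_def minor_00_index[OF Bc])
  qed (use Cc in auto)
  have "[:- complex_of_real (l 0), 1:] * char_poly C = char_poly A"
    using char_poly_unitary_conj[OF R(1) A] char_poly_diag_sum[OF Cc] by (simp add: B_def[symmetric] BC)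
  also have "\<dots> = [:- complex_of_real (l 0), 1:] * (\<Prod>i<n. [:- complex_of_real (l (Suc i)), 1:])"
    unfolding cp by (rule prod.lessThan_Suc_shift)
  finally have "char_poly C = (\<Prod>i<n. [:- complex_of_real (l (Suc i)), 1:])"
    by (metis mult_cancel_left pCons_eq_0_iff zero_neq_one)
  from Suc.IH[OF Cc Cherm this] obtain P where P: "unitary_mat n P"
    "C = P * mat_diag n (\<lambda>i. complex_of_real (l (Suc i))) * mat_adjoint P" by blast
  have Pc: "P \<in> carrier_mat n n" using P by (simp add: unitary_mat_def)
  have PP: "unitary_mat (Suc n) (diag_sum 1 P)" using P by (simp add: unitary_diag_sum)
  let ?D = "mat_diag (Suc n) (\<lambda>i. complex_of_real (l i))"
  have "B = diag_sum 1 P * ?D * mat_adjoint (diag_sum 1 P)"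
    unfolding BC P(2) diag_sum_adjoint using Pc
    by (subst diag_sum_diag[symmetric]) (simp add: diag_sum_mult[of _ n n _ n])
  then have "A = R * (diag_sum 1 P * ?D * mat_adjoint (diag_sum 1 P)) * mat_adjoint R"
    using unitary_conj_eq_iff[OF R(1) A B_def[symmetric]] by simp
  also have "\<dots> = (R * diag_sum 1 P) * ?D * mat_adjoint (R * diag_sum 1 P)"
    using Rc Pc diag_sum_carrier[OF Pc, of 1]
    by (simp add: mat_adjoint_mult[of _ "Suc n" "Suc n" _ "Suc n"]
        assoc_mult_mat[of _ "Suc n" "Suc n" _ "Suc n" _ "Suc n"])
  finally show ?case using unitary_mat_mult[OF R(1) PP] by blast
qed

lemma hermitian_eigenvalue_real:
  fixes A :: "complex mat"
  assumes A: "A \<in> carrier_mat n n" "mat_adjoint A = A" and "eigenvalue A a"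
  shows "a \<in> \<real>"
proof -
  obtain w where w: "w \<in> carrier_vec n" "w \<noteq> 0\<^sub>v n" "A *\<^sub>v w = a \<cdot>\<^sub>v w"
    using assms by (auto simp: eigenvalue_def eigenvector_def)
  have "cinner (a \<cdot>\<^sub>v w) w = cinner w (a \<cdot>\<^sub>v w)"
    using cinner_adjoint[OF A(1) w(1) w(1)] A(2) w(3) by simp
  then have "a * cinner w w = cnj a * cinner w w"
    using w(1) by (simp add: cinner_def sum_distrib_left mult_ac)
  moreover have "cinner w w \<noteq> 0"
    using l2_norm_eq_0_imp[OF _ w(1)] w(2) unfolding cinner_self by auto
  ultimately have "cnj a = a" by simp
  then show ?thesis by (simp add: Reals_cnj_iff)
qed

text \<open>All roots are real, so sorting their real parts merely permutes the linear factors of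
  the characteristic polynomial; equality of multisets carries the product over.\<close>

lemma exists_ordered_eigenvalues:
  assumes A: "A \<in> carrier_mat n n" "mat_adjoint A = A"
  shows "\<exists>l. ordered_eigenvalues A l"
proof -
  obtain as where as: "char_poly A = (\<Prod>a\<leftarrow>as. [:- a, 1:])" "length as = n"
    using char_poly_factorized[OF A(1)] by blast
  have real: "of_real (Re a) = a" if "a \<in> set as" for a
  proof -
    have "poly (char_poly A) a = 0"
      unfolding as(1) poly_prod_list using that by (auto simp: prod_list_zero_iff o_def)
    then have "a \<in> \<real>" using hermitian_eigenvalue_real[OF A] eigenvalue_root_char_poly[OF A(1)] by simp
    then show ?thesis by (simp add: of_real_Re)
  qed
  define rs where "rs = rev (sort (map Re as))"
  have len: "length rs = n" by (simp add: rs_def as)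
  have "mset (map complex_of_real rs) = mset as"
  proof -
    have "mset (map complex_of_real rs) = image_mset complex_of_real (mset (map Re as))"
      by (simp add: rs_def)
    also have "\<dots> = mset (map complex_of_real (map Re as))" by (simp only: mset_map)
    also have "map complex_of_real (map Re as) = as" using real by (simp add: map_idI)
    finally show ?thesis .
  qed
  then have "prod_mset (image_mset (\<lambda>a. [:- a, 1:]) (mset (map complex_of_real rs))) = char_poly A"
    unfolding as(1) by (simp add: prod_mset_prod_list flip: mset_map)
  then have "char_poly A = (\<Prod>r\<leftarrow>rs. [:- complex_of_real r, 1:])"
    by (simp add: o_def prod_mset_prod_list flip: mset_map)
  also have "\<dots> = (\<Prod>i<n. [:- complex_of_real (rs ! i), 1:])"
    by (simp add: prod.list_conv_set_nth len lessThan_atLeast0)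
  finally have "char_poly A = (\<Prod>i<n. [:- complex_of_real (rs ! i), 1:])" .
  moreover have "rs ! j \<le> rs ! i" if "i \<le> j" "j < n" for i j
  proof -
    have "sorted (rev rs)" by (simp add: rs_def)
    then show ?thesis using sorted_rev_nth_mono that len by blast
  qed
  ultimately show ?thesis using A by (auto simp: ordered_eigenvalues_def intro!: exI[of _ "\<lambda>i. rs ! i"])
qed


section \<open>Rayleigh quotients and perturbation of eigenvalues\<close>

lemma unitary_matD:
  assumes "unitary_mat n U"
  shows "U \<in> carrier_mat n n" "mat_adjoint U \<in> carrier_mat n n" "U * mat_adjoint U = 1\<^sub>m n" "mat_adjoint U * U = 1\<^sub>m n"
  using assms by (auto simp: unitary_mat_def)

lemma unitary_adjoint_cancel_vec:
  assumes P: "unitary_mat n P" and y: "y \<in> carrier_vec n"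
  shows "mat_adjoint P *\<^sub>v (P *\<^sub>v y) = y" "P *\<^sub>v (mat_adjoint P *\<^sub>v y) = y"
  using unitary_matD[OF P] y by (simp_all flip: assoc_mult_mat_vec[of _ n n _ n])

lemma mult_diag_vec:
  assumes "y \<in> carrier_vec n"
  shows "mat_diag n f *\<^sub>v y = Matrix.vec n (\<lambda>i. f i * y $ i)"
proof (rule eq_vecI)
  fix i assume "i < dim_vec (Matrix.vec n (\<lambda>i. f i * y $ i))"
  then have i: "i < n" by simp
  have "(mat_diag n f *\<^sub>v y) $ i = (\<Sum>t<n. mat_diag n f $$ (i, t) * y $ t)"
    by (rule mult_mat_vec_index) (use assms i in auto)
  also have "\<dots> = (\<Sum>t<n. if t = i then f i * y $ i else 0)"
    by (rule sum.cong) (use i in auto)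
  finally show "(mat_diag n f *\<^sub>v y) $ i = Matrix.vec n (\<lambda>i. f i * y $ i) $ i" using i by simp
qed simp

lemma diagonalized_mult_vec:
  assumes P: "unitary_mat n P" and y: "y \<in> carrier_vec n"
  shows "(P * mat_diag n f * mat_adjoint P) *\<^sub>v y = P *\<^sub>v Matrix.vec n (\<lambda>i. f i * (mat_adjoint P *\<^sub>v y) $ i)"
proof -
  note c = unitary_matD[OF P]
  have "(P * mat_diag n f * mat_adjoint P) *\<^sub>v y = P *\<^sub>v (mat_diag n f *\<^sub>v (mat_adjoint P *\<^sub>v y))"
    using c y by (simp add: assoc_mult_mat_vec[of _ n n _ n])
  then show ?thesis using mult_diag_vec[of "mat_adjoint P *\<^sub>v y" n f] c y
    by simp
qed

lemma cinner_diagonalized: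
  assumes P: "unitary_mat n P" and y: "y \<in> carrier_vec n"
  shows "cinner ((P * mat_diag n (\<lambda>i. complex_of_real (l i)) * mat_adjoint P) *\<^sub>v y) y
    = of_real (\<Sum>i<n. l i * (cmod ((mat_adjoint P *\<^sub>v y) $ i))\<^sup>2)"
proof -
  note c = unitary_matD[OF P]
  let ?z = "mat_adjoint P *\<^sub>v y"
  have z: "?z \<in> carrier_vec n" using c y by simp
  have "cinner ((P * mat_diag n (\<lambda>i. complex_of_real (l i)) * mat_adjoint P) *\<^sub>v y) y
    = cinner (Matrix.vec n (\<lambda>i. complex_of_real (l i) * ?z $ i)) ?z"
    unfolding diagonalized_mult_vec[OF P y] by (rule cinner_adjoint[OF c(1) _ y]) simp
  also have "\<dots> = (\<Sum>i<n. of_real (l i * (cmod (?z $ i))\<^sup>2))"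
    unfolding cinner_def using z c(1)
    by (intro sum.cong) (auto simp: complex_norm_square mult.assoc simp del: of_real_power index_mult_mat_vec)
  finally show ?thesis by simp
qed

text \<open>There are \<open>k\<close> homogeneous equations in \<open>k + 1\<close> unknowns. A row
  of zeros makes the coefficient matrix square with determinant 0, and a kernel vector is padded
  with zeros.\<close>

lemma exists_vec_underdetermined:
  fixes W :: "complex mat"
  assumes W: "W \<in> carrier_mat n n" and k: "k < n"
  obtains y where "y \<in> carrier_vec n" "y \<noteq> 0\<^sub>v n" "\<And>i. k < i \<Longrightarrow> i < n \<Longrightarrow> y $ i = 0"
    "\<And>j. j < k \<Longrightarrow> (W *\<^sub>v y) $ j = 0"
proof -
  define N where "N = Matrix.mat (Suc k) (Suc k) (\<lambda>(i, j). if i < k then W $$ (i, j) else 0)"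
  have N: "N \<in> carrier_mat (Suc k) (Suc k)" by (simp add: N_def)
  have "Determinant.det N = (\<Sum>j<Suc k. N $$ (k, j) * cofactor N k j)"
    by (rule laplace_expansion_row[OF N]) simp
  also have "\<dots> = 0" by (rule sum.neutral) (auto simp: N_def)
  finally obtain c where c: "c \<in> carrier_vec (Suc k)" "c \<noteq> 0\<^sub>v (Suc k)" "N *\<^sub>v c = 0\<^sub>v (Suc k)"
    using det_0_iff_vec_prod_zero[OF N] by blast
  define y where "y = Matrix.vec n (\<lambda>i. if i \<le> k then c $ i else 0)"
  show ?thesis
  proof (rule that[of y])
    show yc: "y \<in> carrier_vec n" by (simp add: y_def)
    show "y \<noteq> 0\<^sub>v n"
    proof
      assume y0: "y = 0\<^sub>v n"
      have "c = 0\<^sub>v (Suc k)"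
      proof (rule eq_vecI)
        fix i assume "i < dim_vec (0\<^sub>v (Suc k) :: complex Matrix.vec)"
        then have "i \<le> k" by simp
        then show "c $ i = 0\<^sub>v (Suc k) $ i"
          using arg_cong[OF y0, of "\<lambda>x. x $ i"] k by (simp add: y_def)
      qed (use c in simp)
      then show False using c(2) by blast
    qed
    show "y $ i = 0" if "k < i" "i < n" for i using that by (simp add: y_def)
    fix j assume j: "j < k"
    have "(W *\<^sub>v y) $ j = (\<Sum>t<n. W $$ (j, t) * y $ t)"
      by (rule mult_mat_vec_index[OF W yc]) (use j k in simp)
    also have "\<dots> = (\<Sum>t<Suc k. W $$ (j, t) * y $ t)"
      by (rule sum.mono_neutral_right) (use k in \<open>auto simp: y_def\<close>)
    also have "\<dots> = (\<Sum>t<Suc k. N $$ (j, t) * c $ t)"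
      by (rule sum.cong) (use j k in \<open>auto simp: y_def N_def\<close>)
    also have "\<dots> = (N *\<^sub>v c) $ j"
      by (rule mult_mat_vec_index[OF N c(1), symmetric]) (use j in simp)
    finally show "(W *\<^sub>v y) $ j = 0" using c(3) j by simp
  qed
qed

text \<open>Courant--Fischer: some nonzero \<open>y\<close> lies in the span of the first \<open>k + 1\<close> eigenvectors of \<open>A\<close> and is
  orthogonal to the first \<open>k\<close> eigenvectors of \<open>B\<close>.\<close>

lemma weyl_one_sided:
  assumes P: "unitary_mat n P" and Q: "unitary_mat n Q"
    and A: "A = P * mat_diag n (\<lambda>i. complex_of_real (l i)) * mat_adjoint P"
    and B: "B = Q * mat_diag n (\<lambda>i. complex_of_real (m i)) * mat_adjoint Q"
    and l: "\<And>i j. i \<le> j \<Longrightarrow> j < n \<Longrightarrow> l j \<le> l i" and m: "\<And>i j. i \<le> j \<Longrightarrow> j < n \<Longrightarrow> m j \<le> m i"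
    and k: "k < n"
  shows "l k - m k \<le> fnorm (A - B)"
proof -
  note cP = unitary_matD[OF P] and cQ = unitary_matD[OF Q]
  \<comment> \<open>\<open>W\<close> turns coordinates in the eigenbasis of \<open>A\<close> into
    coordinates in that of \<open>B\<close>, so both conditions on \<open>y\<close> become vanishing
    of entries: of \<open>z\<close> beyond \<open>k\<close>, of \<open>W *\<^sub>v z\<close> before
    \<open>k\<close>.\<close>
  define W where "W = mat_adjoint Q * P"
  have W: "W \<in> carrier_mat n n" using cP cQ by (simp add: W_def)
  have Wu: "unitary_mat n W" unfolding W_def by (rule unitary_mat_mult[OF unitary_mat_adjoint[OF Q] P])
  obtain z where z: "z \<in> carrier_vec n" "z \<noteq> 0\<^sub>v n" "\<And>i. k < i \<Longrightarrow> i < n \<Longrightarrow> z $ i = 0"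
    "\<And>j. j < k \<Longrightarrow> (W *\<^sub>v z) $ j = 0"
    using exists_vec_underdetermined[OF W k] by blast
  define y where "y = P *\<^sub>v z"
  have y: "y \<in> carrier_vec n" using cP z by (simp add: y_def)
  have Py: "mat_adjoint P *\<^sub>v y = z" unfolding y_def by (rule unitary_adjoint_cancel_vec[OF P z(1)])
  have Qy: "mat_adjoint Q *\<^sub>v y = W *\<^sub>v z" unfolding y_def W_def
    by (rule assoc_mult_mat_vec[symmetric]) (use cQ cP z in auto)
  have yz: "l2_norm y = l2_norm z" unfolding y_def by (rule l2_norm_unitary[OF P z(1)])
  have z0: "l2_norm z > 0"
    using l2_norm_eq_0_imp[OF _ z(1)] z(2) l2_norm_nonneg[of z] by (metis less_eq_real_def)
  have Ac: "A \<in> carrier_mat n n" and Bc: "B \<in> carrier_mat n n"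
    using cP cQ by (simp_all add: A B)
  have "l k * (l2_norm z)\<^sup>2 = (\<Sum>i<n. l k * (cmod (z $ i))\<^sup>2)"
    using z(1) by (simp add: l2_norm_power2 sum_distrib_left)
  also have "\<dots> \<le> (\<Sum>i<n. l i * (cmod (z $ i))\<^sup>2)"
  proof (rule sum_mono)
    fix i assume "i \<in> {..<n}"
    then show "l k * (cmod (z $ i))\<^sup>2 \<le> l i * (cmod (z $ i))\<^sup>2"
      using l[of i k] k z(3)[of i] by (cases "i \<le> k") (auto intro: mult_right_mono)
  qed
  finally have 1: "l k * (l2_norm z)\<^sup>2 \<le> (\<Sum>i<n. l i * (cmod (z $ i))\<^sup>2)" .
  have "(\<Sum>i<n. m i * (cmod ((W *\<^sub>v z) $ i))\<^sup>2) \<le> (\<Sum>i<n. m k * (cmod ((W *\<^sub>v z) $ i))\<^sup>2)"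
  proof (rule sum_mono)
    fix i assume "i \<in> {..<n}"
    then show "m i * (cmod ((W *\<^sub>v z) $ i))\<^sup>2 \<le> m k * (cmod ((W *\<^sub>v z) $ i))\<^sup>2"
      using m[of k i] z(4)[of i] by (cases "i < k") (auto intro: mult_right_mono simp del: index_mult_mat_vec)
  qed
  also have "\<dots> = m k * (l2_norm (W *\<^sub>v z))\<^sup>2"
    using W by (simp add: l2_norm_power2 sum_distrib_left del: index_mult_mat_vec)
  finally have 2: "(\<Sum>i<n. m i * (cmod ((W *\<^sub>v z) $ i))\<^sup>2) \<le> m k * (l2_norm z)\<^sup>2"
    using l2_norm_unitary[OF Wu z(1)] by simp
  have "cinner ((A - B) *\<^sub>v y) y = cinner (A *\<^sub>v y) y - cinner (B *\<^sub>v y) y"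
    unfolding minus_mult_distrib_mat_vec[OF Ac Bc y] using Ac Bc y
    by (simp add: cinner_def algebra_simps sum_subtractf del: index_mult_mat_vec)
  also have "\<dots> = of_real ((\<Sum>i<n. l i * (cmod (z $ i))\<^sup>2) - (\<Sum>i<n. m i * (cmod ((W *\<^sub>v z) $ i))\<^sup>2))"
    unfolding A B cinner_diagonalized[OF P y] cinner_diagonalized[OF Q y] Py Qy by simp
  finally have "cinner ((A - B) *\<^sub>v y) y
    = of_real ((\<Sum>i<n. l i * (cmod (z $ i))\<^sup>2) - (\<Sum>i<n. m i * (cmod ((W *\<^sub>v z) $ i))\<^sup>2))" .
  then have "(\<Sum>i<n. l i * (cmod (z $ i))\<^sup>2) - (\<Sum>i<n. m i * (cmod ((W *\<^sub>v z) $ i))\<^sup>2)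
    \<le> cmod (cinner ((A - B) *\<^sub>v y) y)"
    by (simp only: norm_of_real abs_ge_self)
  also have "\<dots> \<le> l2_norm ((A - B) *\<^sub>v y) * l2_norm y"
    by (rule cmod_cinner_le[of _ n]) (use minus_carrier_mat[OF Bc, of A] y in simp_all)
  also have "\<dots> \<le> fnorm (A - B) * l2_norm y * l2_norm y"
    by (intro mult_right_mono l2_norm_mult_mat_vec[of _ n n]) (use minus_carrier_mat[OF Bc, of A] y in simp_all)
  finally have "(l k - m k) * (l2_norm z)\<^sup>2 \<le> fnorm (A - B) * (l2_norm z)\<^sup>2"
    using 1 2 by (simp add: yz power2_eq_square algebra_simps)
  then show ?thesis using z0 by simp
qed

lemma weyl_inequality:
  assumes A: "A \<in> carrier_mat n n" "mat_adjoint A = A" "ordered_eigenvalues A l"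
    and B: "B \<in> carrier_mat n n" "mat_adjoint B = B" "ordered_eigenvalues B m"
    and k: "k < n"
  shows "\<bar>l k - m k\<bar> \<le> fnorm (A - B)"
proof -
  have l: "\<And>i j. i \<le> j \<Longrightarrow> j < n \<Longrightarrow> l j \<le> l i" "char_poly A = (\<Prod>i<n. [:- complex_of_real (l i), 1:])"
    and m: "\<And>i j. i \<le> j \<Longrightarrow> j < n \<Longrightarrow> m j \<le> m i" "char_poly B = (\<Prod>i<n. [:- complex_of_real (m i), 1:])"
    using A B by (auto simp: ordered_eigenvalues_def)
  obtain P where P: "unitary_mat n P" "A = P * mat_diag n (\<lambda>i. complex_of_real (l i)) * mat_adjoint P"
    using spectral_theorem_hermitian[OF A(1,2) l(2)] by blast
  obtain Q where Q: "unitary_mat n Q" "B = Q * mat_diag n (\<lambda>i. complex_of_real (m i)) * mat_adjoint Q"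
    using spectral_theorem_hermitian[OF B(1,2) m(2)] by blast
  have "l k - m k \<le> fnorm (A - B)" by (rule weyl_one_sided[OF P(1) Q(1) P(2) Q(2) l(1) m(1) k])
  moreover have "m k - l k \<le> fnorm (B - A)" by (rule weyl_one_sided[OF Q(1) P(1) Q(2) P(2) m(1) l(1) k])
  ultimately show ?thesis using fnorm_commute[OF A(1) B(1)] by simp
qed

text \<open>In the eigenbases the two differences have entries \<open>(f (l i) - f (m j)) W\<^sub>i\<^sub>j\<close> and
  \<open>(l i - m j) W\<^sub>i\<^sub>j\<close>.\<close>

lemma functional_calculus_lipschitz:
  assumes P: "unitary_mat n P" and Q: "unitary_mat n Q"
    and f: "\<And>s t. \<bar>f s - f t\<bar> \<le> \<bar>s - t\<bar>"
  shows "fnorm (P * mat_diag n (\<lambda>i. complex_of_real (f (l i))) * mat_adjoint P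
      - Q * mat_diag n (\<lambda>i. complex_of_real (f (m i))) * mat_adjoint Q)
    \<le> fnorm (P * mat_diag n (\<lambda>i. complex_of_real (l i)) * mat_adjoint P
      - Q * mat_diag n (\<lambda>i. complex_of_real (m i)) * mat_adjoint Q)"
proof -
  note cP = unitary_matD[OF P] and cQ = unitary_matD[OF Q]
  define W where "W = mat_adjoint P * Q"
  have W: "W \<in> carrier_mat n n" using cP cQ by (simp add: W_def)
  have key: "fnorm (P * mat_diag n g * mat_adjoint P - Q * mat_diag n h * mat_adjoint Q)
    = L2_set (\<lambda>p. cmod ((g (fst p) - h (snd p)) * W $$ p)) ({..<n} \<times> {..<n})" for g h
  proof -
    let ?X = "P * mat_diag n g * mat_adjoint P - Q * mat_diag n h * mat_adjoint Q"
    have X: "?X \<in> carrier_mat n n" using cP cQ by (simp add: minus_carrier_mat)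
    have "mat_adjoint P * ?X * Q = mat_adjoint P * (P * mat_diag n g * mat_adjoint P) * Q
      - mat_adjoint P * (Q * mat_diag n h * mat_adjoint Q) * Q"
      using cP cQ by (simp add: mult_minus_distrib_mat[of _ n n _ n] minus_mult_distrib_mat[of _ n n _ _ n])
    also have "mat_adjoint P * (P * mat_diag n g * mat_adjoint P) * Q = (mat_adjoint P * P) * mat_diag n g * W"
      unfolding W_def using cP(1,2) cQ(1,2) by (simp add: assoc_mult_mat[of _ n n _ n _ n])
    also have "mat_adjoint P * (Q * mat_diag n h * mat_adjoint Q) * Q = W * mat_diag n h * (mat_adjoint Q * Q)"
      unfolding W_def using cP(1,2) cQ(1,2) by (simp add: assoc_mult_mat[of _ n n _ n _ n])
    finally have eq: "mat_adjoint P * ?X * Q = mat_diag n g * W - W * mat_diag n h"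
      using W unfolding cP(4) cQ(4) by (simp add: left_mult_one_mat[of _ n n] right_mult_one_mat[of _ n n])
    have "fnorm ?X = fnorm (mat_adjoint P * ?X * Q)"
      using fnorm_unitary_right[OF Q, of "mat_adjoint P * ?X" n] fnorm_unitary_left[OF unitary_mat_adjoint[OF P] X] X cP
      by simp
    also have "\<dots> = L2_set (\<lambda>p. cmod ((g (fst p) - h (snd p)) * W $$ p)) ({..<n} \<times> {..<n})"
      unfolding eq fnorm_def mat_diag_mult_left[OF W] mat_diag_mult_right[OF W]
      by (intro L2_set_cong) (auto simp: algebra_simps)
    finally show ?thesis .
  qed
  show ?thesis unfolding key
  proof (rule L2_set_mono)
    fix p
    have "cmod (complex_of_real (f (l (fst p))) - complex_of_real (f (m (snd p)))) \<le> cmod (complex_of_real (l (fst p)) - complex_of_real (m (snd p)))"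
      using f[of "l (fst p)" "m (snd p)"] by (metis norm_of_real of_real_diff)
    then show "cmod ((complex_of_real (f (l (fst p))) - complex_of_real (f (m (snd p)))) * W $$ p)
      \<le> cmod ((complex_of_real (l (fst p)) - complex_of_real (m (snd p))) * W $$ p)"
      unfolding norm_mult by (rule mult_right_mono) simp
  qed simp
qed

section \<open>Deflation\<close>

text \<open>A continuous majorant vanishing at \<open>p\<close> is the form in which perturbation
  inequalities arrive: the distance \<open>fnorm (A x - A p)\<close> bounds the change of an
  eigenvalue or of a Lipschitz function of the matrix.\<close>

lemma continuous_map_dominated:
  fixes f :: "'a \<Rightarrow> 'b::real_normed_vector"
  assumes "\<And>p. p \<in> topspace M \<Longrightarrow> \<exists>g. continuous_map M euclideanreal g \<and> g p = 0 \<and>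
    (\<forall>x\<in>topspace M. norm (f x - f p) \<le> g x)"
  shows "continuous_map M euclidean f"
  unfolding continuous_map_atin limitin_canonical_iff
proof
  fix p assume p: "p \<in> topspace M"
  then obtain g where g: "continuous_map M euclideanreal g" "g p = 0"
    "\<forall>x\<in>topspace M. norm (f x - f p) \<le> g x" using assms by blast
  have "(g \<longlongrightarrow> 0) (atin M p)" using g(1,2) p by (auto simp: continuous_map_atin)
  moreover have "eventually (\<lambda>x. norm (f x - f p) \<le> g x) (atin M p)"
    unfolding eventually_atin using g(3) by (intro disjI2 conjI p exI[of _ "topspace M"]) auto
  ultimately have "((\<lambda>x. f x - f p) \<longlongrightarrow> 0) (atin M p)" by (rule Lim_null_comparison[rotated])
  then show "(f \<longlongrightarrow> f p) (atin M p)" using Lim_null by blast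
qed

section \<open>Continuous matrix-valued maps\<close>

lemma cont_mat_carrier: "A \<in> cont_mat M n \<Longrightarrow> x \<in> topspace M \<Longrightarrow> A x \<in> carrier_mat n n"
  by (simp add: cont_mat_def)

lemma cont_mat_index:
  "A \<in> cont_mat M n \<Longrightarrow> i < n \<Longrightarrow> j < n \<Longrightarrow> continuous_map M euclidean (\<lambda>x. A x $$ (i, j))"
  by (simp add: cont_mat_def)

lemma cont_matI:
  assumes "\<And>x. x \<in> topspace M \<Longrightarrow> A x \<in> carrier_mat n n"
    and "\<And>i j. i < n \<Longrightarrow> j < n \<Longrightarrow> continuous_map M euclidean (f i j)"
    and "\<And>x i j. x \<in> topspace M \<Longrightarrow> i < n \<Longrightarrow> j < n \<Longrightarrow> f i j x = A x $$ (i, j)"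
  shows "A \<in> cont_mat M n"
  unfolding cont_mat_def using assms(1) by (auto intro: continuous_map_eq[OF assms(2,3)])

lemma cont_mat_mult:
  assumes A: "A \<in> cont_mat M n" and B: "B \<in> cont_mat M n"
  shows "(\<lambda>x. A x * B x) \<in> cont_mat M n"
proof (rule cont_matI[where f = "\<lambda>i j x. \<Sum>t<n. A x $$ (i, t) * B x $$ (t, j)"])
  show "continuous_map M euclidean (\<lambda>x. \<Sum>t<n. A x $$ (i, t) * B x $$ (t, j))" if "i < n" "j < n" for i j
    by (intro cmap_intros cont_mat_index[OF A] cont_mat_index[OF B]) (use that in auto)
qed (use cont_mat_carrier[OF A] cont_mat_carrier[OF B] in \<open>auto simp: mult_mat_index[of _ n n _ n] simp del: index_mult_mat(1)\<close>)

lemma cont_mat_adjoint: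
  assumes A: "A \<in> cont_mat M n"
  shows "(\<lambda>x. mat_adjoint (A x)) \<in> cont_mat M n"
proof (rule cont_matI[where f = "\<lambda>i j x. cnj (A x $$ (j, i))"])
  show "continuous_map M euclidean (\<lambda>x. cnj (A x $$ (j, i)))" if "i < n" "j < n" for i j
    by (intro cmap_intros cont_mat_index[OF A] that)
  show "cnj (A x $$ (j, i)) = mat_adjoint (A x) $$ (i, j)" if "x \<in> topspace M" "i < n" "j < n" for x i j
    using cont_mat_carrier[OF A that(1)] that by simp
qed (use cont_mat_carrier[OF A] in auto)

lemma continuous_map_fnorm_diff:
  assumes A: "A \<in> cont_mat M n" and B: "B \<in> cont_mat M n"
  shows "continuous_map M euclideanreal (\<lambda>x. fnorm (A x - B x))"
proof (rule continuous_map_eq)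
  have "continuous_map M euclideanreal (\<lambda>x. \<Sum>i<n. \<Sum>j<n. (cmod (A x $$ (i, j) - B x $$ (i, j)))\<^sup>2)"
    by (intro cmap_intros cont_mat_index[OF A] cont_mat_index[OF B]) auto
  then show "continuous_map M euclideanreal (\<lambda>x. sqrt (\<Sum>i<n. \<Sum>j<n. (cmod (A x $$ (i, j) - B x $$ (i, j)))\<^sup>2))"
    by (rule continuous_map_euclidean_compose) (intro continuous_intros)
  fix x assume x: "x \<in> topspace M"
  have "(fnorm (A x - B x))\<^sup>2 = (\<Sum>i<n. \<Sum>j<n. (cmod (A x $$ (i, j) - B x $$ (i, j)))\<^sup>2)"
    unfolding fnorm_power2 using cont_mat_carrier[OF A x] cont_mat_carrier[OF B x] by simp
  then show "sqrt (\<Sum>i<n. \<Sum>j<n. (cmod (A x $$ (i, j) - B x $$ (i, j)))\<^sup>2) = fnorm (A x - B x)"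
    by (metis fnorm_nonneg real_sqrt_abs abs_of_nonneg)
qed

lemma cont_mat_const: "A \<in> carrier_mat n n \<Longrightarrow> (\<lambda>x. A) \<in> cont_mat M n"
  by (rule cont_matI[where f = "\<lambda>i j x. A $$ (i, j)"]) auto

lemma fnorm_diff_self: "fnorm (A - A) = 0"
  unfolding fnorm_def L2_set_def by (simp, rule sum.neutral) auto

lemma cont_unitary_iff:
  "U \<in> cont_unitary M n \<longleftrightarrow> U \<in> cont_mat M n \<and> (\<forall>x\<in>topspace M. unitary_mat n (U x))"
  by (auto simp: cont_unitary_def unitary_mat_def cont_mat_def)

lemma cont_self_adjointD:
  assumes "A \<in> cont_self_adjoint M n"
  shows "A \<in> cont_mat M n" "\<And>x. x \<in> topspace M \<Longrightarrow> A x \<in> carrier_mat n n"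
    "\<And>x. x \<in> topspace M \<Longrightarrow> mat_adjoint (A x) = A x"
  using assms by (auto simp: cont_self_adjoint_def cont_mat_def)

lemma continuous_map_eigenvalue:
  assumes A: "A \<in> cont_self_adjoint M n"
    and lam: "\<And>x. x \<in> topspace M \<Longrightarrow> ordered_eigenvalues (A x) (\<lambda>i. lam i x)" and k: "k < n"
  shows "continuous_map M euclideanreal (lam k)"
proof (rule continuous_map_dominated)
  note A' = cont_self_adjointD[OF A]
  fix p assume p: "p \<in> topspace M"
  show "\<exists>g. continuous_map M euclideanreal g \<and> g p = 0 \<and> (\<forall>x\<in>topspace M. norm (lam k x - lam k p) \<le> g x)"
  proof (intro exI conjI ballI)
    show "continuous_map M euclideanreal (\<lambda>x. fnorm (A x - A p))"
      by (rule continuous_map_fnorm_diff[OF A'(1) cont_mat_const[OF A'(2)[OF p]]])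
    show "fnorm (A p - A p) = 0" by (rule fnorm_diff_self)
    show "norm (lam k x - lam k p) \<le> fnorm (A x - A p)" if x: "x \<in> topspace M" for x
      using weyl_inequality[OF A'(2)[OF x] A'(3)[OF x] lam[OF x] A'(2)[OF p] A'(3)[OF p] lam[OF p] k] by simp
  qed
qed

section \<open>Approximate eigenvectors for the largest eigenvalue\<close>

lemma l2_norm_smult: "l2_norm (c \<cdot>\<^sub>v v) = cmod c * l2_norm v"
proof -
  have "(l2_norm (c \<cdot>\<^sub>v v))\<^sup>2 = (cmod c * l2_norm v)\<^sup>2"
    unfolding power_mult_distrib l2_norm_power2 by (simp add: norm_mult power_mult_distrib sum_distrib_left)
  then show ?thesis by (simp add: power2_eq_iff_nonneg)
qed

lemma l2_norm_add_le:
  assumes "x \<in> carrier_vec n" "y \<in> carrier_vec n"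
  shows "l2_norm (x + y) \<le> l2_norm x + l2_norm y"
proof -
  have "l2_norm (x + y) \<le> L2_set (\<lambda>i. cmod (x $ i) + cmod (y $ i)) {..<n}"
    unfolding l2_norm_eq_L2_set using assms by (auto intro!: L2_set_mono norm_triangle_ineq)
  also have "\<dots> \<le> l2_norm x + l2_norm y"
    unfolding l2_norm_eq_L2_set using assms L2_set_triangle_ineq[of "\<lambda>i. cmod (x $ i)" "\<lambda>i. cmod (y $ i)" "{..<n}"] by simp
  finally show ?thesis .
qed

lemma l2_norm_le_sum: "l2_norm v \<le> (\<Sum>i<dim_vec v. cmod (v $ i))"
  unfolding l2_norm_eq_L2_set by (rule L2_set_le_sum) simp

lemma cmod_index_le_l2_norm: "i < dim_vec v \<Longrightarrow> cmod (v $ i) \<le> l2_norm v"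
  unfolding l2_norm_eq_L2_set by (rule member_le_L2_set) auto

text \<open>The difference \<open>A - c\<close> is written entrywise with an explicit size, so that
  it is \<open>n\<close> by \<open>n\<close> whatever \<open>A\<close> is, in particular off the
  space, where values are arbitrary.\<close>

definition shifted :: "nat \<Rightarrow> complex mat \<Rightarrow> real \<Rightarrow> complex mat" where
  "shifted n A c = Matrix.mat n n (\<lambda>(i, j). A $$ (i, j) - (if i = j then of_real c else 0))"

lemma shifted_carrier [simp]: "shifted n A c \<in> carrier_mat n n"
  by (simp add: shifted_def)

lemma shifted_diagonalized:
  assumes P: "unitary_mat n P" and A: "A = P * mat_diag n (\<lambda>i. complex_of_real (l i)) * mat_adjoint P"
  shows "shifted n A c = P * mat_diag n (\<lambda>i. complex_of_real (l i - c)) * mat_adjoint P"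
proof (rule eq_matI)
  note u = unitary_matD[OF P]
  fix i j assume "i < dim_row (P * mat_diag n (\<lambda>i. complex_of_real (l i - c)) * mat_adjoint P)"
    "j < dim_col (P * mat_diag n (\<lambda>i. complex_of_real (l i - c)) * mat_adjoint P)"
  then have ij: "i < n" "j < n" using u by auto
  have e: "(P * mat_diag n f * mat_adjoint P) $$ (i, j) = (\<Sum>t<n. P $$ (i, t) * f t * mat_adjoint P $$ (t, j))" for f
  proof -
    have "(P * mat_diag n f * mat_adjoint P) $$ (i, j) = (\<Sum>t<n. (P * mat_diag n f) $$ (i, t) * mat_adjoint P $$ (t, j))"
      by (rule mult_mat_index[of _ n n _ n]) (use u ij in auto)
    then show ?thesis using ij unfolding mat_diag_mult_right[OF u(1)] by simp
  qed
  have one: "(\<Sum>t<n. P $$ (i, t) * mat_adjoint P $$ (t, j)) = (if i = j then 1 else 0)"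
    using mult_mat_index[OF u(1,2) ij] ij unfolding u(3) by simp
  have "(P * mat_diag n (\<lambda>i. complex_of_real (l i - c)) * mat_adjoint P) $$ (i, j)
    = A $$ (i, j) - of_real c * (\<Sum>t<n. P $$ (i, t) * mat_adjoint P $$ (t, j))"
    unfolding A e by (simp add: sum_distrib_left algebra_simps sum_subtractf)
  then show "shifted n A c $$ (i, j) = (P * mat_diag n (\<lambda>i. complex_of_real (l i - c)) * mat_adjoint P) $$ (i, j)"
    unfolding one using ij by (simp add: shifted_def)
qed (use unitary_matD[OF P] in \<open>auto simp: shifted_def\<close>)

lemma cont_mat_shifted:
  assumes A: "A \<in> cont_mat M n" and c: "continuous_map M euclideanreal c"
  shows "(\<lambda>x. shifted n (A x) (c x)) \<in> cont_mat M n"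
proof (rule cont_matI[where f = "\<lambda>i j x. A x $$ (i, j) - (if i = j then complex_of_real (c x) else 0)"])
  fix i j assume ij: "i < n" "j < n"
  have "continuous_map M euclidean (\<lambda>x. if i = j then complex_of_real (c x) else 0)"
    by (cases "i = j") (auto intro: cmap_intros c)
  then show "continuous_map M euclidean (\<lambda>x. A x $$ (i, j) - (if i = j then complex_of_real (c x) else 0))"
    by (intro cmap_intros cont_mat_index[OF A ij])
qed (auto simp: shifted_def)

text \<open>In the eigenbasis the cutoff kills every coordinate with
  \<open>l i \<le> - \<epsilon>\<close>. The survivors satisfy
  \<open>- \<epsilon> < l i \<le> 0\<close>, so the matrix multiplies each by at most
  \<open>\<epsilon>\<close> in modulus. No spectral gap is involved.\<close>

lemma spectral_cutoff_range:
  assumes P: "unitary_mat n P" and w: "w \<in> carrier_vec n" and "\<epsilon> > 0"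
    and l: "\<And>i. i < n \<Longrightarrow> l i \<le> 0"
  defines "T \<equiv> P * mat_diag n (\<lambda>i. complex_of_real (max 0 (l i + \<epsilon>))) * mat_adjoint P"
  shows "l2_norm ((P * mat_diag n (\<lambda>i. complex_of_real (l i)) * mat_adjoint P) *\<^sub>v (T *\<^sub>v w)) \<le> \<epsilon> * l2_norm (T *\<^sub>v w)"
proof -
  note u = unitary_matD[OF P]
  define z where "z = Matrix.vec n (\<lambda>i. complex_of_real (max 0 (l i + \<epsilon>)) * (mat_adjoint P *\<^sub>v w) $ i)"
  have z: "z \<in> carrier_vec n" by (simp add: z_def)
  have Tw: "T *\<^sub>v w = P *\<^sub>v z" unfolding T_def z_def by (rule diagonalized_mult_vec[OF P w])
  have Pz: "P *\<^sub>v z \<in> carrier_vec n" using u z by simp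
  let ?y = "Matrix.vec n (\<lambda>i. complex_of_real (l i) * z $ i)"
  have "l2_norm ((P * mat_diag n (\<lambda>i. complex_of_real (l i)) * mat_adjoint P) *\<^sub>v (P *\<^sub>v z)) = l2_norm ?y"
    unfolding diagonalized_mult_vec[OF P Pz] unitary_adjoint_cancel_vec[OF P z]
    by (rule l2_norm_unitary[OF P]) simp
  also have "\<dots> \<le> l2_norm (complex_of_real \<epsilon> \<cdot>\<^sub>v z)"
  proof -
    have "cmod (complex_of_real (l i) * z $ i) \<le> cmod (complex_of_real \<epsilon> * z $ i)" if i: "i < n" for i
    proof (cases "l i + \<epsilon> \<le> 0")
      case True
      then show ?thesis using i by (simp add: z_def)
    next
      case False
      then have "\<bar>l i\<bar> \<le> \<epsilon>" using l[OF i] by linarith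
      then show ?thesis using assms(3) by (simp add: norm_mult mult_right_mono)
    qed
    then show ?thesis unfolding l2_norm_eq_L2_set using z by (auto intro!: L2_set_mono)
  qed
  also have "\<dots> = \<epsilon> * l2_norm (P *\<^sub>v z)"
    using assms(3) l2_norm_unitary[OF P z] by (simp add: l2_norm_smult)
  finally show ?thesis unfolding Tw .
qed

text \<open>The eigenbases \<open>P x\<close> are chosen point by point and need not vary
  continuously. Nevertheless \<open>T\<close> is continuous, being a 1-Lipschitz function of
  \<open>L\<close>, and \<open>L\<close> is continuous because \<open>lam 0\<close> is, by Weyl's
  inequality. Normalising the field \<open>T w\<close> gives \<open>v\<close>.\<close>

lemma approximate_top_eigenvector:
  assumes M: "compact_space M" "Hausdorff_space M" "covering_dim_le M 2"
      "trivial_group (cech_cohomology M 2)"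
    and A: "A \<in> cont_self_adjoint M n"
    and lam: "\<And>x. x \<in> topspace M \<Longrightarrow> ordered_eigenvalues (A x) (\<lambda>i. lam i x)"
    and n: "n > 0" and \<epsilon>: "\<epsilon> > 0"
  obtains v where "\<And>i. i < n \<Longrightarrow> continuous_map M euclidean (\<lambda>x. v x $ i)"
    "\<And>x. x \<in> topspace M \<Longrightarrow> v x \<in> carrier_vec n \<and> l2_norm (v x) = 1 \<and>
      l2_norm (shifted n (A x) (lam 0 x) *\<^sub>v v x) \<le> \<epsilon>"
proof -
  note A' = cont_self_adjointD[OF A]
  have lam0: "continuous_map M euclideanreal (lam 0)" by (rule continuous_map_eigenvalue[OF A lam n])
  have ord: "lam j x \<le> lam i x" if "x \<in> topspace M" "i \<le> j" "j < n" for i j x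
    using lam[OF that(1)] A'(2)[OF that(1)] that by (auto simp: ordered_eigenvalues_def)
  have "\<exists>P. unitary_mat n P \<and> A x = P * mat_diag n (\<lambda>i. complex_of_real (lam i x)) * mat_adjoint P"
    if x: "x \<in> topspace M" for x
    by (rule spectral_theorem_hermitian[OF A'(2,3)[OF x]])
      (use lam[OF x] A'(2)[OF x] in \<open>auto simp: ordered_eigenvalues_def\<close>)
  then obtain P where P: "\<And>x. x \<in> topspace M \<Longrightarrow> unitary_mat n (P x)"
    "\<And>x. x \<in> topspace M \<Longrightarrow> A x = P x * mat_diag n (\<lambda>i. complex_of_real (lam i x)) * mat_adjoint (P x)"
    by metis
  define f where "f = (\<lambda>t::real. max 0 (t + \<epsilon>))"
  define L where "L = (\<lambda>x. shifted n (A x) (lam 0 x))"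
  define T where "T = (\<lambda>x. P x * mat_diag n (\<lambda>i. complex_of_real (f (lam i x - lam 0 x))) * mat_adjoint (P x))"
  have L: "L x = P x * mat_diag n (\<lambda>i. complex_of_real (lam i x - lam 0 x)) * mat_adjoint (P x)"
    if "x \<in> topspace M" for x unfolding L_def by (rule shifted_diagonalized[OF P(1,2)[OF that]])
  have Lc: "L \<in> cont_mat M n" unfolding L_def by (rule cont_mat_shifted[OF A'(1) lam0])
  have Tcar: "T x \<in> carrier_mat n n" if "x \<in> topspace M" for x
    using unitary_matD[OF P(1)[OF that]] by (simp add: T_def)
  have Tcont: "continuous_map M euclidean (\<lambda>x. T x $$ (i, j))" if ij: "i < n" "j < n" for i j
  proof (rule continuous_map_dominated)
    fix p assume p: "p \<in> topspace M"
    show "\<exists>g. continuous_map M euclideanreal g \<and> g p = 0 \<and>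
      (\<forall>x\<in>topspace M. norm (T x $$ (i, j) - T p $$ (i, j)) \<le> g x)"
    proof (intro exI conjI ballI)
      show "continuous_map M euclideanreal (\<lambda>x. fnorm (L x - L p))"
        by (rule continuous_map_fnorm_diff[OF Lc cont_mat_const[OF cont_mat_carrier[OF Lc p]]])
      show "fnorm (L p - L p) = 0" by (rule fnorm_diff_self)
      fix x assume x: "x \<in> topspace M"
      have "cmod ((T x - T p) $$ (i, j)) \<le> fnorm (T x - T p)"
        by (rule norm_index_le_fnorm[of _ n n]) (use minus_carrier_mat[OF Tcar[OF p]] ij in auto)
      also have "\<dots> \<le> fnorm (L x - L p)"
        unfolding T_def L[OF x] L[OF p]
        by (rule functional_calculus_lipschitz[OF P(1)[OF x] P(1)[OF p], of f]) (auto simp: f_def)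
      finally show "norm (T x $$ (i, j) - T p $$ (i, j)) \<le> fnorm (L x - L p)"
        using Tcar[OF x] Tcar[OF p] ij by simp
    qed
  qed
  \<comment> \<open>\<open>T\<close> has the Frobenius norm of its diagonal form, whose first entry
    is \<open>f 0 = \<epsilon>\<close>.\<close>
  have Tnz: "\<exists>i<n. \<exists>j<n. T x $$ (i, j) \<noteq> 0" if x: "x \<in> topspace M" for x
  proof (rule ccontr)
    assume neg: "\<not> ?thesis"
    then have "fnorm (T x) \<le> real (n * n) * 0"
      by (intro fnorm_bound Tcar x) auto
    moreover have "fnorm (T x) = fnorm (mat_diag n (\<lambda>i. complex_of_real (f (lam i x - lam 0 x))))"
      unfolding T_def using fnorm_unitary_left[OF P(1)[OF x] mat_diag_dim] unitary_matD[OF P(1)[OF x]]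
      by (subst fnorm_unitary_right[OF unitary_mat_adjoint[OF P(1)[OF x]], of _ n]) simp_all
    moreover have "cmod (mat_diag n (\<lambda>i. complex_of_real (f (lam i x - lam 0 x))) $$ (0, 0)) \<le> fnorm (mat_diag n (\<lambda>i. complex_of_real (f (lam i x - lam 0 x))))"
      by (rule norm_index_le_fnorm) (use n in auto)
    ultimately show False using n \<epsilon> by (simp add: f_def)
  qed
  obtain w where w: "\<And>j. j < n \<Longrightarrow> continuous_map M euclidean (w j)"
    "\<And>x. x \<in> topspace M \<Longrightarrow> \<exists>i<n. (\<Sum>j<n. T x $$ (i, j) * w j x) \<noteq> 0"
    by (rule exists_nonvanishing_image[OF M, of n "\<lambda>x i j. T x $$ (i, j)"]) (use Tcont Tnz in auto)
  define W where "W = (\<lambda>x. Matrix.vec n (\<lambda>j. w j x))"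
  define y where "y = (\<lambda>x. T x *\<^sub>v W x)"
  have y: "y x \<in> carrier_vec n" if "x \<in> topspace M" for x using Tcar[OF that] by (simp add: y_def W_def)
  have yi: "y x $ i = (\<Sum>j<n. T x $$ (i, j) * w j x)" if "x \<in> topspace M" "i < n" for x i
    unfolding y_def using mult_mat_vec_index[OF Tcar[OF that(1)], of "W x" i] that(2) by (simp add: W_def del: index_mult_mat_vec)
  have ycont: "continuous_map M euclidean (\<lambda>x. y x $ i)" if "i < n" for i
  proof (rule continuous_map_eq)
    show "continuous_map M euclidean (\<lambda>x. \<Sum>j<n. T x $$ (i, j) * w j x)"
      by (intro cmap_intros Tcont w(1)) (use that in auto)
  qed (use yi that in simp)
  have ypos: "l2_norm (y x) > 0" if x: "x \<in> topspace M" for x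
  proof -
    obtain i where i: "i < n" "y x $ i \<noteq> 0" using w(2)[OF x] yi[OF x] by auto
    then show ?thesis using cmod_index_le_l2_norm[of i "y x"] y[OF x] by (auto intro: less_le_trans[of _ "cmod (y x $ i)"])
  qed
  have lcont: "continuous_map M euclideanreal (\<lambda>x. l2_norm (y x))"
  proof (rule continuous_map_eq)
    have "continuous_map M euclideanreal (\<lambda>x. \<Sum>i<n. (cmod (y x $ i))\<^sup>2)"
      by (intro cmap_intros ycont) auto
    then show "continuous_map M euclideanreal (\<lambda>x. sqrt (\<Sum>i<n. (cmod (y x $ i))\<^sup>2))"
      by (rule continuous_map_euclidean_compose) (intro continuous_intros)
  qed (simp add: l2_norm_def carrier_vecD[OF y])
  define v where "v = (\<lambda>x. complex_of_real (1 / l2_norm (y x)) \<cdot>\<^sub>v y x)"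
  show ?thesis
  proof (rule that[of v])
    fix i assume i: "i < n"
    show "continuous_map M euclidean (\<lambda>x. v x $ i)"
    proof (rule continuous_map_eq)
      show "continuous_map M euclidean (\<lambda>x. y x $ i / complex_of_real (l2_norm (y x)))"
        by (intro cmap_intros ycont i lcont) (use ypos in fastforce)
    qed (use i in \<open>simp add: v_def carrier_vecD[OF y]\<close>)
  next
    fix x assume x: "x \<in> topspace M"
    have "l2_norm (L x *\<^sub>v y x) \<le> \<epsilon> * l2_norm (y x)"
      unfolding L[OF x] y_def T_def f_def
      by (rule spectral_cutoff_range[OF P(1)[OF x]]) (use ord[OF x] \<epsilon> in \<open>auto simp: W_def\<close>)
    moreover have "L x *\<^sub>v v x = complex_of_real (1 / l2_norm (y x)) \<cdot>\<^sub>v (L x *\<^sub>v y x)"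
      unfolding v_def by (rule mult_mat_vec[OF cont_mat_carrier[OF Lc x] y[OF x]])
    ultimately have "l2_norm (L x *\<^sub>v v x) \<le> \<epsilon>"
      using ypos[OF x] by (simp add: l2_norm_smult norm_divide field_simps)
    then show "v x \<in> carrier_vec n \<and> l2_norm (v x) = 1 \<and> l2_norm (shifted n (A x) (lam 0 x) *\<^sub>v v x) \<le> \<epsilon>"
      using y[OF x] ypos[OF x] by (simp add: v_def l2_norm_smult norm_divide L_def)
  qed
qed


text \<open>Only the first two entries are moved, as a map into C^2; hence the bound on
  \<open>n\<close>. A unit vector with first entry 1 has second entry 0, so before normalisation,
  which divides by a real number, the pair would lie on the real line through
  \<open>(1, 0)\<close>.\<close>

lemma approximate_top_eigenvector_avoiding_e0:
  assumes M: "compact_space M" "Hausdorff_space M" "covering_dim_le M 2"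
      "trivial_group (cech_cohomology M 2)"
    and A: "A \<in> cont_self_adjoint M n"
    and lam: "\<And>x. x \<in> topspace M \<Longrightarrow> ordered_eigenvalues (A x) (\<lambda>i. lam i x)"
    and n: "n \<ge> 2" and \<epsilon>: "\<epsilon> > 0"
  obtains v where "\<And>i. i < n \<Longrightarrow> continuous_map M euclidean (\<lambda>x. v x $ i)"
    "\<And>x. x \<in> topspace M \<Longrightarrow> v x \<in> carrier_vec n \<and> l2_norm (v x) = 1 \<and> v x $ 0 \<noteq> 1 \<and>
      l2_norm (shifted n (A x) (lam 0 x) *\<^sub>v v x) \<le> \<epsilon>"
proof -
  note A' = cont_self_adjointD[OF A]
  have npos: "n > 0" "0 < n" "1 < n" using n by auto
  define L where "L = (\<lambda>x. shifted n (A x) (lam 0 x))"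
  have Lcar: "L x \<in> carrier_mat n n" for x by (simp add: L_def)
  have Lc: "L \<in> cont_mat M n" unfolding L_def
    by (rule cont_mat_shifted[OF A'(1) continuous_map_eigenvalue[OF A lam npos(1)]])
  have "continuous_map M euclideanreal (\<lambda>x. fnorm (L x - 0\<^sub>m n n))"
    by (rule continuous_map_fnorm_diff[OF Lc cont_mat_const]) simp
  moreover have "L x - 0\<^sub>m n n = L x" for x by (rule eq_matI) (auto simp: L_def shifted_def)
  ultimately have "continuous_map M euclideanreal (\<lambda>x. fnorm (L x))" by simp
  then obtain B where B: "B > 0" "\<And>x. x \<in> topspace M \<Longrightarrow> fnorm (L x) \<le> B"
    by (rule continuous_map_bounded_above[OF M(1)]) blast
  have \<epsilon>4: "\<epsilon> / 4 > 0" using \<epsilon> by simp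
  obtain v where v: "\<And>i. i < n \<Longrightarrow> continuous_map M euclidean (\<lambda>x. v x $ i)"
    and v': "\<And>x. x \<in> topspace M \<Longrightarrow> v x \<in> carrier_vec n \<and> l2_norm (v x) = 1 \<and>
      l2_norm (shifted n (A x) (lam 0 x) *\<^sub>v v x) \<le> \<epsilon> / 4"
    by (rule approximate_top_eigenvector[OF M A lam npos(1) \<epsilon>4]) (assumption | rule that | blast)+
  \<comment> \<open>The bound 1/4 keeps the norm of \<open>u\<close> at least 1/2. The other bound
    gives \<open>\<epsilon> / 4 + B * (2 * \<delta>) \<le> \<epsilon> / 2\<close> before
    normalisation, which at most doubles this.\<close>
  define \<delta> where "\<delta> = min (1/4) (\<epsilon> / (8 * B))"
  have \<delta>: "\<delta> > 0" "\<delta> \<le> 1/4" "B * \<delta> \<le> \<epsilon> / 8" using \<epsilon> B(1)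
    by (auto simp: \<delta>_def min_def field_simps)
  define h where "h = (\<lambda>x. (v x $ 0, v x $ 1))"
  have hc: "continuous_map M euclidean h" unfolding h_def by (intro cmap_intros v npos)
  obtain h' where h': "continuous_map M euclidean h'" "\<And>x. x \<in> topspace M \<Longrightarrow> norm (h' x - h x) < \<delta>"
    "\<And>x. x \<in> topspace M \<Longrightarrow> h' x \<notin> span {(1, 0)}"
    by (rule approximate_avoiding_line[OF M(1-3) hc \<delta>(1), of "(1, 0)"]) (auto simp: zero_prod_def)
  define u where "u = (\<lambda>x. Matrix.vec n (\<lambda>i. if i = 0 then fst (h' x) else if i = 1 then snd (h' x) else v x $ i))"
  have u: "u x \<in> carrier_vec n" for x by (simp add: u_def)
  have ucont: "continuous_map M euclidean (\<lambda>x. u x $ i)" if "i < n" for i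
  proof -
    have "continuous_map M euclidean (\<lambda>x. fst (h' x))" "continuous_map M euclidean (\<lambda>x. snd (h' x))"
      by (rule continuous_map_euclidean_compose[OF h'(1)]; intro continuous_intros)+
    then show ?thesis using that v[OF that] by (simp add: u_def)
  qed
  have udiff: "l2_norm (u x - v x) \<le> 2 * \<delta>" if x: "x \<in> topspace M" for x
  proof -
    have vc: "v x \<in> carrier_vec n" using v'[OF x] by simp
    have "l2_norm (u x - v x) \<le> (\<Sum>i<n. cmod ((u x - v x) $ i))"
      using l2_norm_le_sum[of "u x - v x"] vc by simp
    also have "\<dots> = (\<Sum>i\<in>{0, 1}. cmod ((u x - v x) $ i))"
      by (rule sum.mono_neutral_right) (use npos vc in \<open>auto simp: u_def\<close>)
    also have "\<dots> = cmod (fst (h' x - h x)) + cmod (snd (h' x - h x))"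
      using npos vc by (simp add: u_def h_def)
    also have "\<dots> \<le> \<delta> + \<delta>"
      using h'(2)[OF x] norm_fst_le[of "fst (h' x - h x)" "snd (h' x - h x)"]
        norm_snd_le[of "snd (h' x - h x)" "fst (h' x - h x)"]
      by (intro add_mono) (auto simp del: fst_diff snd_diff)
    finally show ?thesis by simp
  qed
  have unorm: "l2_norm (u x) \<ge> 1/2" if x: "x \<in> topspace M" for x
  proof -
    have vc: "v x \<in> carrier_vec n" "l2_norm (v x) = 1" using v'[OF x] by auto
    have "v x = u x + (- 1) \<cdot>\<^sub>v (u x - v x)" by (rule eq_vecI) (use vc u[of x] in auto)
    then have "l2_norm (v x) \<le> l2_norm (u x) + l2_norm ((- 1) \<cdot>\<^sub>v (u x - v x))"
      using l2_norm_add_le[of "u x" n "(- 1) \<cdot>\<^sub>v (u x - v x)"] u vc by simp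
    then show ?thesis using vc(2) udiff[OF x] \<delta>(2) by (simp add: l2_norm_smult)
  qed
  have Lu: "l2_norm (L x *\<^sub>v u x) \<le> \<epsilon> / 2" if x: "x \<in> topspace M" for x
  proof -
    have vc: "v x \<in> carrier_vec n" "l2_norm (L x *\<^sub>v v x) \<le> \<epsilon> / 4" using v'[OF x] by (auto simp: L_def)
    have dc: "u x - v x \<in> carrier_vec n" using vc u by simp
    have "u x = v x + (u x - v x)" by (rule eq_vecI) (use vc u[of x] in auto)
    then have "L x *\<^sub>v u x = L x *\<^sub>v v x + L x *\<^sub>v (u x - v x)"
      using mult_add_distrib_mat_vec[OF Lcar vc(1) dc, of x] by simp
    then have "l2_norm (L x *\<^sub>v u x) \<le> l2_norm (L x *\<^sub>v v x) + l2_norm (L x *\<^sub>v (u x - v x))"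
      using l2_norm_add_le[of "L x *\<^sub>v v x" n "L x *\<^sub>v (u x - v x)"] Lcar vc dc by simp
    also have "\<dots> \<le> \<epsilon> / 4 + fnorm (L x) * l2_norm (u x - v x)"
      by (intro add_mono vc l2_norm_mult_mat_vec[OF Lcar dc])
    also have "\<dots> \<le> \<epsilon> / 4 + B * (2 * \<delta>)"
      using B x udiff[OF x] by (intro add_left_mono mult_mono) auto
    also have "\<dots> \<le> \<epsilon> / 2" using \<delta>(3) by simp
    finally show ?thesis .
  qed
  define w where "w = (\<lambda>x. complex_of_real (1 / l2_norm (u x)) \<cdot>\<^sub>v u x)"
  have lcont: "continuous_map M euclideanreal (\<lambda>x. l2_norm (u x))"
  proof (rule continuous_map_eq)
    have "continuous_map M euclideanreal (\<lambda>x. \<Sum>i<n. (cmod (u x $ i))\<^sup>2)"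
      by (intro cmap_intros ucont) auto
    then show "continuous_map M euclideanreal (\<lambda>x. sqrt (\<Sum>i<n. (cmod (u x $ i))\<^sup>2))"
      by (rule continuous_map_euclidean_compose) (intro continuous_intros)
  qed (simp add: l2_norm_def carrier_vecD[OF u])
  show ?thesis
  proof (rule that[of w])
    fix i assume i: "i < n"
    show "continuous_map M euclidean (\<lambda>x. w x $ i)"
    proof (rule continuous_map_eq)
      show "continuous_map M euclidean (\<lambda>x. u x $ i / complex_of_real (l2_norm (u x)))"
        by (intro cmap_intros ucont i lcont) (use unorm in fastforce)
    qed (use i in \<open>simp add: w_def carrier_vecD[OF u]\<close>)
  next
    fix x assume x: "x \<in> topspace M"
    have wc: "w x \<in> carrier_vec n" using u by (simp add: w_def)
    have w1: "l2_norm (w x) = 1" using unorm[OF x] by (auto simp: w_def l2_norm_smult norm_divide)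
    have "w x $ 0 \<noteq> 1"
    proof
      assume w0: "w x $ 0 = 1"
      then have u0: "fst (h' x) = complex_of_real (l2_norm (u x))"
        using unorm[OF x] npos by (auto simp: w_def u_def field_simps)
      have "(cmod (w x $ 0))\<^sup>2 + (cmod (w x $ 1))\<^sup>2 = (\<Sum>i\<in>{0, 1}. (cmod (w x $ i))\<^sup>2)" by simp
      also have "\<dots> \<le> (\<Sum>i<n. (cmod (w x $ i))\<^sup>2)" by (rule sum_mono2) (use npos in auto)
      also have "\<dots> = 1" using l2_norm_power2[of "w x"] w1 wc by simp
      finally have "w x $ 1 = 0" using w0 by simp
      then have "snd (h' x) = 0" using unorm[OF x] npos by (auto simp: w_def u_def)
      then have "h' x = l2_norm (u x) *\<^sub>R (1, 0)" using u0 by (simp add: prod_eq_iff scaleR_conv_of_real)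
      moreover have "l2_norm (u x) *\<^sub>R (1, 0) \<in> span {(1, 0) :: complex \<times> complex}"
        by (intro span_scale span_base) simp
      ultimately have "h' x \<in> span {(1, 0)}" by (simp only:)
      then show False using h'(3)[OF x] by blast
    qed
    moreover have "L x *\<^sub>v w x = complex_of_real (1 / l2_norm (u x)) \<cdot>\<^sub>v (L x *\<^sub>v u x)"
      unfolding w_def by (rule mult_mat_vec[OF Lcar u])
    then have "l2_norm (L x *\<^sub>v w x) = l2_norm (L x *\<^sub>v u x) / l2_norm (u x)"
      using unorm[OF x] by (simp add: l2_norm_smult norm_divide)
    then have "l2_norm (L x *\<^sub>v w x) \<le> (\<epsilon> / 2) / (1 / 2)"
      using Lu[OF x] unorm[OF x] \<epsilon> by (simp only:) (intro frac_le, auto)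
    ultimately show "w x \<in> carrier_vec n \<and> l2_norm (w x) = 1 \<and> w x $ 0 \<noteq> 1 \<and>
      l2_norm (shifted n (A x) (lam 0 x) *\<^sub>v w x) \<le> \<epsilon>"
      using wc w1 by (simp add: L_def)
  qed
qed

section \<open>Splitting off the largest eigenvalue\<close>

lemma char_poly_diag:
  "char_poly (mat_diag n f) = (\<Prod>i<n. [:- f i, 1:])" for f :: "nat \<Rightarrow> complex"
proof (induction n arbitrary: f)
  case 0
  show ?case using char_poly_upper_triangular[of "mat_diag 0 f" 0] by (simp add: diag_mat_def upper_triangular_def)
next
  case (Suc n)
  have "char_poly (mat_diag (Suc n) f) = [:- f 0, 1:] * (\<Prod>i<n. [:- f (Suc i), 1:])"
    unfolding diag_sum_diag[symmetric] char_poly_diag_sum[OF mat_diag_dim] Suc.IH ..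
  then show ?case by (simp only: prod.lessThan_Suc_shift)
qed

text \<open>Top case of Cauchy interlacing: an eigenvector of the compression, padded with a zero,
  has Rayleigh quotient \<open>m 0\<close> for \<open>B\<close>. It ensures that \<open>l 0\<close>
  followed by the eigenvalues of the compression is a non-increasing list, as the comparison by
  Weyl's inequality demands.\<close>

lemma top_eigenvalue_minor_le:
  assumes B: "B \<in> carrier_mat (Suc n) (Suc n)" "mat_adjoint B = B" "ordered_eigenvalues B l"
    and C: "mat_adjoint (minor_00 B) = minor_00 B" "ordered_eigenvalues (minor_00 B) m" and n: "n > 0"
  shows "m 0 \<le> l 0"
proof -
  let ?C = "minor_00 B"
  have Cc: "?C \<in> carrier_mat n n" by (rule minor_00_carrier[OF B(1)])
  obtain P where P: "unitary_mat n P" "?C = P * mat_diag n (\<lambda>i. complex_of_real (m i)) * mat_adjoint P"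
    using spectral_theorem_hermitian[OF Cc C(1), of m] C(2) Cc by (auto simp: ordered_eigenvalues_def)
  obtain Q where Q: "unitary_mat (Suc n) Q" "B = Q * mat_diag (Suc n) (\<lambda>i. complex_of_real (l i)) * mat_adjoint Q"
    using spectral_theorem_hermitian[OF B(1,2), of l] B by (auto simp: ordered_eigenvalues_def)
  have l: "l i \<le> l 0" if "i < Suc n" for i using B that by (auto simp: ordered_eigenvalues_def)
  define z where "z = P *\<^sub>v unit_vec n 0"
  define y where "y = Matrix.vec (Suc n) (\<lambda>i. if i = 0 then 0 else z $ (i - 1))"
  have zc: "z \<in> carrier_vec n" using unitary_matD[OF P(1)] by (simp add: z_def)
  have yc: "y \<in> carrier_vec (Suc n)" by (simp add: y_def)
  have Pz: "mat_adjoint P *\<^sub>v z = unit_vec n 0" unfolding z_def by (rule unitary_adjoint_cancel_vec[OF P(1)]) simp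
  have "l2_norm z = l2_norm (unit_vec n 0)" unfolding z_def by (rule l2_norm_unitary[OF P(1)]) simp
  also have "(l2_norm (unit_vec n 0))\<^sup>2 = (\<Sum>i<n. if i = 0 then 1 else 0)"
    unfolding l2_norm_power2 by (intro sum.cong) (auto simp: unit_vec_def)
  finally have z1: "(l2_norm z)\<^sup>2 = 1" using n by simp
  have y1: "(l2_norm y)\<^sup>2 = 1"
    using z1 zc unfolding l2_norm_power2 by (simp add: y_def sum.lessThan_Suc_shift del: sum.lessThan_Suc)
  have "cinner (B *\<^sub>v y) y = (\<Sum>i<Suc n. (\<Sum>t<Suc n. B $$ (i, t) * y $ t) * cnj (y $ i))"
    unfolding cinner_def using yc by (intro sum.cong) (auto simp: mult_mat_vec_index[OF B(1) yc] simp del: index_mult_mat_vec sum.lessThan_Suc)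
  also have "\<dots> = (\<Sum>i<n. (\<Sum>t<n. ?C $$ (i, t) * z $ t) * cnj (z $ i))"
    by (simp add: y_def sum.lessThan_Suc_shift minor_00_index[OF B(1)] del: sum.lessThan_Suc)
  also have "\<dots> = cinner (?C *\<^sub>v z) z"
    unfolding cinner_def using zc by (intro sum.cong) (auto simp: mult_mat_vec_index[OF Cc zc] simp del: index_mult_mat_vec)
  also have "\<dots> = of_real (\<Sum>i<n. m i * (cmod (unit_vec n 0 $ i))\<^sup>2)"
    unfolding P(2) cinner_diagonalized[OF P(1) zc] Pz ..
  also have "(\<Sum>i<n. m i * (cmod (unit_vec n 0 $ i))\<^sup>2) = (\<Sum>i<n. if i = 0 then m 0 else 0)"
    by (intro sum.cong) (auto simp: unit_vec_def)
  finally have "cinner (B *\<^sub>v y) y = of_real (m 0)" using n by simp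
  then have "of_real (m 0) = complex_of_real (\<Sum>i<Suc n. l i * (cmod ((mat_adjoint Q *\<^sub>v y) $ i))\<^sup>2)"
    unfolding Q(2) cinner_diagonalized[OF Q(1) yc] by simp
  then have "m 0 = (\<Sum>i<Suc n. l i * (cmod ((mat_adjoint Q *\<^sub>v y) $ i))\<^sup>2)" unfolding of_real_eq_iff .
  also have "\<dots> \<le> (\<Sum>i<Suc n. l 0 * (cmod ((mat_adjoint Q *\<^sub>v y) $ i))\<^sup>2)"
    by (intro sum_mono mult_right_mono l) auto
  also have "\<dots> = l 0 * (l2_norm (mat_adjoint Q *\<^sub>v y))\<^sup>2"
    using unitary_matD[OF Q(1)] by (simp add: l2_norm_power2 sum_distrib_left del: index_mult_mat_vec sum.lessThan_Suc)
  also have "\<dots> = l 0" using l2_norm_unitary[OF unitary_mat_adjoint[OF Q(1)] yc] y1 by simp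
  finally show ?thesis .
qed

lemma fnorm_diag_sum_diff:
  assumes "A \<in> carrier_mat n n" "B \<in> carrier_mat n n"
  shows "fnorm (diag_sum c A - diag_sum c B) = fnorm (A - B)"
proof -
  have "(fnorm (diag_sum c A - diag_sum c B))\<^sup>2 = (fnorm (A - B))\<^sup>2"
    unfolding fnorm_power2 using assms by (simp add: sum.lessThan_Suc_shift diag_sum_index del: sum.lessThan_Suc)
  then show ?thesis by (simp add: power2_eq_iff_nonneg)
qed

text \<open>The first column of \<open>R\<^sup>* A R\<close> is \<open>c e\<^sub>0 + R\<^sup>* r\<close> with \<open>r = (A - c) v\<close>; the first row is its adjoint.\<close>

lemma fnorm_deflation:
  assumes A: "A \<in> carrier_mat (Suc n) (Suc n)" "mat_adjoint A = A" and R: "unitary_mat (Suc n) R"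
    and small: "l2_norm (shifted (Suc n) A c *\<^sub>v col R 0) \<le> \<epsilon>"
  defines "B \<equiv> mat_adjoint R * A * R"
  shows "fnorm (B - diag_sum (of_real c) (minor_00 B)) \<le> real (Suc n * Suc n) * \<epsilon>"
proof -
  let ?N = "Suc n"
  note u = unitary_matD[OF R]
  have Bc: "B \<in> carrier_mat ?N ?N" using u A by (simp add: B_def)
  have herm: "mat_adjoint B = B" unfolding B_def by (rule hermitian_conj[OF A u(1)])
  have Dc: "diag_sum (of_real c) (minor_00 B) \<in> carrier_mat ?N ?N"
    by (rule diag_sum_carrier[OF minor_00_carrier[OF Bc]])
  have \<epsilon>: "\<epsilon> \<ge> 0" using small l2_norm_nonneg order_trans by blast
  define v where "v = col R 0"
  have v: "v \<in> carrier_vec ?N" unfolding v_def by (rule carrier_vecI) (use u in auto)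
  define r where "r = shifted ?N A c *\<^sub>v v"
  have r: "r \<in> carrier_vec ?N" using v by (simp add: r_def)
  have Av: "A *\<^sub>v v = r + of_real c \<cdot>\<^sub>v v"
  proof (rule eq_vecI)
    fix i assume "i < dim_vec (r + complex_of_real c \<cdot>\<^sub>v v)"
    then have i: "i < ?N" using v by simp
    have "r $ i = (\<Sum>t<?N. shifted ?N A c $$ (i, t) * v $ t)"
      unfolding r_def by (rule mult_mat_vec_index[OF shifted_carrier v i])
    also have "\<dots> = (\<Sum>t<?N. A $$ (i, t) * v $ t - (if i = t then of_real c * v $ i else 0))"
      by (rule sum.cong) (use i in \<open>auto simp: shifted_def algebra_simps\<close>)
    also have "\<dots> = (A *\<^sub>v v) $ i - of_real c * v $ i"
      using i mult_mat_vec_index[OF A(1) v i] by (simp add: sum_subtractf del: sum.lessThan_Suc index_mult_mat_vec)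
    finally show "(A *\<^sub>v v) $ i = (r + of_real c \<cdot>\<^sub>v v) $ i" using i v r by (simp del: index_mult_mat_vec)
  qed (use A v r in auto)
  have "col B 0 = mat_adjoint R *\<^sub>v (A *\<^sub>v v)"
    using u A v unfolding B_def v_def by (simp add: col_mult2[of _ ?N ?N _ ?N] assoc_mult_mat_vec[of _ ?N ?N _ ?N])
  also have "\<dots> = mat_adjoint R *\<^sub>v r + of_real c \<cdot>\<^sub>v (mat_adjoint R *\<^sub>v v)"
    unfolding Av using u v r by (simp add: mult_add_distrib_mat_vec[of _ ?N ?N] mult_mat_vec[of _ ?N ?N])
  also have "mat_adjoint R *\<^sub>v v = unit_vec ?N 0"
    unfolding v_def using col_mult2[OF u(2,1), of 0] u(4) by simp
  finally have col0: "col B 0 = mat_adjoint R *\<^sub>v r + of_real c \<cdot>\<^sub>v unit_vec ?N 0" .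
  have rsmall: "l2_norm (mat_adjoint R *\<^sub>v r) \<le> \<epsilon>"
    using l2_norm_unitary[OF unitary_mat_adjoint[OF R] r] small by (simp add: r_def v_def)
  have c0: "cmod (B $$ (i, 0) - (if i = 0 then of_real c else 0)) \<le> \<epsilon>" if i: "i < ?N" for i
  proof -
    have "B $$ (i, 0) - (if i = 0 then of_real c else 0) = (mat_adjoint R *\<^sub>v r) $ i"
      using arg_cong[OF col0, of "\<lambda>x. x $ i"] i Bc u(2) by (simp add: unit_vec_def del: index_mult_mat_vec)
    then show ?thesis
      using cmod_index_le_l2_norm[of i "mat_adjoint R *\<^sub>v r"] rsmall i u by (simp del: index_mult_mat_vec)
  qed
  have r0: "cmod (B $$ (0, i) - (if i = 0 then of_real c else 0)) \<le> \<epsilon>" if i: "i < ?N" for i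
  proof -
    have "B $$ (0, i) = cnj (B $$ (i, 0))"
      using arg_cong[OF herm, of "\<lambda>x. x $$ (0, i)"] i Bc by simp
    then have "B $$ (0, i) - (if i = 0 then of_real c else 0) = cnj (B $$ (i, 0) - (if i = 0 then of_real c else 0))"
      by simp
    then show ?thesis using c0[OF i] by (metis complex_mod_cnj)
  qed
  show ?thesis
  proof (rule fnorm_bound)
    show "B - diag_sum (of_real c) (minor_00 B) \<in> carrier_mat ?N ?N" by (rule minus_carrier_mat[OF Dc])
    fix i j assume ij: "i < ?N" "j < ?N"
    have "(B - diag_sum (of_real c) (minor_00 B)) $$ (i, j) = B $$ (i, j) - diag_sum (of_real c) (minor_00 B) $$ (i, j)"
      using ij by (simp add: carrier_matD[OF Bc] carrier_matD[OF minor_00_carrier[OF Bc]])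
    also have "diag_sum (of_real c) (minor_00 B) $$ (i, j) = (if i = 0 then if j = 0 then of_real c else 0 else if j = 0 then 0 else B $$ (i, j))"
      using ij Bc minor_00_carrier[OF Bc] minor_00_index[OF Bc, of "i - 1" "j - 1"] by (subst diag_sum_index) auto
    finally show "cmod ((B - diag_sum (of_real c) (minor_00 B)) $$ (i, j)) \<le> \<epsilon>"
      using c0[OF ij(1)] r0[OF ij(2)] \<epsilon> by (cases "i = 0"; cases "j = 0") auto
  qed
qed


text \<open>The induction hypothesis diagonalises the compression with its own eigenvalues, which
  are not those of \<open>A x\<close>. The diagonal obtained is close to a unitary conjugate of
  \<open>A x\<close> and is itself ordered, so by Weyl's inequality it can be exchanged for the true
  eigenvalues at the cost of a factor that depends on the size only.\<close>

lemma approximate_diagonalization: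
  assumes M: "compact_space M" "Hausdorff_space M" "covering_dim_le M 2"
      "trivial_group (cech_cohomology M 2)"
    and "A \<in> cont_self_adjoint M n"
    and "\<And>x. x \<in> topspace M \<Longrightarrow> ordered_eigenvalues (A x) (\<lambda>i. lam i x)"
    and "\<epsilon> > 0"
  shows "\<exists>U\<in>cont_unitary M n. \<forall>x\<in>topspace M.
    fnorm (mat_adjoint (U x) * A x * U x - mat_diag n (\<lambda>i. complex_of_real (lam i x))) < \<epsilon>"
  using assms(5-7)
proof (induction n arbitrary: A lam \<epsilon>)
  case (0 A lam \<epsilon>)
  show ?case
  proof (intro bexI ballI)
    show "(\<lambda>x. 1\<^sub>m 0) \<in> cont_unitary M 0"
      unfolding cont_unitary_iff by (auto intro!: cont_mat_const unitary_matI)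
    fix x assume "x \<in> topspace M"
    show "fnorm (mat_adjoint (1\<^sub>m 0) * A x * 1\<^sub>m 0 - mat_diag 0 (\<lambda>i. complex_of_real (lam i x))) < \<epsilon>"
      using 0 by (simp add: fnorm_def)
  qed
next
  case (Suc n A lam \<epsilon>)
  let ?N = "Suc n"
  note A = cont_self_adjointD[OF Suc.prems(1)] and lam = Suc.prems(2) and \<epsilon> = Suc.prems(3)
  show ?case
  \<comment> \<open>Size 1 is separate because a unit vector field avoiding the first basis vector
    is available from size 2 on; a 1 by 1 matrix is already diagonal.\<close>
  proof (cases "n = 0")
    case True
    have one: "unitary_mat ?N (1\<^sub>m ?N)"
      by (rule unitary_matI) (auto intro!: eq_matI)
    show ?thesis
    proof (intro bexI ballI)
      show "(\<lambda>x. 1\<^sub>m ?N) \<in> cont_unitary M ?N"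
        unfolding cont_unitary_iff using one by (auto intro!: cont_mat_const)
      fix x assume x: "x \<in> topspace M"
      have "char_poly (A x) = [:- (A x $$ (0, 0)), 1:]"
        using A(2)[OF x] True by (subst char_poly_upper_triangular[of _ 1]) (auto simp: diag_mat_def upper_triangular_def)
      moreover have "char_poly (A x) = [:- complex_of_real (lam 0 x), 1:]"
        using lam[OF x] A(2)[OF x] True by (auto simp: ordered_eigenvalues_def)
      ultimately have "A x $$ (0, 0) = complex_of_real (lam 0 x)" by simp
      then have "A x = mat_diag ?N (\<lambda>i. complex_of_real (lam i x))"
        using A(2)[OF x] True by (intro eq_matI) auto
      moreover have "mat_adjoint (1\<^sub>m ?N) * A x * 1\<^sub>m ?N = A x"
      proof -
        have "mat_adjoint (1\<^sub>m ?N :: complex mat) = 1\<^sub>m ?N" by (rule eq_matI) auto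
        then show ?thesis using A(2)[OF x] by simp
      qed
      ultimately show "fnorm (mat_adjoint (1\<^sub>m ?N) * A x * 1\<^sub>m ?N - mat_diag ?N (\<lambda>i. complex_of_real (lam i x))) < \<epsilon>"
        using fnorm_diff_self \<epsilon> by simp
    qed
  next
    case False
    define K where "K = real (?N * ?N)"
    have K: "K > 0" unfolding K_def of_nat_0_less_iff by simp
    \<comment> \<open>\<open>K\<close> is the entrywise constant of \<open>fnorm_bound\<close>.
      Deflation costs \<open>\<eta> / 2\<close>, the eigenvector being taken to accuracy
      \<open>\<eta> / (2 * K)\<close>; the induction hypothesis costs \<open>\<eta> / 2\<close> and
      the exchange of the diagonal \<open>K * \<eta>\<close>. The total is
      \<open>\<epsilon> / 2\<close>, which leaves the inequality strict.\<close>
    define \<eta> where "\<eta> = \<epsilon> / (2 * (1 + K))"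
    have "\<eta> * (2 * (1 + K)) = \<epsilon>" unfolding \<eta>_def using K by simp
    then have \<eta>2: "2 * (\<eta> + K * \<eta>) = \<epsilon>" by (simp add: algebra_simps)
    have \<eta>: "\<eta> > 0" using \<epsilon> K by (simp add: \<eta>_def)
    have e1: "\<eta> / (2 * K) > 0" and e2: "\<eta> / 2 > 0" using \<eta> K by auto
    have N2: "?N \<ge> 2" using False by simp
    obtain v where v: "\<And>i. i < ?N \<Longrightarrow> continuous_map M euclidean (\<lambda>x. v x $ i)"
      and v': "\<And>x. x \<in> topspace M \<Longrightarrow> v x \<in> carrier_vec ?N \<and> l2_norm (v x) = 1 \<and> v x $ 0 \<noteq> 1 \<and>
        l2_norm (shifted ?N (A x) (lam 0 x) *\<^sub>v v x) \<le> \<eta> / (2 * K)"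
      by (rule approximate_top_eigenvector_avoiding_e0[OF M Suc.prems(1) lam N2 e1]) (assumption | rule that | blast)+
    define R where "R = (\<lambda>x. householder ?N (v x))"
    have Ru: "unitary_mat ?N (R x)" if "x \<in> topspace M" for x
      unfolding R_def by (rule unitary_householder) (use v'[OF that] in auto)
    have Rcol: "col (R x) 0 = v x" if "x \<in> topspace M" for x
      by (rule eq_vecI) (use v'[OF that] in \<open>auto simp: R_def householder_col_0\<close>)
    have Rc: "R \<in> cont_mat M ?N"
    proof (rule cont_matI[where f = "\<lambda>i j x. (if i = j then 1 else 0) - (v x $ i - (if i = 0 then 1 else 0)) *
        cnj (v x $ j - (if j = 0 then 1 else 0)) / (1 - cnj (v x $ 0))"])
      fix i j assume ij: "i < ?N" "j < ?N"
      show "continuous_map M euclidean (\<lambda>x. (if i = j then 1 else 0) - (v x $ i - (if i = 0 then 1 else 0)) *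
        cnj (v x $ j - (if j = 0 then 1 else 0)) / (1 - cnj (v x $ 0)))"
      proof (intro cmap_intros v ij)
        fix x assume "x \<in> topspace M"
        then have "v x $ 0 \<noteq> 1" using v' by blast
        then show "1 - cnj (v x $ 0) \<noteq> 0" by (metis complex_cnj_cnj complex_cnj_one eq_iff_diff_eq_0)
      qed simp
    qed (auto simp: R_def householder_def)
    define B where "B = (\<lambda>x. mat_adjoint (R x) * A x * R x)"
    have Bc: "B \<in> cont_mat M ?N" unfolding B_def
      by (rule cont_mat_mult[OF cont_mat_mult[OF cont_mat_adjoint[OF Rc] A(1)] Rc])
    have Bcar: "B x \<in> carrier_mat ?N ?N" if "x \<in> topspace M" for x by (rule cont_mat_carrier[OF Bc that])
    have Bherm: "mat_adjoint (B x) = B x" if "x \<in> topspace M" for x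
      unfolding B_def by (rule hermitian_conj[OF A(2,3)[OF that] unitary_matD(1)[OF Ru[OF that]]])
    have Blam: "ordered_eigenvalues (B x) (\<lambda>i. lam i x)" if "x \<in> topspace M" for x
      using lam[OF that] A(2)[OF that] Bcar[OF that] char_poly_unitary_conj[OF Ru[OF that] A(2)[OF that]]
      by (auto simp: ordered_eigenvalues_def B_def)
    define C where "C = (\<lambda>x. minor_00 (B x))"
    have Ccar: "C x \<in> carrier_mat n n" if "x \<in> topspace M" for x
      unfolding C_def by (rule minor_00_carrier[OF Bcar[OF that]])
    have Cherm: "mat_adjoint (C x) = C x" if x: "x \<in> topspace M" for x
    proof (rule eq_matI)
      fix i j assume "i < dim_row (C x)" "j < dim_col (C x)"
      then have ij: "i < n" "j < n" using Ccar[OF x] by auto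
      have "mat_adjoint (B x) $$ (Suc i, Suc j) = B x $$ (Suc i, Suc j)" using Bherm[OF x] by simp
      then show "mat_adjoint (C x) $$ (i, j) = C x $$ (i, j)"
        using ij Bcar[OF x] Ccar[OF x] by (simp add: C_def minor_00_index[OF Bcar[OF x]])
    qed (use Ccar[OF x] in auto)
    have "C \<in> cont_mat M n"
      by (rule cont_matI[where f = "\<lambda>i j x. B x $$ (Suc i, Suc j)"])
        (auto intro: cont_mat_index[OF Bc] simp: Ccar C_def minor_00_index[OF Bcar] minor_00_carrier[OF Bcar])
    then have Csa: "C \<in> cont_self_adjoint M n" using Cherm by (simp add: cont_self_adjoint_def)
    have "\<exists>l. ordered_eigenvalues (C x) l" if "x \<in> topspace M" for x
      by (rule exists_ordered_eigenvalues[OF Ccar[OF that] Cherm[OF that]])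
    then obtain mu where mu: "\<And>x. x \<in> topspace M \<Longrightarrow> ordered_eigenvalues (C x) (mu x)" by metis
    obtain U where U: "U \<in> cont_unitary M n" and U': "\<And>x. x \<in> topspace M \<Longrightarrow>
      fnorm (mat_adjoint (U x) * C x * U x - mat_diag n (\<lambda>i. complex_of_real (mu x i))) < \<eta> / 2"
      using Suc.IH[OF Csa, of "\<lambda>i x. mu x i", OF mu e2] by blast
    have Uu: "unitary_mat n (U x)" if "x \<in> topspace M" for x using U that by (simp add: cont_unitary_iff)
    define S where "S = (\<lambda>x. diag_sum 1 (U x))"
    have Su: "unitary_mat ?N (S x)" if "x \<in> topspace M" for x
      unfolding S_def by (rule unitary_diag_sum[OF Uu[OF that]])
    have Sc: "S \<in> cont_mat M ?N"
    proof (rule cont_matI[where f = "\<lambda>i j x. if i = 0 then if j = 0 then 1 else 0 else if j = 0 then 0 else U x $$ (i - 1, j - 1)"])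
      fix i j assume ij: "i < ?N" "j < ?N"
      have "continuous_map M euclidean (\<lambda>x. U x $$ (i - 1, j - 1))" if "i \<noteq> 0" "j \<noteq> 0"
        by (rule cont_mat_index) (use U ij that in \<open>auto simp: cont_unitary_iff\<close>)
      then show "continuous_map M euclidean (\<lambda>x. if i = 0 then if j = 0 then 1 else 0 else if j = 0 then 0 else U x $$ (i - 1, j - 1))"
        by simp
      fix x assume x: "x \<in> topspace M"
      show "(if i = 0 then if j = 0 then 1 else 0 else if j = 0 then 0 else U x $$ (i - 1, j - 1)) = S x $$ (i, j)"
        unfolding S_def using unitary_matD(1)[OF Uu[OF x]] ij by (subst diag_sum_index) auto
    qed (use unitary_matD(1)[OF Su] in auto)
    define V where "V = (\<lambda>x. R x * S x)"
    have Vu: "unitary_mat ?N (V x)" if "x \<in> topspace M" for x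
      unfolding V_def by (rule unitary_mat_mult[OF Ru[OF that] Su[OF that]])
    have Vcu: "V \<in> cont_unitary M ?N"
      unfolding cont_unitary_iff using Vu cont_mat_mult[OF Rc Sc] by (simp add: V_def)
    show ?thesis
    proof (intro bexI[OF _ Vcu] ballI)
      fix x assume x: "x \<in> topspace M"
      note cR = unitary_matD[OF Ru[OF x]] and cS = unitary_matD[OF Su[OF x]] and cU = unitary_matD[OF Uu[OF x]]
        and cV = unitary_matD[OF Vu[OF x]]
      define c where "c = complex_of_real (lam 0 x)"
      define E where "E = mat_adjoint (V x) * A x * V x"
      have Ec: "E \<in> carrier_mat ?N ?N" using cV A(2)[OF x] by (simp add: E_def)
      have EB: "E = mat_adjoint (S x) * B x * S x"
        unfolding E_def V_def B_def using cR(1,2) cS(1,2) A(2)[OF x]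
        by (simp add: mat_adjoint_mult[of _ ?N ?N _ ?N] assoc_mult_mat[of _ ?N ?N _ ?N _ ?N])
      have dC: "diag_sum c (C x) \<in> carrier_mat ?N ?N" by (rule diag_sum_carrier[OF Ccar[OF x]])
      \<comment> \<open>Conjugation by \<open>S x\<close> fixes the scalar corner, so the deflation
        error of \<open>B x\<close> is carried over with unchanged norm.\<close>
      have eqC: "mat_adjoint (S x) * diag_sum c (C x) * S x = diag_sum c (mat_adjoint (U x) * C x * U x)"
        unfolding S_def diag_sum_adjoint using cU(1,2) Ccar[OF x] by (simp add: diag_sum_mult[of _ n n _ n])
      have "E - diag_sum c (mat_adjoint (U x) * C x * U x) = mat_adjoint (S x) * (B x - diag_sum c (C x)) * S x"
        unfolding EB eqC[symmetric] using cS(1,2) Bcar[OF x] dC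
        by (simp add: mult_minus_distrib_mat[of _ ?N ?N _ ?N] minus_mult_distrib_mat[of _ ?N ?N _ _ ?N])
      then have "fnorm (E - diag_sum c (mat_adjoint (U x) * C x * U x)) = fnorm (B x - diag_sum c (C x))"
        using fnorm_unitary_right[OF Su[OF x], of "mat_adjoint (S x) * (B x - diag_sum c (C x))" ?N]
          fnorm_unitary_left[OF unitary_mat_adjoint[OF Su[OF x]], of "B x - diag_sum c (C x)" ?N] cS(1,2) minus_carrier_mat[OF dC]
        by simp
      also have "\<dots> \<le> K * (\<eta> / (2 * K))"
        unfolding B_def C_def c_def K_def
        by (rule fnorm_deflation[OF A(2,3)[OF x] Ru[OF x]]) (use v'[OF x] in \<open>simp add: Rcol[OF x] K_def\<close>)
      also have "\<dots> = \<eta> / 2" using K by simp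
      finally have 1: "fnorm (E - diag_sum c (mat_adjoint (U x) * C x * U x)) \<le> \<eta> / 2" .
      \<comment> \<open>The diagonal reached by this step: the top eigenvalue of \<open>A x\<close>,
        then the eigenvalues of the compression.\<close>
      define \<nu> where "\<nu> = (\<lambda>i. case i of 0 \<Rightarrow> lam 0 x | Suc j \<Rightarrow> mu x j)"
      have D\<nu>: "diag_sum c (mat_diag n (\<lambda>i. complex_of_real (mu x i))) = mat_diag ?N (\<lambda>i. complex_of_real (\<nu> i))"
        using diag_sum_diag[of "\<lambda>i. complex_of_real (\<nu> i)" n] by (simp add: \<nu>_def c_def)
      have UCU: "mat_adjoint (U x) * C x * U x \<in> carrier_mat n n" using cU Ccar[OF x] by simp
      have 2: "fnorm (diag_sum c (mat_adjoint (U x) * C x * U x) - mat_diag ?N (\<lambda>i. complex_of_real (\<nu> i))) < \<eta> / 2"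
        unfolding D\<nu>[symmetric] fnorm_diag_sum_diff[OF UCU mat_diag_dim] by (rule U'[OF x])
      have 3: "fnorm (E - mat_diag ?N (\<lambda>i. complex_of_real (\<nu> i))) \<le> \<eta>"
        using fnorm_triangle[OF Ec diag_sum_carrier[OF UCU, of c] mat_diag_dim, of "\<lambda>i. complex_of_real (\<nu> i)"] 1 2 by simp
      have Eherm: "mat_adjoint E = E" unfolding E_def by (rule hermitian_conj[OF A(2,3)[OF x] cV(1)])
      have Elam: "ordered_eigenvalues E (\<lambda>i. lam i x)"
        using lam[OF x] A(2)[OF x] Ec char_poly_unitary_conj[OF Vu[OF x] A(2)[OF x]]
        by (auto simp: ordered_eigenvalues_def E_def)
      have mu0: "mu x 0 \<le> lam 0 x"
        by (rule top_eigenvalue_minor_le[OF Bcar[OF x] Bherm[OF x] Blam[OF x]])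
          (use Cherm[OF x] mu[OF x] False in \<open>auto simp: C_def\<close>)
      have mumono: "mu x j \<le> mu x i" if "i \<le> j" "j < n" for i j
        using mu[OF x] Ccar[OF x] that by (auto simp: ordered_eigenvalues_def)
      have "\<nu> j \<le> \<nu> i" if "i \<le> j" "j < ?N" for i j
        using that mumono mu0 mumono[of 0] by (cases i; cases j) (force simp: \<nu>_def)+
      then have D\<nu>ord: "ordered_eigenvalues (mat_diag ?N (\<lambda>i. complex_of_real (\<nu> i))) \<nu>"
        unfolding ordered_eigenvalues_def by (auto simp: char_poly_diag)
      have "\<bar>lam k x - \<nu> k\<bar> \<le> \<eta>" if "k < ?N" for k
        using weyl_inequality[OF Ec Eherm Elam mat_diag_dim mat_adjoint_diag_real D\<nu>ord that] 3 by simp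
      then have "fnorm (mat_diag ?N (\<lambda>i. complex_of_real (\<nu> i)) - mat_diag ?N (\<lambda>i. complex_of_real (lam i x))) \<le> K * \<eta>"
        unfolding K_def
        by (intro fnorm_bound minus_carrier_mat mat_diag_dim)
          (use \<eta> in \<open>auto simp: abs_minus_commute simp flip: of_real_diff\<close>)
      then have "fnorm (E - mat_diag ?N (\<lambda>i. complex_of_real (lam i x))) \<le> \<eta> + K * \<eta>"
        using fnorm_triangle[OF Ec mat_diag_dim mat_diag_dim, of "\<lambda>i. complex_of_real (lam i x)" "\<lambda>i. complex_of_real (\<nu> i)"] 3
        by simp
      also have "\<dots> = 2 * (\<eta> + K * \<eta>) / 2" by simp
      also have "\<dots> < \<epsilon>" unfolding \<eta>2 using \<epsilon> by simp
      finally show "fnorm (mat_adjoint (V x) * A x * V x - mat_diag ?N (\<lambda>i. complex_of_real (lam i x))) < \<epsilon>"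
        by (simp add: E_def)
    qed
  qed
qed

theorem theorem4p1:
  fixes M :: "'a topology"
  assumes "compact_space M" and "Hausdorff_space M"
    and "covering_dim_le M 2"
    and "trivial_group (cech_cohomology M 2)"
  shows "C_approx_diagonal M \<and>
    (\<forall>n\<ge>2. \<forall>A\<in>cont_self_adjoint M n. \<forall>lam :: nat \<Rightarrow> 'a \<Rightarrow> real.
       (\<forall>x\<in>topspace M. ordered_eigenvalues (A x) (\<lambda>i. lam i x)) \<longrightarrow>
       (\<forall>\<epsilon>>0. \<exists>U\<in>cont_unitary M n. \<forall>x\<in>topspace M.
          op_norm (mat_adjoint (U x) * A x * U x
            - mat_diag n (\<lambda>i. complex_of_real (lam i x))) < \<epsilon>))"
proof -
  have main: "\<exists>U\<in>cont_unitary M n. \<forall>x\<in>topspace M.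
      op_norm (mat_adjoint (U x) * A x * U x - mat_diag n (\<lambda>i. complex_of_real (lam i x))) < \<epsilon>"
    if "A \<in> cont_self_adjoint M n" "\<forall>x\<in>topspace M. ordered_eigenvalues (A x) (\<lambda>i. lam i x)" "\<epsilon> > 0"
    for n A and lam :: "nat \<Rightarrow> 'a \<Rightarrow> real" and \<epsilon>
    using approximate_diagonalization[OF assms that(1) _ that(3), of lam] that(2) op_norm_le_fnorm
    by (meson le_less_trans)
  have "approx_diagonalizable M n A" if A: "A \<in> cont_self_adjoint M n" for n A
    unfolding approx_diagonalizable_def
  proof (intro allI impI)
    fix \<epsilon> :: real assume \<epsilon>: "\<epsilon> > 0"
    note A' = cont_self_adjointD[OF A]
    have "\<exists>l. ordered_eigenvalues (A x) l" if "x \<in> topspace M" for x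
      by (rule exists_ordered_eigenvalues[OF A'(2,3)[OF that]])
    then obtain l where l: "\<And>x. x \<in> topspace M \<Longrightarrow> ordered_eigenvalues (A x) (l x)" by metis
    \<comment> \<open>The supremum over the space turns strict pointwise bounds into a weak one,
      hence the half.\<close>
    have "\<epsilon> / 2 > 0" using \<epsilon> by simp
    with main[OF A, of "\<lambda>i x. l x i"] l obtain U where U: "U \<in> cont_unitary M n"
      "\<And>x. x \<in> topspace M \<Longrightarrow> op_norm (mat_adjoint (U x) * A x * U x - mat_diag n (\<lambda>i. complex_of_real (l x i))) < \<epsilon> / 2"
      by blast
    show "\<exists>U\<in>cont_unitary M n. \<exists>a :: nat \<Rightarrow> 'a \<Rightarrow> complex.
        (\<forall>i<n. continuous_map M euclidean (a i)) \<and>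
        cstar_norm M (\<lambda>x. U x * A x * mat_adjoint (U x) - mat_diag n (\<lambda>i. a i x)) < \<epsilon>"
    proof (intro bexI exI conjI allI impI)
      \<comment> \<open>Approximate diagonalisability conjugates with the adjoint on the right, the
        eigenvalue statement with the adjoint on the left, so the witness is the adjoint of
        \<open>U\<close>.\<close>
      show "(\<lambda>x. mat_adjoint (U x)) \<in> cont_unitary M n"
        using U(1) by (auto simp: cont_unitary_iff intro: cont_mat_adjoint unitary_mat_adjoint)
      show "continuous_map M euclidean (\<lambda>x. complex_of_real (l x i))" if "i < n" for i
        by (rule continuous_map_of_real[OF continuous_map_eigenvalue[OF A, of "\<lambda>i x. l x i", OF l that]])
      have "cstar_norm M (\<lambda>x. mat_adjoint (U x) * A x * mat_adjoint (mat_adjoint (U x)) - mat_diag n (\<lambda>i. complex_of_real (l x i))) \<le> \<epsilon> / 2"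
        unfolding cstar_norm_def by (rule cSup_least) (use U(2) \<epsilon> in \<open>auto simp: less_imp_le\<close>)
      then show "cstar_norm M (\<lambda>x. mat_adjoint (U x) * A x * mat_adjoint (mat_adjoint (U x)) - mat_diag n (\<lambda>i. complex_of_real (l x i))) < \<epsilon>"
        using \<epsilon> by linarith
    qed
  qed
  then have "C_approx_diagonal M" by (simp add: C_approx_diagonal_def)
  then show ?thesis using main by blast
qed

end
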